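(* Let $R$ be a local principal ideal ring of length two with maximal ideal $(\pi)$ and residue field $k$. Let $p\in k[t]$ be monic irreducible of degree $d$, $\lambda_1\ge\dots\ge\lambda_l\ge1$ integers, $A=C_{p^{\lambda_1}}\oplus\dots\oplus C_{p^{\lambda_l}}\in M_n(k)$ with $n=d(\lambda_1+\dots+\lambda_l)$, $\mathbf p\in R[t]$ a monic lift of $p$, and $\mathbf A_0=C_{\mathbf p^{\lambda_1}}\oplus\dots\oplus C_{\mathbf p^{\lambda_l}}\in M_n(R)$. Suppose that $\xi\in\mathrm{Ext}^1_{k[t]}(M^A,M^A)$ has $E(\xi)=(\epsilon_{ij})$, where each entry is represented by a polynomial $\epsilon_{ij}=\epsilon_{ij}^0+\epsilon_{ij}^1t+\dots+\epsilon_{ij}^{d\lambda_i-1}t^{d\lambda_i-1}\in k[t]$ of degree less than $d\lambda_i$. Then $$\mathbf A_\xi=\mathbf A_0+\pi\phi(\epsilon),$$ where $\phi(\epsilon)$ is the $l\times l$ block matrix with $(i,j)$th block of size $(d\lambda_i)\times(d\lambda_j)$ given by $$\phi(\epsilon)_{ij}=\begin{pmatrix}0&\cdots&0&\epsilon_{ij}^0\\0&\cdots&0&\epsilon_{ij}^1\\\vdots&&\vdots&\vdots\\0&\cdots&0&\epsilon_{ij}^{d\lambda_i-1}\end{pmatrix}.$$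
   Context: For $X\in M_n(k)$, $\pi X\in M_n(R)$ denotes $\pi$ times any lift of $X$. $C_f$ denotes the companion matrix of a monic polynomial $f$: the matrix of multiplication by $t$ on $k[t]/f$ (or $R[t]/f$) in the basis $1,t,\dots,t^{\deg f-1}$. $M^A$ is the $k[t]$-module $k^n$ with $t$ acting by $A$, so $M^A=k[t]/p^{\lambda_1}\oplus\dots\oplus k[t]/p^{\lambda_l}$, with generators $e_1,\dots,e_l$ (the images of $1$ in the summands); it is also an $R[t]$-module via $R[t]\to k[t]$. Matrix of an extension: for a class $\xi$ of $0\to M^A\xrightarrow{i}M\xrightarrow{q}M^A\to0$ in $\mathrm{Ext}^1_{k[t]}(M^A,M^A)$, choose $\tilde f_j\in M$ with $q(\tilde f_j)=e_j$ and write $p^{\lambda_j}\tilde f_j=\sum_i\epsilon_{ij}\,i(e_i)$ with $\epsilon_{ij}\in k[t]$. Then $E(\xi)=(\epsilon_{ij})$, where $\epsilon_{ij}$ is well defined modulo $p^{\min(\lambda_i,\lambda_j)}$. The matrix $\mathbf A_\xi$: $\xi_{\mathbf A_0}\in\mathrm{Ext}^1_{R[t]}(M^A,M^A)$ is the class of $0\to M^A\xrightarrow{\pi}M^{\mathbf A_0}\to M^A\to0$, where $M^{\mathbf A_0}$ is $R^n$ with $t$ acting by $\mathbf A_0$, the first map is $x\mapsto\pi\tilde x$ for any lift $\tilde x$ of $x$, and the second is reduction. Let $\iota:\mathrm{Ext}^1_{k[t]}(M^A,M^A)\to \mathrm{Ext}^1_{R[t]}(M^A,M^A)$ be the natural map.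 Take an extension of $R[t]$-modules $0\to M^A\to E\to M^A\to0$ in the class $\iota(\xi)+\xi_{\mathbf A_0}$; $E$ is free of rank $n$ over $R$ and $\mathbf A_\xi$ is the matrix of multiplication by $t$ on $E$ in any $R$-basis lifting the standard basis of $M^A$. Thus $\mathbf A_\xi$ is defined only up to conjugation by $\ker(\mathrm{GL}_n(R)\to\mathrm{GL}_n(k))$, and the asserted equality is understood up to such conjugation. *)

theory Defs
  imports "Jordan_Normal_Form.VS_Connect" "HOL-Algebra.QuotRing"
begin

section \<open>Rings\<close>

definition principal_ideal_ring :: "('a, 'b) ring_scheme \<Rightarrow> bool" where
  "principal_ideal_ring R \<longleftrightarrow> cring R \<and> (\<forall>I. ideal I R \<longrightarrow> principalideal I R)"

definition local_ring :: "('a, 'b) ring_scheme \<Rightarrow> bool" where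
  "local_ring R \<longleftrightarrow> cring R \<and> (\<exists>!I. maximalideal I R)"

text \<open>The ring has a composition series of length \<open>n\<close> as a module over itself.\<close>

definition has_length :: "('a, 'b) ring_scheme \<Rightarrow> nat \<Rightarrow> bool" where
  "has_length R n \<longleftrightarrow> (\<exists>I. I 0 = {\<zero>\<^bsub>R\<^esub>} \<and> I n = carrier R \<and> (\<forall>i\<le>n. ideal (I i) R) \<and>
     (\<forall>i<n. I i \<subset> I (Suc i) \<and> (\<nexists>J. ideal J R \<and> I i \<subset> J \<and> J \<subset> I (Suc i))))"

text \<open>The field \<open>'k\<close> together with the reduction map \<open>red\<close> is a model of the residue field
  \<open>R/(\<pi>)\<close>.\<close>

definition residue_map :: "'r::comm_ring_1 \<Rightarrow> ('r \<Rightarrow> 'k::field) \<Rightarrow> bool" where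
  "residue_map \<pi> red \<longleftrightarrow> comm_ring_hom red \<and> surj red \<and>
     {x. red x = 0} = PIdl\<^bsub>class_ring\<^esub> \<pi>"

section \<open>Modules\<close>

text \<open>In HOL-Algebra a module record extends a ring record; its fields \<open>mult\<close> and \<open>one\<close> carry
  no meaning and are filled with zeros.\<close>

definition restrict_scalars :: "('s \<Rightarrow> 'a) \<Rightarrow> ('a, 'm) module \<Rightarrow> ('s, 'm) module" where
  "restrict_scalars h M = \<lparr>carrier = carrier M, mult = (\<lambda>_ _. \<zero>\<^bsub>M\<^esub>), one = \<zero>\<^bsub>M\<^esub>,
     zero = \<zero>\<^bsub>M\<^esub>, add = add M, smult = (\<lambda>s x. h s \<odot>\<^bsub>M\<^esub> x)\<rparr>"

definition quotient_module :: "('a, 'm) module \<Rightarrow> 'm set \<Rightarrow> ('a, 'm set) module" where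
  "quotient_module M K = \<lparr>carrier = a_rcosets\<^bsub>M\<^esub> K, mult = (\<lambda>_ _. K), one = K, zero = K,
     add = (\<lambda>C D. C <+>\<^bsub>M\<^esub> D), smult = (\<lambda>s C. \<Union>x\<in>C. K +>\<^bsub>M\<^esub> (s \<odot>\<^bsub>M\<^esub> x))\<rparr>"

text \<open>The module \<open>M\<^sup>A\<close>: column vectors of length \<open>n\<close>, on which a polynomial \<open>f\<close> acts as
  \<open>f(A)\<close>, so that \<open>t\<close> acts as \<open>A\<close>.\<close>

definition matrix_module :: "nat \<Rightarrow> 'a::comm_ring_1 mat \<Rightarrow> ('a poly, 'a vec) module" where
  "matrix_module n A = \<lparr>carrier = carrier_vec n, mult = (\<lambda>_ _. 0\<^sub>v n), one = 0\<^sub>v n,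
     zero = 0\<^sub>v n, add = (+),
     smult = (\<lambda>f v. finsum_vec TYPE('a) n (\<lambda>i. coeff f i \<cdot>\<^sub>v ((A ^\<^sub>m i) *\<^sub>v v)) {..degree f})\<rparr>"

section \<open>Extensions and $\mathrm{Ext}^1$\<close>

text \<open>Data of a sequence \<open>0 \<rightarrow> N \<rightarrow> E \<rightarrow> M \<rightarrow> 0\<close>; the type parameters are those of the scalars
  and of the elements of \<open>N\<close>, \<open>E\<close> and \<open>M\<close>.\<close>

record ('a, 'n, 'e, 'm) extension =
  mid :: "('a, 'e) module"
  inj_map :: "'n \<Rightarrow> 'e"
  proj_map :: "'e \<Rightarrow> 'm"

definition is_extension ::
  "'a ring \<Rightarrow> ('a, 'm) module \<Rightarrow> ('a, 'n) module \<Rightarrow> ('a, 'n, 'e, 'm) extension \<Rightarrow> bool" where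
  "is_extension S M N X \<longleftrightarrow> module S (mid X) \<and>
     inj_map X \<in> LinearCombinations.module_hom S N (mid X) \<and> proj_map X \<in> LinearCombinations.module_hom S (mid X) M \<and>
     inj_on (inj_map X) (carrier N) \<and> proj_map X ` carrier (mid X) = carrier M \<and>
     inj_map X ` carrier N = {x \<in> carrier (mid X). proj_map X x = \<zero>\<^bsub>M\<^esub>}"

definition ext_equiv :: "'a ring \<Rightarrow> ('a, 'n) module \<Rightarrow>
    ('a, 'n, 'e, 'm) extension \<Rightarrow> ('a, 'n, 'f, 'm) extension \<Rightarrow> bool" where
  "ext_equiv S N X Y \<longleftrightarrow> (\<exists>\<phi> \<in> LinearCombinations.module_hom S (mid X) (mid Y).
     bij_betw \<phi> (carrier (mid X)) (carrier (mid Y)) \<and>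
     (\<forall>a \<in> carrier N. \<phi> (inj_map X a) = inj_map Y a) \<and>
     (\<forall>x \<in> carrier (mid X). proj_map Y (\<phi> x) = proj_map X x))"

text \<open>Every extension of \<open>M\<close> by \<open>N\<close>, whatever the type of its middle term, is in bijection
  with \<open>N \<times> M\<close> and hence equivalent to one whose middle term lives on the type
  \<open>'n \<times> 'm\<close>. An equivalence class therefore collects the extensions on that type, and in this
  way classes of extensions on different types become comparable.\<close>

definition ext_class :: "'a ring \<Rightarrow> ('a, 'm) module \<Rightarrow> ('a, 'n) module \<Rightarrow>
    ('a, 'n, 'e, 'm) extension \<Rightarrow> ('a, 'n, 'n \<times> 'm, 'm) extension set" where
  "ext_class S M N X = {Y. is_extension S M N Y \<and> ext_equiv S N X Y}"

definition Ext1 :: "'a ring \<Rightarrow> ('a, 'm) module \<Rightarrow> ('a, 'n) module \<Rightarrow>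
    ('a, 'n, 'n \<times> 'm, 'm) extension set set" where
  "Ext1 S M N = {ext_class S M N X | X :: ('a, 'n, 'n \<times> 'm, 'm) extension. is_extension S M N X}"

text \<open>The Baer sum: the fibre product of the two middle terms over \<open>M\<close>, modulo the
  antidiagonal copy of \<open>N\<close>.\<close>

definition baer_sum :: "('a, 'n) module \<Rightarrow> ('a, 'n, 'e, 'm) extension \<Rightarrow>
    ('a, 'n, 'f, 'm) extension \<Rightarrow> ('a, 'n, ('e \<times> 'f) set, 'm) extension" where
  "baer_sum N X Y =
    (let P = (direct_sum (mid X) (mid Y))
           \<lparr>carrier := {(x, y) \<in> carrier (mid X) \<times> carrier (mid Y). proj_map X x = proj_map Y y}\<rparr>;
         K = (\<lambda>a. (inj_map X a, \<ominus>\<^bsub>mid Y\<^esub> inj_map Y a)) ` carrier N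
     in \<lparr>mid = quotient_module P K,
         inj_map = (\<lambda>a. K +>\<^bsub>P\<^esub> (inj_map X a, \<zero>\<^bsub>mid Y\<^esub>)),
         proj_map = (\<lambda>C. proj_map X (fst (SOME c. c \<in> C)))\<rparr>)"

definition ext_add :: "'a ring \<Rightarrow> ('a, 'm) module \<Rightarrow> ('a, 'n) module \<Rightarrow>
    ('a, 'n, 'n \<times> 'm, 'm) extension set \<Rightarrow> ('a, 'n, 'n \<times> 'm, 'm) extension set \<Rightarrow>
    ('a, 'n, 'n \<times> 'm, 'm) extension set" where
  "ext_add S M N \<xi> \<eta> = (\<Union>X\<in>\<xi>. \<Union>Y\<in>\<eta>. ext_class S M N (baer_sum N X Y))"

text \<open>The natural map from \<open>Ext\<^sup>1\<close> over the target of \<open>h\<close> to \<open>Ext\<^sup>1\<close> over its source \<open>S\<close>.\<close>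

definition ext_restrict :: "'s ring \<Rightarrow> ('s \<Rightarrow> 'a) \<Rightarrow> ('a, 'm) module \<Rightarrow> ('a, 'n) module \<Rightarrow>
    ('a, 'n, 'n \<times> 'm, 'm) extension set \<Rightarrow> ('s, 'n, 'n \<times> 'm, 'm) extension set" where
  "ext_restrict S h M N \<xi> =
    (\<Union>X\<in>\<xi>. ext_class S (restrict_scalars h M) (restrict_scalars h N)
       \<lparr>mid = restrict_scalars h (mid X), inj_map = inj_map X, proj_map = proj_map X\<rparr>)"

section \<open>Companion matrices and the module $M^A$\<close>

text \<open>Multiplication by \<open>t\<close> in the basis \<open>1, t, \<dots>\<close> modulo a monic \<open>f\<close>; see the lemma below.\<close>

definition companion :: "'a::comm_ring_1 poly \<Rightarrow> 'a mat" where
  "companion f = mat (degree f) (degree f)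
     (\<lambda>(i, j). if Suc j = degree f then - coeff f i else if i = Suc j then 1 else 0)"

lemma companion_mult_t:
  assumes "lead_coeff f = 1" and "j < degree f"
  shows "f dvd [:0, 1:] * monom 1 j - (\<Sum>i<degree f. monom (companion f $$ (i, j)) i)"
proof (cases "Suc j = degree f")
  case True
  have "[:0, 1:] * monom 1 j = monom (1::'a) (degree f)"
    using True by (simp add: monom_Suc flip: True)
  moreover have "(\<Sum>i<degree f. monom (companion f $$ (i, j)) i) = - (\<Sum>i<degree f. monom (coeff f i) i)"
    unfolding sum_negf[symmetric] minus_monom
    using True assms(2) by (intro sum.cong) (auto simp: companion_def)
  moreover have "f = monom 1 (degree f) + (\<Sum>i<degree f. monom (coeff f i) i)"
  proof -
    have "f = (\<Sum>i\<le>degree f. monom (coeff f i) i)"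
      by (rule poly_as_sum_of_monoms[symmetric])
    also have "{..degree f} = insert (degree f) {..<degree f}"
      by auto
    finally show ?thesis
      using assms(1) by simp
  qed
  ultimately have "f = [:0, 1:] * monom 1 j - (\<Sum>i<degree f. monom (companion f $$ (i, j)) i)"
    by simp
  then show ?thesis by (metis dvd_refl)
next
  case False
  have "(\<Sum>i<degree f. monom (companion f $$ (i, j)) i)
      = (\<Sum>i<degree f. if i = Suc j then monom 1 (Suc j) else 0)"
    using False assms(2) by (intro sum.cong) (auto simp: companion_def)
  also have "\<dots> = monom 1 (Suc j)"
    using False assms(2) by simp
  finally show ?thesis by (simp add: monom_Suc)
qed

definition block_sizes :: "nat \<Rightarrow> nat list \<Rightarrow> nat list" where
  "block_sizes d ls = map (\<lambda>m. d * m) ls"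

definition companion_sum :: "'a::comm_ring_1 poly \<Rightarrow> nat list \<Rightarrow> 'a mat" where
  "companion_sum p ls = diag_block_mat (map (\<lambda>m. companion (p ^ m)) ls)"

text \<open>The generator \<open>e\<^sub>j\<close>, i.e. the image of \<open>1\<close> in the \<open>j\<close>-th summand, is the first
  standard basis vector of the \<open>j\<close>-th block (blocks are numbered from \<open>0\<close>).\<close>

definition gen :: "nat \<Rightarrow> nat list \<Rightarrow> nat \<Rightarrow> 'a::zero_neq_one vec" where
  "gen d ls j = unit_vec (d * sum_list ls) (sum_list (take j (block_sizes d ls)))"

section \<open>The matrix of an extension\<close>

text \<open>The \<open>(i, j)\<close> entry of \<open>E(\<xi>)\<close>, as a residue class modulo \<open>p ^ min \<lambda>\<^sub>i \<lambda>\<^sub>j\<close>.\<close>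

definition ext_matrix :: "'k::field poly \<Rightarrow> nat list \<Rightarrow>
    ('k poly, 'k vec, 'e, 'k vec) extension set \<Rightarrow> nat \<Rightarrow> nat \<Rightarrow> 'k poly set" where
  "ext_matrix p ls \<xi> i j = {e. \<exists>X\<in>\<xi>. \<exists>f \<epsilon>.
     (\<forall>j'<length ls. f j' \<in> carrier (mid X) \<and> proj_map X (f j') = gen (degree p) ls j' \<and>
        p ^ (ls ! j') \<odot>\<^bsub>mid X\<^esub> f j' =
          (\<Oplus>\<^bsub>mid X\<^esub>i'\<in>{..<length ls}. \<epsilon> i' j' \<odot>\<^bsub>mid X\<^esub> inj_map X (gen (degree p) ls i'))) \<and>
     p ^ min (ls ! i) (ls ! j) dvd e - \<epsilon> i j}"

section \<open>The matrix $\mathbf{A}_\xi$\<close>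

text \<open>\<open>\<pi>\<close> times a lift of \<open>x\<close>; independent of the lift because \<open>\<pi>\<^sup>2 = 0\<close> in a local principal
  ideal ring of length two. Vectors and matrices are lifted entrywise.\<close>

definition pi_lift :: "'r::comm_ring_1 \<Rightarrow> ('r \<Rightarrow> 'k) \<Rightarrow> 'k \<Rightarrow> 'r" where
  "pi_lift \<pi> red x = \<pi> * (SOME y. red y = x)"

definition lift_extension :: "'r::comm_ring_1 \<Rightarrow> ('r \<Rightarrow> 'k::field) \<Rightarrow> nat \<Rightarrow> 'r mat \<Rightarrow>
    ('r poly, 'k vec, 'r vec, 'k vec) extension" where
  "lift_extension \<pi> red n A0 = \<lparr>mid = matrix_module n A0,
     inj_map = map_vec (pi_lift \<pi> red), proj_map = map_vec red\<rparr>"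

text \<open>\<open>B\<close> is the matrix of multiplication by \<open>t\<close> on the middle term with respect to some
  \<open>R\<close>-basis \<open>b\<^sub>0, \<dots>, b\<^sub>n\<^sub>-\<^sub>1\<close> lifting the standard basis of \<open>k\<^sup>n\<close>. Elements of \<open>R\<close> act as constant
  polynomials.\<close>

definition is_t_matrix :: "nat \<Rightarrow> ('r::comm_ring_1 poly, 'k::field vec, 'e, 'k vec) extension \<Rightarrow>
    'r mat \<Rightarrow> bool" where
  "is_t_matrix n X B \<longleftrightarrow> B \<in> carrier_mat n n \<and> (\<exists>b.
     (\<forall>j<n. b j \<in> carrier (mid X) \<and> proj_map X (b j) = unit_vec n j) \<and>
     bij_betw (\<lambda>c. \<Oplus>\<^bsub>mid X\<^esub>j\<in>{..<n}. [:c $ j:] \<odot>\<^bsub>mid X\<^esub> b j) (carrier_vec n) (carrier (mid X)) \<and>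
     (\<forall>j<n. [:0, 1:] \<odot>\<^bsub>mid X\<^esub> b j = (\<Oplus>\<^bsub>mid X\<^esub>i\<in>{..<n}. [:B $$ (i, j):] \<odot>\<^bsub>mid X\<^esub> b i)))"

text \<open>Since \<open>A\<^sub>\<xi>\<close> depends on the choice of an extension in the class \<open>\<iota>(\<xi>) + \<xi>\<^sub>A\<^sub>0\<close> and of a
  basis, it is represented by the set of all matrices arising from such choices.\<close>

definition A_xi :: "'r::comm_ring_1 \<Rightarrow> ('r \<Rightarrow> 'k::field) \<Rightarrow> nat \<Rightarrow> 'k mat \<Rightarrow> 'r mat \<Rightarrow>
    ('k poly, 'k vec, 'k vec \<times> 'k vec, 'k vec) extension set \<Rightarrow> 'r mat set" where
  "A_xi \<pi> red n A A0 \<xi> =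
    (let h = map_poly red; M = matrix_module n A; M' = restrict_scalars h M
     in {B. \<exists>X \<in> ext_add class_ring M' M' (ext_restrict class_ring h M M \<xi>)
                 (ext_class class_ring M' M' (lift_extension \<pi> red n A0)).
            is_t_matrix n X B})"

text \<open>Orbit of \<open>B\<close> under conjugation by \<open>ker(GL\<^sub>n(R) \<rightarrow> GL\<^sub>n(k))\<close>.\<close>

definition congruence_conjugates :: "('r::comm_ring_1 \<Rightarrow> 'k::field) \<Rightarrow> nat \<Rightarrow> 'r mat \<Rightarrow> 'r mat set" where
  "congruence_conjugates red n B =
    {C. \<exists>P Q. similar_mat_wit C B P Q \<and> map_mat red P = 1\<^sub>m n}"

section \<open>Block matrices\<close>

text \<open>The block containing a global index, and the position inside that block.\<close>

fun block_pos :: "nat list \<Rightarrow> nat \<Rightarrow> nat \<times> nat" where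
  "block_pos [] r = (0, r)"
| "block_pos (s # ss) r =
    (if r < s then (0, r) else (let (i, a) = block_pos ss (r - s) in (Suc i, a)))"

definition block_mat :: "nat list \<Rightarrow> (nat \<Rightarrow> nat \<Rightarrow> 'a mat) \<Rightarrow> 'a mat" where
  "block_mat ss F = mat (sum_list ss) (sum_list ss)
     (\<lambda>(r, c). let (i, a) = block_pos ss r; (j, b) = block_pos ss c in F i j $$ (a, b))"

definition phi_mat :: "nat list \<Rightarrow> (nat \<Rightarrow> nat \<Rightarrow> 'a::comm_ring_1 poly) \<Rightarrow> 'a mat" where
  "phi_mat ss \<epsilon> = block_mat ss (\<lambda>i j. mat (ss ! i) (ss ! j)
     (\<lambda>(a, b). if Suc b = ss ! j then coeff (\<epsilon> i j) a else 0))"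

end

theory Submission
  imports Defs
begin

text \<open>
  Let \<open>M\<close> be \<open>k\<^sup>n\<close> with \<open>t\<close> acting as \<open>A\<close>, and let \<open>X\<close> be an extension of \<open>M\<close> by \<open>M\<close> over \<open>k[t]\<close> in
  the class \<open>\<xi>\<close>. The idea is that \<open>X\<close> can be written in a normal form in which \<open>t\<close> acts as the
  block matrix with rows \<open>(A, \<Phi>)\<close> and \<open>(0, A)\<close>, where \<open>\<Phi> = \<phi>(\<epsilon>)\<close>, and that a matrix of this shape
  over \<open>k\<close> is added to the extension given by \<open>A0\<close> by replacing \<open>A0\<close> with \<open>A0 + \<pi> \<Phi>\<close>.

  For the normal form, choose lifts \<open>f\<^sub>j\<close> of the generators \<open>e\<^sub>j\<close> such that \<open>p ^ \<lambda>\<^sub>j f\<^sub>j\<close> is exactly the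
  image of \<open>\<Sum>\<^sub>i \<epsilon>\<^sub>i\<^sub>j e\<^sub>i\<close>. The entries of \<open>E(\<xi>)\<close> are only defined modulo \<open>p ^ min \<lambda>\<^sub>i \<lambda>\<^sub>j\<close>, but
  changing \<open>f\<^sub>j\<close> by elements of \<open>M\<close> realises every choice of representatives
  (\<open>ext_matrix_well_defined\<close>, \<open>adapted_lifts\<close>). The elements \<open>t\<^sup>a f\<^sub>j\<close> with \<open>a < d \<lambda>\<^sub>j\<close> then define a
  \<open>k\<close>-linear section \<open>s\<close> of \<open>X \<rightarrow> M\<close>. It fails to commute with \<open>t\<close> only at the last exponent of each
  block, where \<open>t ^ (d \<lambda>\<^sub>j) f\<^sub>j\<close> has to be reduced by means of \<open>p ^ \<lambda>\<^sub>j f\<^sub>j\<close>; hence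
  \<open>t s(v) = s(A v) + \<Phi> v\<close> with the columns of \<open>\<epsilon>\<close> in the last column of each block. The same
  information is carried by the retraction \<open>r\<close> with \<open>x = r x + s(x mod M)\<close>, which satisfies
  \<open>r(t x) = A (r x) + \<Phi> (x mod M)\<close> (\<open>retraction\<close>).

  Let \<open>W\<close> be the extension given by \<open>A0 + \<pi> \<Phi>\<close>. On the fibre product over \<open>M\<close> of \<open>X\<close> and the extension
  \<open>Y = R\<^sup>n\<close> given by \<open>A0\<close>, the map \<open>\<theta>(x, y) = y + \<pi> r(x)\<close> is \<open>R[t]\<close>-linear into \<open>W\<close>, since \<open>\<pi>\<^sup>2 = 0\<close>
  (\<open>deformed_action\<close>). Its kernel is the antidiagonal copy of \<open>M\<close>, so \<open>W\<close> is the Baer sum of \<open>X\<close> and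
  \<open>Y\<close> (\<open>baer_sum_equiv\<close>). Finally, the matrices of \<open>t\<close> on \<open>W\<close> with respect to \<open>R\<close>-bases that lift the
  standard basis are the conjugates of \<open>A0 + \<pi> \<Phi>\<close> by matrices congruent to the identity
  (\<open>t_matrices_of_lift\<close>).
\<close>

section \<open>The annihilator of the uniformizer\<close>

lemma ideal_class_ringI:
  fixes I :: "'a::comm_ring_1 set"
  assumes "0 \<in> I" "\<And>x y. x \<in> I \<Longrightarrow> y \<in> I \<Longrightarrow> x + y \<in> I" "\<And>r x. x \<in> I \<Longrightarrow> r * x \<in> I"
  shows "ideal I class_ring"
proof (rule idealI)
  show "ring (class_ring :: 'a ring)" by (rule class_ring.ring_axioms)
  show "subgroup I (add_monoid class_ring)"
  proof (rule group.subgroupI)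
    show "Group.group (add_monoid (class_ring :: 'a ring))"
      using class_ring.ring_axioms by (metis abelian_group.a_group ring.is_abelian_group)
    fix a assume a: "a \<in> I"
    have "inv\<^bsub>add_monoid class_ring\<^esub> a = - a"
      using class_ring_simps by (metis a_inv_def)
    then show "inv\<^bsub>add_monoid class_ring\<^esub> a \<in> I" using assms(3)[OF a, of "-1"] by simp
  qed (use assms in auto)
qed (use assms in \<open>auto simp: mult.commute\<close>)

lemma ideal_class_ringD:
  fixes I :: "'a::comm_ring_1 set"
  assumes "ideal I class_ring"
  shows "0 \<in> I" "\<And>x y. x \<in> I \<Longrightarrow> y \<in> I \<Longrightarrow> x + y \<in> I" "\<And>r x. x \<in> I \<Longrightarrow> r * x \<in> I"
proof -
  interpret ideal I "class_ring :: 'a ring" by fact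
  show "0 \<in> I" using additive_subgroup.zero_closed[OF additive_subgroup_axioms] by simp
  show "\<And>x y. x \<in> I \<Longrightarrow> y \<in> I \<Longrightarrow> x + y \<in> I" using additive_subgroup.a_closed[OF additive_subgroup_axioms] by simp
  show "\<And>r x. x \<in> I \<Longrightarrow> r * x \<in> I" using I_l_closed by simp
qed

lemma PIdl_class_ring: "PIdl\<^bsub>class_ring\<^esub> (a::'a::comm_ring_1) = range (\<lambda>r. r * a)"
  by (auto simp: cgenideal_def)

text \<open>In length two the maximal ideal \<open>(\<pi>)\<close> is a minimal nonzero ideal. If the annihilator \<open>K\<close> of \<open>\<pi>\<close>
  were not contained in \<open>(\<pi>)\<close>, then \<open>R = K \<oplus> (\<pi>)\<close> with \<open>K\<close> a second maximal ideal, against locality.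
  So \<open>K \<subseteq> (\<pi>)\<close>, and this forces \<open>\<pi>\<^sup>2 = 0\<close>: otherwise \<open>(\<pi>\<^sup>2) = (\<pi>)\<close>, say \<open>\<pi> = r \<pi>\<^sup>2\<close>, and then
  \<open>1 - r \<pi>\<close> would lie in \<open>K \<subseteq> (\<pi>)\<close>, and so would \<open>1\<close>.\<close>

lemma annihilator_of_uniformizer:
  fixes \<pi> :: "'r::comm_ring_1"
  assumes loc: "local_ring (class_ring :: 'r ring)"
    and len: "has_length (class_ring :: 'r ring) 2"
    and max: "maximalideal (PIdl\<^bsub>class_ring\<^esub> \<pi>) (class_ring :: 'r ring)"
  shows "\<pi> * x = 0 \<longleftrightarrow> x \<in> PIdl\<^bsub>class_ring\<^esub> \<pi>"
proof -
  let ?R = "class_ring :: 'r ring"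
  define p where "p = PIdl\<^bsub>?R\<^esub> \<pi>"
  define K where "K = {x. \<pi> * x = 0}"
  have uniq: "J = p" if "maximalideal J ?R" for J
    using loc max that unfolding local_ring_def p_def by blast
  have maxI: "maximalideal J ?R"
    if "ideal J ?R" "J \<subset> UNIV" "\<nexists>L. ideal L ?R \<and> J \<subset> L \<and> L \<subset> UNIV" for J
    using that by (intro maximalidealI) (auto simp: psubset_eq)
  have p_ideal: "ideal p ?R" and p_top: "p \<noteq> UNIV"
    and p_max: "\<And>L. ideal L ?R \<Longrightarrow> p \<subseteq> L \<Longrightarrow> L = p \<or> L = UNIV"
    using max unfolding p_def maximalideal_def maximalideal_axioms_def by auto
  obtain I where I: "I 0 = {0}" "I 2 = (UNIV :: 'r set)" "\<And>i. i \<le> 2 \<Longrightarrow> ideal (I i) ?R"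
    and chain: "\<forall>i<2. I i \<subset> I (Suc i) \<and> (\<nexists>J. ideal J ?R \<and> I i \<subset> J \<and> J \<subset> I (Suc i))"
    using len unfolding has_length_def by auto
  have simple: "I i \<subset> I (Suc i)" "ideal J ?R \<Longrightarrow> I i \<subset> J \<Longrightarrow> J \<subset> I (Suc i) \<Longrightarrow> False"
    if "i < 2" for i J
    using chain that by blast+
  \<comment> \<open>the middle term of the composition series is a maximal ideal, hence \<open>(\<pi>)\<close>\<close>
  have "I 1 = p"
  proof (rule uniq, rule maxI)
    show "ideal (I 1) ?R" using I(3)[of 1] by simp
    show "I 1 \<subset> UNIV" using simple(1)[of 1] by (auto simp: numeral_2_eq_2)
    show "\<nexists>L. ideal L ?R \<and> I 1 \<subset> L \<and> L \<subset> UNIV" using simple(2)[of 1] I(2) by (auto simp: numeral_2_eq_2)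
  qed
  then have p_nz: "p \<noteq> {0}"
    using I(1) simple(1)[of 0] by auto
  have p_min: "J = {0} \<or> J = p" if "ideal J ?R" "J \<subseteq> p" for J
  proof -
    have "0 \<in> J" using ideal_class_ringD(1)[OF that(1)] .
    then show ?thesis using that simple(2)[of 0 J] I(1) \<open>I 1 = p\<close> by fastforce
  qed
  have p_eq: "p = range (\<lambda>r. r * \<pi>)" unfolding p_def PIdl_class_ring ..
  have K_ideal: "ideal K ?R"
    unfolding K_def by (rule ideal_class_ringI) (auto simp: algebra_simps)
  have pi_nz: "\<pi> \<noteq> 0" using p_nz unfolding p_eq by auto
  have one_notin_K: "1 \<notin> K" using pi_nz unfolding K_def by simp
  have pi_in: "\<pi> \<in> p" unfolding p_eq by (metis mult_1 rangeI)
  have sum_ideal: "ideal {a + b | a b. a \<in> J \<and> b \<in> p} ?R" if "ideal J ?R" for J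
  proof (rule ideal_class_ringI)
    show "0 \<in> {a + b | a b. a \<in> J \<and> b \<in> p}"
      using ideal_class_ringD(1)[OF that] ideal_class_ringD(1)[OF p_ideal] by force
  next
    fix x y assume "x \<in> {a + b | a b. a \<in> J \<and> b \<in> p}" "y \<in> {a + b | a b. a \<in> J \<and> b \<in> p}"
    then obtain a b c d where "a \<in> J" "b \<in> p" "c \<in> J" "d \<in> p" "x = a + b" "y = c + d" by auto
    then have "x + y = (a + c) + (b + d)" "a + c \<in> J" "b + d \<in> p"
      using ideal_class_ringD(2)[OF that] ideal_class_ringD(2)[OF p_ideal] by auto
    then show "x + y \<in> {a + b | a b. a \<in> J \<and> b \<in> p}" by blast
  next
    fix r x assume "x \<in> {a + b | a b. a \<in> J \<and> b \<in> p}"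
    then obtain a b where "a \<in> J" "b \<in> p" "x = a + b" by auto
    then have "r * x = r * a + r * b" "r * a \<in> J" "r * b \<in> p"
      using ideal_class_ringD(3)[OF that] ideal_class_ringD(3)[OF p_ideal] by (auto simp: algebra_simps)
    then show "r * x \<in> {a + b | a b. a \<in> J \<and> b \<in> p}" by blast
  qed
  have K_sub: "K \<subseteq> p"
  proof (rule ccontr)
    assume not: "\<not> K \<subseteq> p"
    have "ideal (K \<inter> p) ?R"
      using ideal_class_ringD[OF K_ideal] ideal_class_ringD[OF p_ideal]
      by (intro ideal_class_ringI) auto
    then have "K \<inter> p = {0} \<or> K \<inter> p = p" using p_min by blast
    moreover have "K \<inter> p \<noteq> p"
      using p_max[OF K_ideal] not one_notin_K by blast
    ultimately have Kp: "K \<inter> p = {0}" by blast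
    have "{a + b | a b. a \<in> K \<and> b \<in> p} = UNIV"
    proof -
      let ?L = "{a + b | a b. a \<in> K \<and> b \<in> p}"
      have "p \<subseteq> ?L" using ideal_class_ringD(1)[OF K_ideal] by force
      moreover have "K \<subseteq> ?L" using ideal_class_ringD(1)[OF p_ideal] by force
      ultimately show ?thesis using p_max[OF sum_ideal[OF K_ideal]] not by blast
    qed
    then obtain k q where kq: "1 = k + q" "k \<in> K" "q \<in> p" by blast
    have "maximalideal K ?R"
    proof (rule maxI[OF K_ideal])
      show "K \<subset> UNIV" using one_notin_K by blast
      show "\<nexists>L. ideal L ?R \<and> K \<subset> L \<and> L \<subset> UNIV"
      proof
        assume "\<exists>L. ideal L ?R \<and> K \<subset> L \<and> L \<subset> UNIV"
        then obtain L where L: "ideal L ?R" "K \<subset> L" "L \<noteq> UNIV" by blast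
        have "ideal (L \<inter> p) ?R"
          using ideal_class_ringD[OF L(1)] ideal_class_ringD[OF p_ideal]
          by (intro ideal_class_ringI) auto
        then have "L \<inter> p = {0} \<or> L \<inter> p = p" using p_min by blast
        then show False
        proof
          assume "L \<inter> p = {0}"
          have "x \<in> K" if "x \<in> L" for x
          proof -
            have "q * x \<in> L" "x * q \<in> p"
              using ideal_class_ringD(3)[OF L(1) that] ideal_class_ringD(3)[OF p_ideal kq(3)] by auto
            then have "x * q = 0" using \<open>L \<inter> p = {0}\<close> by (auto simp: mult.commute)
            then have "x = x * k" using kq(1) by (metis add.right_neutral distrib_left mult.right_neutral)
            then show ?thesis using ideal_class_ringD(3)[OF K_ideal kq(2)] by metis
          qed
          then show False using L(2) by blast
        next
          assume "L \<inter> p = p"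
          then have "p \<subseteq> L" by blast
          then show False using p_max[OF L(1)] L(2,3) not by blast
        qed
      qed
    qed
    then show False using uniq not by blast
  qed
  have "\<pi> * \<pi> = 0"
  proof (rule ccontr)
    assume nz: "\<pi> * \<pi> \<noteq> 0"
    define J where "J = range (\<lambda>r. r * (\<pi> * \<pi>))"
    have "ideal J ?R"
      using cring.cgenideal_ideal[OF class_cring.cring_axioms, of "\<pi> * \<pi>"]
      unfolding J_def PIdl_class_ring by simp
    moreover have "J \<subseteq> p" unfolding J_def p_eq by (auto simp: mult.assoc[symmetric])
    moreover have "\<pi> * \<pi> \<in> J" unfolding J_def by (metis mult_1 rangeI)
    ultimately have "J = p" using p_min nz by blast
    then obtain r where "\<pi> = r * (\<pi> * \<pi>)" using pi_in unfolding J_def by blast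
    then have "1 - r * \<pi> \<in> K" unfolding K_def by (simp add: algebra_simps)
    then have "1 - r * \<pi> \<in> p" using K_sub by blast
    moreover have "r * \<pi> \<in> p" unfolding p_eq by blast
    ultimately have "1 \<in> p" using ideal_class_ringD(2)[OF p_ideal] by fastforce
    then show False using p_top ideal_class_ringD(3)[OF p_ideal] by (metis UNIV_eq_I mult.right_neutral)
  qed
  then have "p \<subseteq> K" unfolding p_eq K_def by (auto simp: algebra_simps)
  then show ?thesis using K_sub unfolding K_def p_def by blast
qed

section \<open>Extensions and their classes\<close>

lemma module_homI:
  assumes "\<And>x. x \<in> carrier E \<Longrightarrow> f x \<in> carrier F"
    and "\<And>x y. x \<in> carrier E \<Longrightarrow> y \<in> carrier E \<Longrightarrow> f (x \<oplus>\<^bsub>E\<^esub> y) = f x \<oplus>\<^bsub>F\<^esub> f y"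
    and "\<And>s x. s \<in> carrier S \<Longrightarrow> x \<in> carrier E \<Longrightarrow> f (s \<odot>\<^bsub>E\<^esub> x) = s \<odot>\<^bsub>F\<^esub> f x"
  shows "f \<in> LinearCombinations.module_hom S E F"
  using assms by (auto simp: LinearCombinations.module_hom_def)

lemma module_homD:
  assumes "f \<in> LinearCombinations.module_hom S E F"
  shows "x \<in> carrier E \<Longrightarrow> f x \<in> carrier F"
    and "x \<in> carrier E \<Longrightarrow> y \<in> carrier E \<Longrightarrow> f (x \<oplus>\<^bsub>E\<^esub> y) = f x \<oplus>\<^bsub>F\<^esub> f y"
    and "s \<in> carrier S \<Longrightarrow> x \<in> carrier E \<Longrightarrow> f (s \<odot>\<^bsub>E\<^esub> x) = s \<odot>\<^bsub>F\<^esub> f x"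
  using assms by (auto simp: LinearCombinations.module_hom_def)

lemma module_hom_zero:
  assumes "module S E" "module S F" "f \<in> LinearCombinations.module_hom S E F"
  shows "f \<zero>\<^bsub>E\<^esub> = \<zero>\<^bsub>F\<^esub>"
  using assms by (intro mod_hom.f0_is_0) (simp add: mod_hom_def mod_hom_axioms_def)

lemma module_hom_finsum:
  assumes E: "module S E" and F: "module S F"
    and f: "f \<in> LinearCombinations.module_hom S E F"
    and g: "g \<in> A \<rightarrow> carrier E"
  shows "f (\<Oplus>\<^bsub>E\<^esub>a\<in>A. g a) = (\<Oplus>\<^bsub>F\<^esub>a\<in>A. f (g a))"
proof -
  interpret E: Module.module S E by fact
  interpret F: Module.module S F by fact
  note D = module_homD[OF f]
  show ?thesis using g
  proof (induct A rule: infinite_finite_induct)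
    case (insert a A)
    have "(\<lambda>a. f (g a)) \<in> A \<rightarrow> carrier F" "f (g a) \<in> carrier F" using insert D(1) by auto
    then show ?case using insert D(2) by auto
  qed (simp_all add: module_hom_zero[OF E F f] E.finsum_infinite F.finsum_infinite)
qed

lemma is_extensionD:
  assumes "is_extension S M N X"
  shows "module S (mid X)"
    and "inj_map X \<in> LinearCombinations.module_hom S N (mid X)"
    and "proj_map X \<in> LinearCombinations.module_hom S (mid X) M"
    and "inj_on (inj_map X) (carrier N)"
    and "m \<in> carrier M \<Longrightarrow> \<exists>x\<in>carrier (mid X). proj_map X x = m"
    and "x \<in> carrier (mid X) \<Longrightarrow> proj_map X x = \<zero>\<^bsub>M\<^esub> \<Longrightarrow> \<exists>a\<in>carrier N. x = inj_map X a"
    and "a \<in> carrier N \<Longrightarrow> proj_map X (inj_map X a) = \<zero>\<^bsub>M\<^esub>"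
    and "a \<in> carrier N \<Longrightarrow> inj_map X a \<in> carrier (mid X)"
    and "x \<in> carrier (mid X) \<Longrightarrow> proj_map X x \<in> carrier M"
proof -
  note X = assms[unfolded is_extension_def]
  show mod: "module S (mid X)"
    and i: "inj_map X \<in> LinearCombinations.module_hom S N (mid X)"
    and p: "proj_map X \<in> LinearCombinations.module_hom S (mid X) M"
    and "inj_on (inj_map X) (carrier N)"
    using X by blast+
  have im: "proj_map X ` carrier (mid X) = carrier M"
    and ker: "inj_map X ` carrier N = {x \<in> carrier (mid X). proj_map X x = \<zero>\<^bsub>M\<^esub>}"
    using X by blast+
  show "m \<in> carrier M \<Longrightarrow> \<exists>x\<in>carrier (mid X). proj_map X x = m"
    using im by (metis imageE)
  show "x \<in> carrier (mid X) \<Longrightarrow> proj_map X x = \<zero>\<^bsub>M\<^esub> \<Longrightarrow> \<exists>a\<in>carrier N. x = inj_map X a"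
    and "a \<in> carrier N \<Longrightarrow> proj_map X (inj_map X a) = \<zero>\<^bsub>M\<^esub>"
    using ker by blast+
  show "a \<in> carrier N \<Longrightarrow> inj_map X a \<in> carrier (mid X)"
    by (rule module_homD(1)[OF i])
  show "x \<in> carrier (mid X) \<Longrightarrow> proj_map X x \<in> carrier M"
    by (rule module_homD(1)[OF p])
qed

lemma ext_equiv_refl: "ext_equiv S N X X"
  unfolding ext_equiv_def by (rule bexI[of _ "\<lambda>x. x"]) (auto intro!: module_homI simp: bij_betw_def)

lemma ext_equiv_trans:
  assumes "ext_equiv S N X Y" and "ext_equiv S N Y Z"
  shows "ext_equiv S N X Z"
proof -
  obtain f where f: "f \<in> LinearCombinations.module_hom S (mid X) (mid Y)"
      "bij_betw f (carrier (mid X)) (carrier (mid Y))"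
      "\<And>a. a \<in> carrier N \<Longrightarrow> f (inj_map X a) = inj_map Y a"
      "\<And>x. x \<in> carrier (mid X) \<Longrightarrow> proj_map Y (f x) = proj_map X x"
    using assms(1) unfolding ext_equiv_def by blast
  obtain g where g: "g \<in> LinearCombinations.module_hom S (mid Y) (mid Z)"
      "bij_betw g (carrier (mid Y)) (carrier (mid Z))"
      "\<And>a. a \<in> carrier N \<Longrightarrow> g (inj_map Y a) = inj_map Z a"
      "\<And>x. x \<in> carrier (mid Y) \<Longrightarrow> proj_map Z (g x) = proj_map Y x"
    using assms(2) unfolding ext_equiv_def by blast
  note F = module_homD[OF f(1)] and G = module_homD[OF g(1)]
  have "g \<circ> f \<in> LinearCombinations.module_hom S (mid X) (mid Z)"
    by (rule module_homI) (simp_all add: F G)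
  moreover have "bij_betw (g \<circ> f) (carrier (mid X)) (carrier (mid Z))"
    using f(2) g(2) by (rule bij_betw_trans)
  ultimately show ?thesis unfolding ext_equiv_def
    by (intro bexI[of _ "g \<circ> f"]) (auto simp: f g F)
qed

text \<open>Closure of the operations of \<open>mid Y\<close> comes from the bijection, so that \<open>Y\<close> can be a Baer sum, for
  which the module axioms have not been established.\<close>

lemma ext_equiv_sym:
  assumes X: "is_extension S M N X" and XY: "ext_equiv S N X Y"
  shows "ext_equiv S N Y X"
proof -
  interpret X: Module.module S "mid X" using is_extensionD(1)[OF X] .
  obtain f where f: "f \<in> LinearCombinations.module_hom S (mid X) (mid Y)"
      "bij_betw f (carrier (mid X)) (carrier (mid Y))"
      "\<And>a. a \<in> carrier N \<Longrightarrow> f (inj_map X a) = inj_map Y a"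
      "\<And>x. x \<in> carrier (mid X) \<Longrightarrow> proj_map Y (f x) = proj_map X x"
    using XY unfolding ext_equiv_def by blast
  note F = module_homD[OF f(1)]
  define g where "g = the_inv_into (carrier (mid X)) f"
  have inj: "inj_on f (carrier (mid X))" using f(2) by (rule bij_betw_imp_inj_on)
  have gf: "g (f x) = x" if "x \<in> carrier (mid X)" for x
    unfolding g_def by (rule the_inv_into_f_f[OF inj that])
  have surj: "\<exists>x\<in>carrier (mid X). y = f x" if "y \<in> carrier (mid Y)" for y
    using f(2) that unfolding bij_betw_def by blast
  have "g \<in> LinearCombinations.module_hom S (mid Y) (mid X)"
  proof (rule module_homI)
    show "g y \<in> carrier (mid X)" if "y \<in> carrier (mid Y)" for y
      using surj[OF that] gf by auto
    show "g (y \<oplus>\<^bsub>mid Y\<^esub> z) = g y \<oplus>\<^bsub>mid X\<^esub> g z"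
      if yz: "y \<in> carrier (mid Y)" "z \<in> carrier (mid Y)" for y z
      using surj[OF yz(1)] surj[OF yz(2)] gf by (auto simp flip: F(2))
    show "g (s \<odot>\<^bsub>mid Y\<^esub> y) = s \<odot>\<^bsub>mid X\<^esub> g y"
      if sy: "s \<in> carrier S" "y \<in> carrier (mid Y)" for s y
      using surj[OF sy(2)] sy(1) gf by (auto simp flip: F(3))
  qed
  moreover have "bij_betw g (carrier (mid Y)) (carrier (mid X))"
    unfolding g_def by (rule bij_betw_the_inv_into[OF f(2)])
  moreover have "g (inj_map Y a) = inj_map X a" if "a \<in> carrier N" for a
    using gf[OF is_extensionD(8)[OF X that]] f(3)[OF that] by simp
  moreover have "proj_map X (g y) = proj_map Y y" if "y \<in> carrier (mid Y)" for y
    using surj[OF that] gf f(4) by auto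
  ultimately show ?thesis unfolding ext_equiv_def by blast
qed

lemma module_transport:
  assumes E: "module S E" and g: "inj_on g (carrier E)" and F: "carrier F = g ` carrier E"
    "\<zero>\<^bsub>F\<^esub> = g \<zero>\<^bsub>E\<^esub>"
    and add: "\<And>x y. x \<in> carrier E \<Longrightarrow> y \<in> carrier E \<Longrightarrow> g x \<oplus>\<^bsub>F\<^esub> g y = g (x \<oplus>\<^bsub>E\<^esub> y)"
    and smult: "\<And>s x. s \<in> carrier S \<Longrightarrow> x \<in> carrier E \<Longrightarrow> s \<odot>\<^bsub>F\<^esub> g x = g (s \<odot>\<^bsub>E\<^esub> x)"
  shows "module S F"
proof -
  interpret E: Module.module S E by fact
  show ?thesis
  proof (rule moduleI)
    show "cring S" ..
    show "abelian_group F"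
    proof (rule abelian_groupI)
      fix x assume "x \<in> carrier F"
      then obtain a where a: "a \<in> carrier E" "x = g a" using F by auto
      then show "\<exists>y\<in>carrier F. y \<oplus>\<^bsub>F\<^esub> x = \<zero>\<^bsub>F\<^esub>"
        by (intro bexI[of _ "g (\<ominus>\<^bsub>E\<^esub> a)"]) (auto simp: F add E.l_neg)
    qed (auto simp: F add E.a_ac)
  qed (auto simp: F add smult E.smult_l_distr E.smult_r_distr E.smult_assoc1)
qed

lemma extension_same_proj:
  assumes M: "module S M" and X: "is_extension S M N X"
    and x: "x \<in> carrier (mid X)" and y: "y \<in> carrier (mid X)" and eq: "proj_map X x = proj_map X y"
  shows "\<exists>a\<in>carrier N. x = inj_map X a \<oplus>\<^bsub>mid X\<^esub> y"
proof -
  interpret M: Module.module S M by fact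
  note D = is_extensionD[OF X]
  interpret X: Module.module S "mid X" by (rule D(1))
  let ?z = "x \<oplus>\<^bsub>mid X\<^esub> \<ominus>\<^bsub>mid X\<^esub> y"
  have z: "?z \<in> carrier (mid X)" "?z \<oplus>\<^bsub>mid X\<^esub> y = x"
    using x y by (simp_all add: X.a_assoc X.l_neg)
  have "proj_map X y = proj_map X ?z \<oplus>\<^bsub>M\<^esub> proj_map X y"
    using module_homD(2)[OF D(3) z(1) y] unfolding z(2) eq .
  then have "proj_map X ?z = \<zero>\<^bsub>M\<^esub>"
    using M.add.r_cancel_one'[OF D(9)[OF y] D(9)[OF z(1)]] by simp
  then show ?thesis using D(6)[OF z(1)] z(2) by metis
qed

text \<open>Choosing a preimage of every element of \<open>M\<close> identifies the set underlying the middle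
  term with \<open>N \<times> M\<close>, to which the module structure is then carried over.\<close>

lemma ext_class_nonempty:
  fixes X :: "('a, 'n, 'e, 'm) extension"
  assumes M: "module S M" and X: "is_extension S M N X"
  shows "ext_class S M N X \<noteq> {}"
proof -
  interpret M: Module.module S M by fact
  interpret X: Module.module S "mid X" using is_extensionD(1)[OF X] .
  let ?E = "mid X"
  note D = is_extensionD[OF X]
  note P = module_homD[OF D(3)]
  define s where "s m = (SOME x. x \<in> carrier ?E \<and> proj_map X x = m)" for m
  have s: "s m \<in> carrier ?E" "proj_map X (s m) = m" if "m \<in> carrier M" for m
    using D(5)[OF that] unfolding s_def by (metis (mono_tags, lifting) someI_ex)+
  have "\<exists>a\<in>carrier N. x = inj_map X a \<oplus>\<^bsub>?E\<^esub> s (proj_map X x)" if x: "x \<in> carrier ?E" for x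
    using extension_same_proj[OF M X x] s D(9)[OF x] by simp
  then obtain u where u: "\<And>x. x \<in> carrier ?E \<Longrightarrow> u x \<in> carrier N \<and> x = inj_map X (u x) \<oplus>\<^bsub>?E\<^esub> s (proj_map X x)"
    by metis
  define g where "g x = (u x, proj_map X x)" for x
  have g_inj: "inj_on g (carrier ?E)"
    by (rule inj_onI) (metis g_def u prod.inject)
  define h where "h = the_inv_into (carrier ?E) g"
  have h: "h (g x) = x" if "x \<in> carrier ?E" for x
    unfolding h_def by (rule the_inv_into_f_f[OF g_inj that])
  define F where "F = \<lparr>carrier = g ` carrier ?E, mult = (\<lambda>_ _. g \<zero>\<^bsub>?E\<^esub>), one = g \<zero>\<^bsub>?E\<^esub>,
    zero = g \<zero>\<^bsub>?E\<^esub>, add = (\<lambda>x y. g (h x \<oplus>\<^bsub>?E\<^esub> h y)), smult = (\<lambda>s x. g (s \<odot>\<^bsub>?E\<^esub> h x))\<rparr>"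
  have Fs: "carrier F = g ` carrier ?E" "\<zero>\<^bsub>F\<^esub> = g \<zero>\<^bsub>?E\<^esub>"
    "\<And>x y. x \<in> carrier ?E \<Longrightarrow> y \<in> carrier ?E \<Longrightarrow> g x \<oplus>\<^bsub>F\<^esub> g y = g (x \<oplus>\<^bsub>?E\<^esub> y)"
    "\<And>s x. s \<in> carrier S \<Longrightarrow> x \<in> carrier ?E \<Longrightarrow> s \<odot>\<^bsub>F\<^esub> g x = g (s \<odot>\<^bsub>?E\<^esub> x)"
    unfolding F_def by (simp_all add: h)
  have F: "module S F" by (rule module_transport[OF D(1) g_inj Fs])
  define Y where "Y = \<lparr>mid = F, inj_map = g \<circ> inj_map X, proj_map = snd\<rparr>"
  note I = module_homD[OF D(2)]
  have g_hom: "g \<in> LinearCombinations.module_hom S ?E F"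
    by (rule module_homI) (simp_all add: Fs)
  have "is_extension S M N Y"
    unfolding is_extension_def Y_def extension.simps
  proof (intro conjI)
    show "g \<circ> inj_map X \<in> LinearCombinations.module_hom S N F"
      by (rule module_homI) (simp_all add: Fs I)
    show "snd \<in> LinearCombinations.module_hom S F M"
      by (rule module_homI) (auto simp: Fs P g_def[THEN arg_cong[of _ _ snd]])
    show "inj_on (g \<circ> inj_map X) (carrier N)"
      using D(4,8) g_inj by (intro comp_inj_on) (auto intro: inj_on_subset)
    show "snd ` carrier F = carrier M"
      using X unfolding is_extension_def by (simp add: Fs image_image g_def)
    have "inj_map X ` carrier N = {x \<in> carrier ?E. proj_map X x = \<zero>\<^bsub>M\<^esub>}"
      using X unfolding is_extension_def by simp
    then show "(g \<circ> inj_map X) ` carrier N = {x \<in> carrier F. snd x = \<zero>\<^bsub>M\<^esub>}"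
      unfolding Fs image_comp[symmetric] by (auto simp: g_def image_iff)
  qed (fact F)
  moreover have "ext_equiv S N X Y"
    unfolding ext_equiv_def
    by (rule bexI[of _ g]) (use g_hom g_inj in \<open>auto simp: Y_def Fs bij_betw_def g_def[THEN arg_cong[of _ _ snd]]\<close>)
  ultimately show ?thesis unfolding ext_class_def by blast
qed

lemma ext_class_refl: "is_extension S M N X \<Longrightarrow> X \<in> ext_class S M N X"
  by (simp add: ext_class_def ext_equiv_refl)

text \<open>A recognition principle for Baer sums. A linear map \<open>\<theta>\<close> from the fibre product to \<open>W\<close> that is
  addition on \<open>N \<times> N\<close> and lies over the identity of \<open>M\<close> is surjective, and its kernel is the
  antidiagonal copy of \<open>N\<close>. The elements of the Baer sum, which are cosets of this kernel, are thus
  the fibres \<open>\<kappa> w\<close> of \<open>\<theta>\<close>, and \<open>\<kappa>\<close> is the required equivalence.\<close>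

lemma baer_sum_equiv:
  fixes X :: "('a, 'n, 'e, 'm) extension" and Y :: "('a, 'n, 'f, 'm) extension"
    and W :: "('a, 'n, 'g, 'm) extension"
  assumes M: "module S M" and N: "module S N"
    and X: "is_extension S M N X" and Y: "is_extension S M N Y" and W: "is_extension S M N W"
    and closed: "\<And>x y. x \<in> carrier (mid X) \<Longrightarrow> y \<in> carrier (mid Y) \<Longrightarrow> proj_map X x = proj_map Y y \<Longrightarrow>
      \<theta> x y \<in> carrier (mid W) \<and> proj_map W (\<theta> x y) = proj_map X x"
    and add: "\<And>x y x' y'. x \<in> carrier (mid X) \<Longrightarrow> y \<in> carrier (mid Y) \<Longrightarrow> proj_map X x = proj_map Y y \<Longrightarrow>
      x' \<in> carrier (mid X) \<Longrightarrow> y' \<in> carrier (mid Y) \<Longrightarrow> proj_map X x' = proj_map Y y' \<Longrightarrow>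
      \<theta> (x \<oplus>\<^bsub>mid X\<^esub> x') (y \<oplus>\<^bsub>mid Y\<^esub> y') = \<theta> x y \<oplus>\<^bsub>mid W\<^esub> \<theta> x' y'"
    and smult: "\<And>s x y. s \<in> carrier S \<Longrightarrow> x \<in> carrier (mid X) \<Longrightarrow> y \<in> carrier (mid Y) \<Longrightarrow>
      proj_map X x = proj_map Y y \<Longrightarrow> \<theta> (s \<odot>\<^bsub>mid X\<^esub> x) (s \<odot>\<^bsub>mid Y\<^esub> y) = s \<odot>\<^bsub>mid W\<^esub> \<theta> x y"
    and inj: "\<And>a b. a \<in> carrier N \<Longrightarrow> b \<in> carrier N \<Longrightarrow>
      \<theta> (inj_map X a) (inj_map Y b) = inj_map W (a \<oplus>\<^bsub>N\<^esub> b)"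
  shows "ext_equiv S N W (baer_sum N X Y)"
proof -
  interpret M: Module.module S M by fact
  interpret N: Module.module S N by fact
  note DX = is_extensionD[OF X] and DY = is_extensionD[OF Y] and DW = is_extensionD[OF W]
  interpret X: Module.module S "mid X" by (rule DX(1))
  interpret Y: Module.module S "mid Y" by (rule DY(1))
  interpret W: Module.module S "mid W" by (rule DW(1))
  note IX = module_homD[OF DX(2)] and IY = module_homD[OF DY(2)] and IW = module_homD[OF DW(2)]
  note PX = module_homD[OF DX(3)] and PY = module_homD[OF DY(3)] and PW = module_homD[OF DW(3)]
  define C where "C = {(x, y). x \<in> carrier (mid X) \<and> y \<in> carrier (mid Y) \<and> proj_map X x = proj_map Y y}"
  define P where "P = (direct_sum (mid X) (mid Y)) \<lparr>carrier := C\<rparr>"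
  define K where "K = (\<lambda>a. (inj_map X a, \<ominus>\<^bsub>mid Y\<^esub> inj_map Y a)) ` carrier N"
  define \<kappa> where "\<kappa> w = {c \<in> C. \<theta> (fst c) (snd c) = w}" for w
  have baer: "baer_sum N X Y = \<lparr>mid = quotient_module P K,
      inj_map = (\<lambda>a. K +>\<^bsub>P\<^esub> (inj_map X a, \<zero>\<^bsub>mid Y\<^esub>)),
      proj_map = (\<lambda>D. proj_map X (fst (SOME c. c \<in> D)))\<rparr>"
    unfolding baer_sum_def P_def K_def C_def Let_def by (simp add: Sigma_def case_prod_unfold) 
  have Ps: "carrier P = C" "\<And>c d. c \<oplus>\<^bsub>P\<^esub> d = (fst c \<oplus>\<^bsub>mid X\<^esub> fst d, snd c \<oplus>\<^bsub>mid Y\<^esub> snd d)"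
    "\<And>s c. s \<odot>\<^bsub>P\<^esub> c = (s \<odot>\<^bsub>mid X\<^esub> fst c, s \<odot>\<^bsub>mid Y\<^esub> snd c)"
    by (simp_all add: P_def direct_sum_def)
  have I0: "inj_map Y \<zero>\<^bsub>N\<^esub> = \<zero>\<^bsub>mid Y\<^esub>" "inj_map X \<zero>\<^bsub>N\<^esub> = \<zero>\<^bsub>mid X\<^esub>" "inj_map W \<zero>\<^bsub>N\<^esub> = \<zero>\<^bsub>mid W\<^esub>"
    using module_hom_zero[OF N] DX DY DW by auto
  have P0: "proj_map Y \<zero>\<^bsub>mid Y\<^esub> = \<zero>\<^bsub>M\<^esub>" "proj_map X \<zero>\<^bsub>mid X\<^esub> = \<zero>\<^bsub>M\<^esub>"
    using module_hom_zero[OF _ M] DX DY by auto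
  have neg: "\<ominus>\<^bsub>mid Y\<^esub> inj_map Y a = inj_map Y (\<ominus>\<^bsub>N\<^esub> a)" if "a \<in> carrier N" for a
    using IY(2)[of "\<ominus>\<^bsub>N\<^esub> a" a] that I0(1) by (intro Y.minus_equality) (auto simp: N.l_neg DY(8))
  have C_add: "(x \<oplus>\<^bsub>mid X\<^esub> x', y \<oplus>\<^bsub>mid Y\<^esub> y') \<in> C" if "(x, y) \<in> C" "(x', y') \<in> C" for x y x' y'
    using that PX(2) PY(2) unfolding C_def by auto
  have C_smult: "(s \<odot>\<^bsub>mid X\<^esub> x, s \<odot>\<^bsub>mid Y\<^esub> y) \<in> C" if "s \<in> carrier S" "(x, y) \<in> C" for s x y
    using that PX(3) PY(3) unfolding C_def by auto
  have C_inj: "(inj_map X a, inj_map Y b) \<in> C" if "a \<in> carrier N" "b \<in> carrier N" for a b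
    using that DX(7,8) DY(7,8) unfolding C_def by auto
  have C_neg: "(\<ominus>\<^bsub>mid X\<^esub> x, \<ominus>\<^bsub>mid Y\<^esub> y) \<in> C" if "(x, y) \<in> C" for x y
  proof -
    have "x \<in> carrier (mid X)" "y \<in> carrier (mid Y)" using that by (auto simp: C_def)
    then have "(\<ominus>\<^bsub>S\<^esub> \<one>\<^bsub>S\<^esub> \<odot>\<^bsub>mid X\<^esub> x, \<ominus>\<^bsub>S\<^esub> \<one>\<^bsub>S\<^esub> \<odot>\<^bsub>mid Y\<^esub> y) = (\<ominus>\<^bsub>mid X\<^esub> x, \<ominus>\<^bsub>mid Y\<^esub> y)"
      by (simp add: X.smult_l_minus Y.smult_l_minus)
    then show ?thesis using C_smult[OF _ that, of "\<ominus>\<^bsub>S\<^esub> \<one>\<^bsub>S\<^esub>"] by simp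
  qed
  have C_mem: "x \<in> carrier (mid X)" "y \<in> carrier (mid Y)" "proj_map X x = proj_map Y y" if "(x, y) \<in> C" for x y
    using that by (auto simp: C_def)
  have \<theta>_C: "\<theta> x y \<in> carrier (mid W)" "proj_map W (\<theta> x y) = proj_map X x" if "(x, y) \<in> C" for x y
    using closed C_mem[OF that] by auto
  have \<theta>_add: "\<theta> (x \<oplus>\<^bsub>mid X\<^esub> x') (y \<oplus>\<^bsub>mid Y\<^esub> y') = \<theta> x y \<oplus>\<^bsub>mid W\<^esub> \<theta> x' y'"
    if "(x, y) \<in> C" "(x', y') \<in> C" for x y x' y'
    using add C_mem[OF that(1)] C_mem[OF that(2)] by auto
  \<comment> \<open>the antidiagonal copy of \<open>N\<close> is exactly the kernel of \<open>\<theta>\<close>\<close>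
  have ker: "(x, y) \<in> K \<longleftrightarrow> (x, y) \<in> C \<and> \<theta> x y = \<zero>\<^bsub>mid W\<^esub>" for x y
  proof
    assume "(x, y) \<in> K"
    then obtain a where a: "a \<in> carrier N" "x = inj_map X a" "y = inj_map Y (\<ominus>\<^bsub>N\<^esub> a)"
      using neg by (auto simp: K_def)
    then show "(x, y) \<in> C \<and> \<theta> x y = \<zero>\<^bsub>mid W\<^esub>"
      using C_inj[of a "\<ominus>\<^bsub>N\<^esub> a"] inj[of a "\<ominus>\<^bsub>N\<^esub> a"] I0(3) by (simp add: N.r_neg)
  next
    assume xy: "(x, y) \<in> C \<and> \<theta> x y = \<zero>\<^bsub>mid W\<^esub>"
    then have "proj_map X x = \<zero>\<^bsub>M\<^esub>" "proj_map Y y = \<zero>\<^bsub>M\<^esub>"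
      using \<theta>_C(2)[of x y] C_mem[of x y] module_hom_zero[OF DW(1) M DW(3)] by auto
    then obtain a b where ab: "a \<in> carrier N" "b \<in> carrier N" "x = inj_map X a" "y = inj_map Y b"
      using DX(6)[of x] DY(6)[of y] C_mem[of x y] xy by auto
    then have "inj_map W (a \<oplus>\<^bsub>N\<^esub> b) = inj_map W \<zero>\<^bsub>N\<^esub>" using inj xy I0 by auto
    then have "a \<oplus>\<^bsub>N\<^esub> b = \<zero>\<^bsub>N\<^esub>" using inj_onD[OF DW(4)] ab by auto
    then have "b = \<ominus>\<^bsub>N\<^esub> a" using ab by (metis N.minus_equality N.a_comm)
    then show "(x, y) \<in> K" unfolding K_def using ab neg by auto
  qed
  have fibre: "K +>\<^bsub>P\<^esub> (x, y) = \<kappa> (\<theta> x y)" if xy: "(x, y) \<in> C" for x y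
  proof (intro equalityI subsetI)
    fix c assume "c \<in> K +>\<^bsub>P\<^esub> (x, y)"
    then obtain p q where pq: "(p, q) \<in> K" "c = (p \<oplus>\<^bsub>mid X\<^esub> x, q \<oplus>\<^bsub>mid Y\<^esub> y)"
      by (auto simp: a_r_coset_def' Ps)
    then have "(p, q) \<in> C" "\<theta> p q = \<zero>\<^bsub>mid W\<^esub>" using ker by auto
    then show "c \<in> \<kappa> (\<theta> x y)"
      using C_add[of p q x y] \<theta>_add[of p q x y] xy \<theta>_C(1)[OF xy] pq(2) by (simp add: \<kappa>_def)
  next
    fix c assume "c \<in> \<kappa> (\<theta> x y)"
    then obtain x' y' where c: "c = (x', y')" "(x', y') \<in> C" "\<theta> x' y' = \<theta> x y"
      by (cases c) (auto simp: \<kappa>_def)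
    let ?p = "x' \<oplus>\<^bsub>mid X\<^esub> \<ominus>\<^bsub>mid X\<^esub> x" and ?q = "y' \<oplus>\<^bsub>mid Y\<^esub> \<ominus>\<^bsub>mid Y\<^esub> y"
    have pq: "(?p, ?q) \<in> C" by (rule C_add[OF c(2) C_neg[OF xy]])
    have eq: "?p \<oplus>\<^bsub>mid X\<^esub> x = x'" "?q \<oplus>\<^bsub>mid Y\<^esub> y = y'"
      using C_mem[OF xy] C_mem[OF c(2)] by (simp_all add: X.a_assoc X.l_neg Y.a_assoc Y.l_neg)
    have "\<theta> x y = \<theta> ?p ?q \<oplus>\<^bsub>mid W\<^esub> \<theta> x y"
      using \<theta>_add[OF pq xy] unfolding eq c(3) .
    then have "\<theta> ?p ?q = \<zero>\<^bsub>mid W\<^esub>" using W.add.r_cancel_one'[OF \<theta>_C(1)[OF xy] \<theta>_C(1)[OF pq]] by simp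
    then have "(?p, ?q) \<in> K" using ker pq by blast
    then show "c \<in> K +>\<^bsub>P\<^esub> (x, y)"
      unfolding a_r_coset_def' Ps using eq c(1) by (auto intro!: bexI[of _ "(?p, ?q)"])
  qed
  have surj: "\<exists>x y. (x, y) \<in> C \<and> \<theta> x y = w" if w: "w \<in> carrier (mid W)" for w
  proof -
    obtain x where x: "x \<in> carrier (mid X)" "proj_map X x = proj_map W w" using DX(5) DW(9) w by metis
    obtain y where y: "y \<in> carrier (mid Y)" "proj_map Y y = proj_map W w" using DY(5) DW(9) w by metis
    have xy: "(x, y) \<in> C" using x y by (simp add: C_def)
    obtain a where a: "a \<in> carrier N" "w = inj_map W a \<oplus>\<^bsub>mid W\<^esub> \<theta> x y"
      using extension_same_proj[OF M W w \<theta>_C(1)[OF xy]] \<theta>_C(2)[OF xy] x(2) by auto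
    have C: "(inj_map X a, inj_map Y \<zero>\<^bsub>N\<^esub>) \<in> C" using C_inj a(1) by simp
    have "\<theta> (inj_map X a \<oplus>\<^bsub>mid X\<^esub> x) (inj_map Y \<zero>\<^bsub>N\<^esub> \<oplus>\<^bsub>mid Y\<^esub> y) = w"
      using \<theta>_add[OF C xy] inj[of a "\<zero>\<^bsub>N\<^esub>"] a by simp
    then show ?thesis using C_add[OF C xy] by blast
  qed
  have \<kappa>_inj: "v = w" if v: "v \<in> carrier (mid W)" and eq: "\<kappa> v = \<kappa> w" for v w
  proof -
    obtain x y where "(x, y) \<in> C" "\<theta> x y = v" using surj[OF v] by blast
    then have "(x, y) \<in> \<kappa> w" unfolding eq[symmetric] by (simp add: \<kappa>_def)
    then show ?thesis using \<open>\<theta> x y = v\<close> by (simp add: \<kappa>_def)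
  qed
  have carrier_Q: "carrier (quotient_module P K) = \<kappa> ` carrier (mid W)"
  proof -
    have "carrier (quotient_module P K) = (\<lambda>c. K +>\<^bsub>P\<^esub> c) ` C"
      by (auto simp: quotient_module_def A_RCOSETS_def' Ps)
    also have "\<dots> = (\<lambda>(x, y). \<kappa> (\<theta> x y)) ` C" using fibre by (intro image_cong) auto
    also have "\<dots> = \<kappa> ` (\<lambda>(x, y). \<theta> x y) ` C" by (simp add: image_image case_prod_unfold)
    also have "(\<lambda>(x, y). \<theta> x y) ` C = carrier (mid W)"
    proof (intro equalityI subsetI)
      fix w assume "w \<in> carrier (mid W)"
      then obtain x y where "(x, y) \<in> C" "\<theta> x y = w" using surj by blast
      then show "w \<in> (\<lambda>(x, y). \<theta> x y) ` C" by (intro image_eqI[of _ _ "(x, y)"]) simp_all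
    qed (use \<theta>_C(1) in auto)
    finally show ?thesis .
  qed
  have \<kappa>_add: "\<kappa> v <+>\<^bsub>P\<^esub> \<kappa> w = \<kappa> (v \<oplus>\<^bsub>mid W\<^esub> w)" if vw: "v \<in> carrier (mid W)" "w \<in> carrier (mid W)" for v w
  proof (intro equalityI subsetI)
    fix c assume "c \<in> \<kappa> v <+>\<^bsub>P\<^esub> \<kappa> w"
    then show "c \<in> \<kappa> (v \<oplus>\<^bsub>mid W\<^esub> w)"
      using C_add \<theta>_add by (auto simp: set_add_def set_mult_def \<kappa>_def Ps)
  next
    fix c assume "c \<in> \<kappa> (v \<oplus>\<^bsub>mid W\<^esub> w)"
    then obtain x y where c: "c = (x, y)" "(x, y) \<in> C" "\<theta> x y = v \<oplus>\<^bsub>mid W\<^esub> w"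
      by (cases c) (auto simp: \<kappa>_def)
    obtain x' y' where c': "(x', y') \<in> C" "\<theta> x' y' = w" using surj vw by blast
    let ?p = "x \<oplus>\<^bsub>mid X\<^esub> \<ominus>\<^bsub>mid X\<^esub> x'" and ?q = "y \<oplus>\<^bsub>mid Y\<^esub> \<ominus>\<^bsub>mid Y\<^esub> y'"
    have pq: "(?p, ?q) \<in> C" by (rule C_add[OF c(2) C_neg[OF c'(1)]])
    have eq: "?p \<oplus>\<^bsub>mid X\<^esub> x' = x" "?q \<oplus>\<^bsub>mid Y\<^esub> y' = y"
      using C_mem[OF c'(1)] C_mem[OF c(2)] by (simp_all add: X.a_assoc X.l_neg Y.a_assoc Y.l_neg)
    have "\<theta> ?p ?q \<oplus>\<^bsub>mid W\<^esub> w = v \<oplus>\<^bsub>mid W\<^esub> w"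
      using \<theta>_add[OF pq c'(1)] c(3) c'(2) eq by simp
    then have "\<theta> ?p ?q = v" using vw \<theta>_C(1)[OF pq] by simp
    then have "(?p, ?q) \<in> \<kappa> v" "(x', y') \<in> \<kappa> w" using pq c' by (auto simp: \<kappa>_def)
    moreover have "c = (?p, ?q) \<oplus>\<^bsub>P\<^esub> (x', y')" using c(1) eq by (simp add: Ps)
    ultimately show "c \<in> \<kappa> v <+>\<^bsub>P\<^esub> \<kappa> w" unfolding set_add_def set_mult_def by auto
  qed
  have \<kappa>_smult: "(\<Union>x\<in>\<kappa> w. K +>\<^bsub>P\<^esub> (s \<odot>\<^bsub>P\<^esub> x)) = \<kappa> (s \<odot>\<^bsub>mid W\<^esub> w)"
    if sw: "s \<in> carrier S" "w \<in> carrier (mid W)" for s w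
  proof -
    have "K +>\<^bsub>P\<^esub> (s \<odot>\<^bsub>P\<^esub> c) = \<kappa> (s \<odot>\<^bsub>mid W\<^esub> w)" if "c \<in> \<kappa> w" for c
    proof -
      obtain x y where c: "c = (x, y)" "(x, y) \<in> C" "\<theta> x y = w" using \<open>c \<in> \<kappa> w\<close> by (cases c) (auto simp: \<kappa>_def)
      show ?thesis
        using fibre[OF C_smult[OF sw(1) c(2)]] smult[OF sw(1) C_mem[OF c(2)]] c(1,3) by (simp add: Ps)
    qed
    moreover have "\<kappa> w \<noteq> {}" using surj[OF sw(2)] by (auto simp: \<kappa>_def)
    ultimately show ?thesis by auto
  qed
  have "\<kappa> \<in> LinearCombinations.module_hom S (mid W) (quotient_module P K)"
    by (rule module_homI) (simp_all add: carrier_Q, simp_all add: quotient_module_def \<kappa>_add \<kappa>_smult)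
  moreover have "bij_betw \<kappa> (carrier (mid W)) (carrier (quotient_module P K))"
    unfolding carrier_Q bij_betw_def using \<kappa>_inj by (auto simp: inj_on_def)
  moreover have "\<kappa> (inj_map W a) = K +>\<^bsub>P\<^esub> (inj_map X a, \<zero>\<^bsub>mid Y\<^esub>)" if a: "a \<in> carrier N" for a
    using fibre[of "inj_map X a" "inj_map Y \<zero>\<^bsub>N\<^esub>"] C_inj[of a "\<zero>\<^bsub>N\<^esub>"] inj[of a "\<zero>\<^bsub>N\<^esub>"] a I0 by simp
  moreover have "proj_map X (fst (SOME c. c \<in> \<kappa> w)) = proj_map W w" if w: "w \<in> carrier (mid W)" for w
  proof -
    have "(SOME c. c \<in> \<kappa> w) \<in> \<kappa> w" using surj[OF w] by (intro someI_ex[of "\<lambda>c. c \<in> \<kappa> w"]) (auto simp: \<kappa>_def)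
    then obtain x y where "(SOME c. c \<in> \<kappa> w) = (x, y)" "(x, y) \<in> C" "\<theta> x y = w"
      by (cases "SOME c. c \<in> \<kappa> w") (auto simp: \<kappa>_def)
    then show ?thesis using \<theta>_C(2)[of x y] by simp
  qed
  ultimately show ?thesis unfolding ext_equiv_def baer extension.simps by blast
qed

section \<open>Restriction of scalars\<close>

lemma restrict_scalars_simps [simp]:
  "carrier (restrict_scalars h M) = carrier M" "\<zero>\<^bsub>restrict_scalars h M\<^esub> = \<zero>\<^bsub>M\<^esub>"
  "x \<oplus>\<^bsub>restrict_scalars h M\<^esub> y = x \<oplus>\<^bsub>M\<^esub> y" "s \<odot>\<^bsub>restrict_scalars h M\<^esub> x = h s \<odot>\<^bsub>M\<^esub> x"
  by (simp_all add: restrict_scalars_def)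

lemma restrict_scalars_module:
  fixes h :: "'s::comm_ring_1 \<Rightarrow> 'a::comm_ring_1"
  assumes h: "comm_ring_hom h" and M: "module class_ring M"
  shows "module class_ring (restrict_scalars h M)"
proof -
  interpret h: comm_ring_hom h by fact
  interpret M: Module.module class_ring M by fact
  show ?thesis
  proof (rule moduleI)
    show "cring (class_ring :: 's ring)" by (rule class_cring.cring_axioms)
    show "abelian_group (restrict_scalars h M)"
    proof (rule abelian_groupI)
      fix x assume "x \<in> carrier (restrict_scalars h M)"
      then show "\<exists>y\<in>carrier (restrict_scalars h M). y \<oplus>\<^bsub>restrict_scalars h M\<^esub> x = \<zero>\<^bsub>restrict_scalars h M\<^esub>"
        by (intro bexI[of _ "\<ominus>\<^bsub>M\<^esub> x"]) (simp_all add: M.l_neg)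
    qed (auto simp: M.a_ac)
  qed (use M.smult_l_distr M.smult_r_distr M.smult_assoc1 M.smult_one M.smult_closed in \<open>auto simp: h.hom_add h.hom_mult\<close>)
qed

lemma restrict_scalars_extension:
  fixes h :: "'s::comm_ring_1 \<Rightarrow> 'a::comm_ring_1"
  assumes h: "comm_ring_hom h" and X: "is_extension class_ring M N X"
  shows "is_extension class_ring (restrict_scalars h M) (restrict_scalars h N)
    \<lparr>mid = restrict_scalars h (mid X), inj_map = inj_map X, proj_map = proj_map X\<rparr>"
  using X restrict_scalars_module[OF h] unfolding is_extension_def
  by (auto simp: LinearCombinations.module_hom_def)

section \<open>Modules over a polynomial ring\<close>

lemma mult_mat_smult_vec:
  fixes A :: "'a::comm_ring_1 mat"
  assumes "A \<in> carrier_mat m n" "v \<in> carrier_vec n"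
  shows "A *\<^sub>v (a \<cdot>\<^sub>v v) = a \<cdot>\<^sub>v (A *\<^sub>v v)"
  using assms by (intro eq_vecI) (auto simp: scalar_prod_def sum_distrib_left mult.left_commute)

lemma zero_smult_vec: "v \<in> carrier_vec n \<Longrightarrow> (0 :: 'a::comm_ring_1) \<cdot>\<^sub>v v = 0\<^sub>v n"
  by (intro eq_vecI) auto

lemma matrix_module_simps [simp]:
  "carrier (matrix_module n A) = carrier_vec n" "\<zero>\<^bsub>matrix_module n A\<^esub> = 0\<^sub>v n"
  "v \<oplus>\<^bsub>matrix_module n A\<^esub> w = v + w"
  by (simp_all add: matrix_module_def)

lemma matrix_module_smult_closed [simp]:
  assumes "A \<in> carrier_mat n n" "v \<in> carrier_vec n"
  shows "f \<odot>\<^bsub>matrix_module n A\<^esub> v \<in> carrier_vec n"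
  unfolding matrix_module_def using assms
  by (auto intro!: finsum_vec_closed mult_mat_vec_carrier[of _ n n])

lemma matrix_module_smult_index:
  assumes "A \<in> carrier_mat n n" "v \<in> carrier_vec n" "r < n" "degree f \<le> N"
  shows "(f \<odot>\<^bsub>matrix_module n A\<^esub> v) $ r = (\<Sum>i\<le>N. coeff f i * ((A ^\<^sub>m i) *\<^sub>v v) $ r)"
proof -
  have "(f \<odot>\<^bsub>matrix_module n A\<^esub> v) $ r = (\<Sum>i\<le>degree f. coeff f i * ((A ^\<^sub>m i) *\<^sub>v v) $ r)"
  proof -
    have "(\<lambda>i. coeff f i \<cdot>\<^sub>v ((A ^\<^sub>m i) *\<^sub>v v)) \<in> {..degree f} \<rightarrow> carrier_vec n"
      using assms(1,2) by (auto intro!: mult_mat_vec_carrier[of _ n n])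
    then have "finsum_vec TYPE('a) n (\<lambda>i. coeff f i \<cdot>\<^sub>v ((A ^\<^sub>m i) *\<^sub>v v)) {..degree f} $ r
        = (\<Sum>i\<le>degree f. (coeff f i \<cdot>\<^sub>v ((A ^\<^sub>m i) *\<^sub>v v)) $ r)"
      using assms(3) by (intro index_finsum_vec) auto
    then show ?thesis unfolding matrix_module_def using assms(1,3) by simp
  qed
  also have "\<dots> = (\<Sum>i\<le>N. coeff f i * ((A ^\<^sub>m i) *\<^sub>v v) $ r)"
    using assms(4) by (intro sum.mono_neutral_left) (auto simp: coeff_eq_0)
  finally show ?thesis .
qed

lemma matrix_module_add_left:
  assumes A: "A \<in> carrier_mat n n" and v: "v \<in> carrier_vec n"
  shows "(f + g) \<odot>\<^bsub>matrix_module n A\<^esub> v = f \<odot>\<^bsub>matrix_module n A\<^esub> v + g \<odot>\<^bsub>matrix_module n A\<^esub> v"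
proof (rule eq_vecI)
  have closed: "h \<odot>\<^bsub>matrix_module n A\<^esub> v \<in> carrier_vec n" for h using A v by simp
  then show "dim_vec ((f + g) \<odot>\<^bsub>matrix_module n A\<^esub> v) =
      dim_vec (f \<odot>\<^bsub>matrix_module n A\<^esub> v + g \<odot>\<^bsub>matrix_module n A\<^esub> v)"
    by (metis add_carrier_vec carrier_vecD)
  fix r assume "r < dim_vec (f \<odot>\<^bsub>matrix_module n A\<^esub> v + g \<odot>\<^bsub>matrix_module n A\<^esub> v)"
  then have r: "r < n" using closed by (metis add_carrier_vec carrier_vecD)
  let ?N = "max (degree f) (degree g)"
  note idx = matrix_module_smult_index[OF A v r, of _ ?N]
  show "((f + g) \<odot>\<^bsub>matrix_module n A\<^esub> v) $ r =
      (f \<odot>\<^bsub>matrix_module n A\<^esub> v + g \<odot>\<^bsub>matrix_module n A\<^esub> v) $ r"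
    using r closed[of g] idx[of "f + g"] idx[of f] idx[of g] degree_add_le_max[of f g]
    by (simp add: algebra_simps sum.distrib)
qed

lemma matrix_module_const:
  assumes "A \<in> carrier_mat n n" "v \<in> carrier_vec n"
  shows "[:c:] \<odot>\<^bsub>matrix_module n A\<^esub> v = c \<cdot>\<^sub>v v"
proof (rule eq_vecI)
  have c: "[:c:] \<odot>\<^bsub>matrix_module n A\<^esub> v \<in> carrier_vec n" using assms by simp
  then show "dim_vec ([:c:] \<odot>\<^bsub>matrix_module n A\<^esub> v) = dim_vec (c \<cdot>\<^sub>v v)" using assms by simp
  show "([:c:] \<odot>\<^bsub>matrix_module n A\<^esub> v) $ i = (c \<cdot>\<^sub>v v) $ i" if "i < dim_vec (c \<cdot>\<^sub>v v)" for i
    using matrix_module_smult_index[of A n v i "[:c:]" 0] assms that by simp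
qed

text \<open>Horner's rule, first with the extra factor \<open>A\<close> next to the vector, as it comes out of the powers
  of \<open>A\<close>; that polynomials in \<open>A\<close> commute with \<open>A\<close> then gives the form used afterwards.\<close>

lemma matrix_module_pCons_shift:
  assumes A: "A \<in> carrier_mat n n" and v: "v \<in> carrier_vec n"
  shows "pCons c f \<odot>\<^bsub>matrix_module n A\<^esub> v = c \<cdot>\<^sub>v v + f \<odot>\<^bsub>matrix_module n A\<^esub> (A *\<^sub>v v)"
proof (rule eq_vecI)
  let ?M = "matrix_module n A"
  have Av: "A *\<^sub>v v \<in> carrier_vec n" by (rule mult_mat_vec_carrier[OF A v])
  have closed: "pCons c f \<odot>\<^bsub>?M\<^esub> v \<in> carrier_vec n" "f \<odot>\<^bsub>?M\<^esub> (A *\<^sub>v v) \<in> carrier_vec n" using A v Av by auto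
  then show "dim_vec (pCons c f \<odot>\<^bsub>?M\<^esub> v) = dim_vec (c \<cdot>\<^sub>v v + f \<odot>\<^bsub>?M\<^esub> (A *\<^sub>v v))"
    by simp
  fix r assume "r < dim_vec (c \<cdot>\<^sub>v v + f \<odot>\<^bsub>?M\<^esub> (A *\<^sub>v v))"
  then have r: "r < n" using closed by simp
  have "(pCons c f \<odot>\<^bsub>?M\<^esub> v) $ r
      = (\<Sum>i\<le>Suc (degree f). coeff (pCons c f) i * ((A ^\<^sub>m i) *\<^sub>v v) $ r)"
    using A v r by (intro matrix_module_smult_index) (auto simp: degree_pCons_le)
  also have "\<dots> = c * v $ r + (\<Sum>i\<le>degree f. coeff f i * ((A ^\<^sub>m Suc i) *\<^sub>v v) $ r)"
    using A v r by (subst sum.atMost_Suc_shift) simp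
  also have "(\<Sum>i\<le>degree f. coeff f i * ((A ^\<^sub>m Suc i) *\<^sub>v v) $ r)
      = (\<Sum>i\<le>degree f. coeff f i * ((A ^\<^sub>m i) *\<^sub>v (A *\<^sub>v v)) $ r)"
    using A v by (intro sum.cong refl arg_cong2[where f = "(*)"] arg_cong2[where f = vec_index])
      (auto intro!: assoc_mult_mat_vec)
  also have "\<dots> = (f \<odot>\<^bsub>?M\<^esub> (A *\<^sub>v v)) $ r"
    using matrix_module_smult_index[OF A Av r, of f "degree f"] by simp
  finally show "(pCons c f \<odot>\<^bsub>?M\<^esub> v) $ r = (c \<cdot>\<^sub>v v + f \<odot>\<^bsub>?M\<^esub> (A *\<^sub>v v)) $ r"
    using r closed v by simp
qed

lemma matrix_module_zero_poly:
  assumes A: "A \<in> carrier_mat n n" and v: "v \<in> carrier_vec n"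
  shows "0 \<odot>\<^bsub>matrix_module n A\<^esub> v = 0\<^sub>v n"
  using matrix_module_const[OF A v, of 0] v by auto

lemma matrix_module_pCons:
  assumes A: "A \<in> carrier_mat n n" and v: "v \<in> carrier_vec n"
  shows "pCons c f \<odot>\<^bsub>matrix_module n A\<^esub> v = c \<cdot>\<^sub>v v + A *\<^sub>v (f \<odot>\<^bsub>matrix_module n A\<^esub> v)"
proof -
  have "f \<odot>\<^bsub>matrix_module n A\<^esub> (A *\<^sub>v v) = A *\<^sub>v (f \<odot>\<^bsub>matrix_module n A\<^esub> v)"
    if "v \<in> carrier_vec n" for v
    using that
  proof (induction f arbitrary: v)
    case 0
    then show ?case using A
      by (auto simp: matrix_module_zero_poly[OF A] mult_mat_vec_carrier[OF A] intro!: eq_vecI)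
  next
    case (pCons a f)
    have "A *\<^sub>v v \<in> carrier_vec n" by (rule mult_mat_vec_carrier[OF A pCons.prems])
    then show ?case using pCons A
      by (simp add: matrix_module_pCons_shift mult_add_distrib_mat_vec[OF A] mult_mat_smult_vec[OF A])
  qed
  then show ?thesis using v by (simp add: matrix_module_pCons_shift[OF A v])
qed

lemma matrix_module_t:
  assumes A: "A \<in> carrier_mat n n" and v: "v \<in> carrier_vec n"
  shows "[:0, 1:] \<odot>\<^bsub>matrix_module n A\<^esub> v = A *\<^sub>v v"
  using v mult_mat_vec_carrier[OF A v]
  by (simp add: matrix_module_pCons[OF A v, of 0 "[:1:]"] matrix_module_const[OF A v])
    (simp add: zero_smult_vec)

lemma matrix_module_is_module:
  fixes A :: "'a::comm_ring_1 mat"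
  assumes A: "A \<in> carrier_mat n n"
  shows "module class_ring (matrix_module n A)"
proof -
  let ?M = "matrix_module n A"
  note add_left = matrix_module_add_left[OF A] and pC = matrix_module_pCons[OF A]
  have cl: "f \<odot>\<^bsub>?M\<^esub> v \<in> carrier_vec n" if "v \<in> carrier_vec n" for f v using that A by simp
  have smult: "(Polynomial.smult a f) \<odot>\<^bsub>?M\<^esub> v = a \<cdot>\<^sub>v (f \<odot>\<^bsub>?M\<^esub> v)" if v: "v \<in> carrier_vec n" for a f v
  proof (induction f)
    case 0
    then show ?case using v A by (auto simp: matrix_module_zero_poly)
  next
    case (pCons b f)
    then show ?case using cl[OF v] v
      by (simp add: pC[OF v] smult_add_distrib_vec[of _ n] mult_mat_smult_vec[OF A] smult_smult_assoc
        mult_mat_vec_carrier[OF A])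
  qed
  have r_distr: "f \<odot>\<^bsub>?M\<^esub> (v + w) = f \<odot>\<^bsub>?M\<^esub> v + f \<odot>\<^bsub>?M\<^esub> w"
    if vw: "v \<in> carrier_vec n" "w \<in> carrier_vec n" for f v w
  proof (induction f)
    case 0
    then show ?case using vw A by (simp add: matrix_module_zero_poly)
  next
    case (pCons b f)
    have "b \<cdot>\<^sub>v (v + w) = b \<cdot>\<^sub>v v + b \<cdot>\<^sub>v w" by (rule smult_add_distrib_vec[OF vw])
    moreover have "A *\<^sub>v (f \<odot>\<^bsub>?M\<^esub> v + f \<odot>\<^bsub>?M\<^esub> w) = A *\<^sub>v (f \<odot>\<^bsub>?M\<^esub> v) + A *\<^sub>v (f \<odot>\<^bsub>?M\<^esub> w)"
      by (rule mult_add_distrib_mat_vec[OF A cl[OF vw(1)] cl[OF vw(2)]])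
    moreover have "v + w \<in> carrier_vec n" using vw by simp
    ultimately show ?case using pCons vw cl[OF vw(1)] cl[OF vw(2)]
        mult_mat_vec_carrier[OF A cl[OF vw(1)]] mult_mat_vec_carrier[OF A cl[OF vw(2)]]
      by (auto simp: pC)
  qed
  have assoc: "(f * g) \<odot>\<^bsub>?M\<^esub> v = f \<odot>\<^bsub>?M\<^esub> (g \<odot>\<^bsub>?M\<^esub> v)" if v: "v \<in> carrier_vec n" for f g v
  proof (induction f)
    case 0
    then show ?case using v A by (simp add: matrix_module_zero_poly)
  next
    case (pCons b f)
    then show ?case using mult_mat_vec_carrier[OF A cl[OF cl[OF v]]]
      by (simp add: add_left[OF v] pC[OF v] pC[OF cl[OF v]] smult[OF v] zero_smult_vec[OF v])
  qed
  show ?thesis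
  proof (rule moduleI)
    show "cring (class_ring :: 'a poly ring)" by (rule class_cring.cring_axioms)
    show "abelian_group ?M"
    proof (rule abelian_groupI)
      fix x assume "x \<in> carrier ?M"
      then show "\<exists>y\<in>carrier ?M. y \<oplus>\<^bsub>?M\<^esub> x = \<zero>\<^bsub>?M\<^esub>"
        by (intro bexI[of _ "- x"]) auto
    qed (auto simp: comm_add_vec)
  qed (use A in \<open>simp_all add: add_left r_distr assoc matrix_module_const flip: pCons_one\<close>)
qed

lemma matrix_module_finsum:
  fixes A :: "'a::comm_ring_1 mat"
  assumes A: "A \<in> carrier_mat n n" and "finite I" and "\<And>i. i \<in> I \<Longrightarrow> g i \<in> carrier_vec n"
  shows "(\<Oplus>\<^bsub>matrix_module n A\<^esub>i\<in>I. g i) \<in> carrier_vec n"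
    and "r < n \<Longrightarrow> (\<Oplus>\<^bsub>matrix_module n A\<^esub>i\<in>I. g i) $ r = (\<Sum>i\<in>I. g i $ r)"
proof -
  interpret M: Module.module class_ring "matrix_module n A" by (rule matrix_module_is_module[OF A])
  have "(\<Oplus>\<^bsub>matrix_module n A\<^esub>i\<in>I. g i) \<in> carrier_vec n \<and>
    (\<forall>r<n. (\<Oplus>\<^bsub>matrix_module n A\<^esub>i\<in>I. g i) $ r = (\<Sum>i\<in>I. g i $ r))"
    using assms(2,3)
  proof (induction I)
    case empty
    then show ?case using M.finsum_empty by auto
  next
    case (insert i I)
    have "g \<in> I \<rightarrow> carrier (matrix_module n A)" "g i \<in> carrier (matrix_module n A)" using insert by auto
    from M.finsum_insert[OF insert(1,2) this] insert show ?case by auto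
  qed
  then show "(\<Oplus>\<^bsub>matrix_module n A\<^esub>i\<in>I. g i) \<in> carrier_vec n"
    and "r < n \<Longrightarrow> (\<Oplus>\<^bsub>matrix_module n A\<^esub>i\<in>I. g i) $ r = (\<Sum>i\<in>I. g i $ r)" by auto
qed

lemma module_pCons:
  assumes "module class_ring E" "x \<in> carrier E"
  shows "pCons c f \<odot>\<^bsub>E\<^esub> x = [:c:] \<odot>\<^bsub>E\<^esub> x \<oplus>\<^bsub>E\<^esub> [:0, 1:] \<odot>\<^bsub>E\<^esub> (f \<odot>\<^bsub>E\<^esub> x)"
proof -
  interpret E: Module.module class_ring E by fact
  have "pCons c f = [:c:] + [:0, 1:] * f" by simp
  then show ?thesis using E.smult_l_distr[of "[:c:]" "[:0, 1:] * f" x] E.smult_assoc1[of "[:0, 1:]" f x] assms(2)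
    by simp
qed

text \<open>The ring of scalars is generated by the constants and \<open>t\<close>, so linearity needs to be tested on
  these only.\<close>

lemma module_hom_polyI:
  fixes E :: "('a::comm_ring_1 poly, 'e) module"
  assumes E: "module class_ring E" and F: "module class_ring F"
    and closed: "\<And>x. x \<in> carrier E \<Longrightarrow> f x \<in> carrier F"
    and add: "\<And>x y. x \<in> carrier E \<Longrightarrow> y \<in> carrier E \<Longrightarrow> f (x \<oplus>\<^bsub>E\<^esub> y) = f x \<oplus>\<^bsub>F\<^esub> f y"
    and const: "\<And>c x. x \<in> carrier E \<Longrightarrow> f ([:c:] \<odot>\<^bsub>E\<^esub> x) = [:c:] \<odot>\<^bsub>F\<^esub> f x"
    and t: "\<And>x. x \<in> carrier E \<Longrightarrow> f ([:0, 1:] \<odot>\<^bsub>E\<^esub> x) = [:0, 1:] \<odot>\<^bsub>F\<^esub> f x"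
  shows "f \<in> LinearCombinations.module_hom class_ring E F"
proof (rule module_homI[OF closed add])
  interpret E: Module.module class_ring E by fact
  interpret F: Module.module class_ring F by fact
  fix s :: "'a poly" and x assume x: "x \<in> carrier E"
  have Ec: "p \<odot>\<^bsub>E\<^esub> y \<in> carrier E" if "y \<in> carrier E" for p y using E.smult_closed that by simp
  show "f (s \<odot>\<^bsub>E\<^esub> x) = s \<odot>\<^bsub>F\<^esub> f x"
  proof (induction s)
    case 0
    then show ?case using const[OF x, of 0] by simp
  next
    case (pCons c s)
    then show ?case using x closed
      unfolding module_pCons[OF E x, of c s] module_pCons[OF F closed[OF x], of c s]
      by (simp add: add const t Ec)
  qed
qed

text \<open>The fibre product is closed under constants and under \<open>t\<close>, so an induction on polynomials reduces
  the linearity of \<open>\<theta>\<close> in the recognition principle to these scalars.\<close>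

lemma baer_sum_equiv_poly:
  fixes X :: "('a::comm_ring_1 poly, 'n, 'e, 'm) extension" and Y :: "('a poly, 'n, 'f, 'm) extension"
    and W :: "('a poly, 'n, 'g, 'm) extension"
  assumes M: "module class_ring M" and N: "module class_ring N"
    and X: "is_extension class_ring M N X" and Y: "is_extension class_ring M N Y"
    and W: "is_extension class_ring M N W"
    and closed: "\<And>x y. x \<in> carrier (mid X) \<Longrightarrow> y \<in> carrier (mid Y) \<Longrightarrow> proj_map X x = proj_map Y y \<Longrightarrow>
      \<theta> x y \<in> carrier (mid W) \<and> proj_map W (\<theta> x y) = proj_map X x"
    and add: "\<And>x y x' y'. x \<in> carrier (mid X) \<Longrightarrow> y \<in> carrier (mid Y) \<Longrightarrow> proj_map X x = proj_map Y y \<Longrightarrow>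
      x' \<in> carrier (mid X) \<Longrightarrow> y' \<in> carrier (mid Y) \<Longrightarrow> proj_map X x' = proj_map Y y' \<Longrightarrow>
      \<theta> (x \<oplus>\<^bsub>mid X\<^esub> x') (y \<oplus>\<^bsub>mid Y\<^esub> y') = \<theta> x y \<oplus>\<^bsub>mid W\<^esub> \<theta> x' y'"
    and const: "\<And>c x y. x \<in> carrier (mid X) \<Longrightarrow> y \<in> carrier (mid Y) \<Longrightarrow> proj_map X x = proj_map Y y \<Longrightarrow>
      \<theta> ([:c:] \<odot>\<^bsub>mid X\<^esub> x) ([:c:] \<odot>\<^bsub>mid Y\<^esub> y) = [:c:] \<odot>\<^bsub>mid W\<^esub> \<theta> x y"
    and t: "\<And>x y. x \<in> carrier (mid X) \<Longrightarrow> y \<in> carrier (mid Y) \<Longrightarrow> proj_map X x = proj_map Y y \<Longrightarrow>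
      \<theta> ([:0, 1:] \<odot>\<^bsub>mid X\<^esub> x) ([:0, 1:] \<odot>\<^bsub>mid Y\<^esub> y) = [:0, 1:] \<odot>\<^bsub>mid W\<^esub> \<theta> x y"
    and inj: "\<And>a b. a \<in> carrier N \<Longrightarrow> b \<in> carrier N \<Longrightarrow>
      \<theta> (inj_map X a) (inj_map Y b) = inj_map W (a \<oplus>\<^bsub>N\<^esub> b)"
  shows "ext_equiv class_ring N W (baer_sum N X Y)"
proof (rule baer_sum_equiv[OF M N X Y W closed add _ inj])
  note DX = is_extensionD[OF X] and DY = is_extensionD[OF Y] and DW = is_extensionD[OF W]
  interpret X: Module.module class_ring "mid X" by (rule DX(1))
  interpret Y: Module.module class_ring "mid Y" by (rule DY(1))
  interpret W: Module.module class_ring "mid W" by (rule DW(1))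
  note PX = module_homD[OF DX(3)] and PY = module_homD[OF DY(3)]
  have cl: "s \<odot>\<^bsub>mid X\<^esub> x \<in> carrier (mid X)" "s \<odot>\<^bsub>mid Y\<^esub> y \<in> carrier (mid Y)"
      "proj_map X (s \<odot>\<^bsub>mid X\<^esub> x) = proj_map Y (s \<odot>\<^bsub>mid Y\<^esub> y)"
    if "x \<in> carrier (mid X)" "y \<in> carrier (mid Y)" "proj_map X x = proj_map Y y" for s x y
    using X.smult_closed[of s x] Y.smult_closed[of s y] PX(3)[of s x] PY(3)[of s y] that by simp_all
  fix s :: "'a poly" and x y
  assume xy: "x \<in> carrier (mid X)" "y \<in> carrier (mid Y)" "proj_map X x = proj_map Y y"
  have \<theta>: "\<theta> x y \<in> carrier (mid W)" using closed[OF xy] by blast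
  show "\<theta> (s \<odot>\<^bsub>mid X\<^esub> x) (s \<odot>\<^bsub>mid Y\<^esub> y) = s \<odot>\<^bsub>mid W\<^esub> \<theta> x y"
  proof (induction s)
    case 0
    then show ?case using const[OF xy, of 0] by simp
  next
    case (pCons c s)
    let ?t = "[:0, 1:] :: 'a poly"
    have "\<theta> ([:c:] \<odot>\<^bsub>mid X\<^esub> x \<oplus>\<^bsub>mid X\<^esub> ?t \<odot>\<^bsub>mid X\<^esub> (s \<odot>\<^bsub>mid X\<^esub> x))
        ([:c:] \<odot>\<^bsub>mid Y\<^esub> y \<oplus>\<^bsub>mid Y\<^esub> ?t \<odot>\<^bsub>mid Y\<^esub> (s \<odot>\<^bsub>mid Y\<^esub> y)) =
        [:c:] \<odot>\<^bsub>mid W\<^esub> \<theta> x y \<oplus>\<^bsub>mid W\<^esub> ?t \<odot>\<^bsub>mid W\<^esub> (s \<odot>\<^bsub>mid W\<^esub> \<theta> x y)"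
      using add[OF cl[OF xy, of "[:c:]"] cl[OF cl[OF xy, of s], of ?t]] const[OF xy] t[OF cl[OF xy, of s]] pCons.IH
      by simp
    then show ?case
      unfolding module_pCons[OF DX(1) xy(1), of c s] module_pCons[OF DY(1) xy(2), of c s]
        module_pCons[OF DW(1) \<theta>, of c s] .
  qed
qed

lemma is_t_matrix_ext_equiv:
  assumes X: "is_extension class_ring M N X" and Y: "is_extension class_ring M N Y"
    and XY: "ext_equiv class_ring N X Y" and t: "is_t_matrix n X B"
  shows "is_t_matrix n Y B"
proof -
  interpret X: Module.module class_ring "mid X" by (rule is_extensionD(1)[OF X])
  obtain f where f: "f \<in> LinearCombinations.module_hom class_ring (mid X) (mid Y)"
      "bij_betw f (carrier (mid X)) (carrier (mid Y))"
      "\<And>x. x \<in> carrier (mid X) \<Longrightarrow> proj_map Y (f x) = proj_map X x"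
    using XY unfolding ext_equiv_def by blast
  note F = module_homD[OF f(1)]
  obtain b where B: "B \<in> carrier_mat n n"
    and b: "\<And>j. j < n \<Longrightarrow> b j \<in> carrier (mid X)" "\<And>j. j < n \<Longrightarrow> proj_map X (b j) = unit_vec n j"
    and bij: "bij_betw (\<lambda>c. \<Oplus>\<^bsub>mid X\<^esub>j\<in>{..<n}. [:c $ j:] \<odot>\<^bsub>mid X\<^esub> b j) (carrier_vec n) (carrier (mid X))"
    and tb: "\<And>j. j < n \<Longrightarrow> [:0, 1:] \<odot>\<^bsub>mid X\<^esub> b j = (\<Oplus>\<^bsub>mid X\<^esub>i\<in>{..<n}. [:B $$ (i, j):] \<odot>\<^bsub>mid X\<^esub> b i)"
    using t unfolding is_t_matrix_def by auto
  have sums: "f (\<Oplus>\<^bsub>mid X\<^esub>j\<in>{..<n}. [:c j:] \<odot>\<^bsub>mid X\<^esub> b j) = (\<Oplus>\<^bsub>mid Y\<^esub>j\<in>{..<n}. [:c j:] \<odot>\<^bsub>mid Y\<^esub> f (b j))" for c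
  proof -
    interpret Y: Module.module class_ring "mid Y" by (rule is_extensionD(1)[OF Y])
    have "f (\<Oplus>\<^bsub>mid X\<^esub>j\<in>{..<n}. [:c j:] \<odot>\<^bsub>mid X\<^esub> b j) = (\<Oplus>\<^bsub>mid Y\<^esub>j\<in>{..<n}. f ([:c j:] \<odot>\<^bsub>mid X\<^esub> b j))"
      using b(1) X.smult_closed
      by (intro module_hom_finsum[OF is_extensionD(1)[OF X] is_extensionD(1)[OF Y] f(1)]) auto
    also have "\<dots> = (\<Oplus>\<^bsub>mid Y\<^esub>j\<in>{..<n}. [:c j:] \<odot>\<^bsub>mid Y\<^esub> f (b j))"
      using b(1) F Y.smult_closed by (intro Y.finsum_cong') auto
    finally show ?thesis .
  qed
  show ?thesis unfolding is_t_matrix_def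
  proof (intro conjI exI[of _ "\<lambda>j. f (b j)"] allI impI)
    show "bij_betw (\<lambda>c. \<Oplus>\<^bsub>mid Y\<^esub>j\<in>{..<n}. [:c $ j:] \<odot>\<^bsub>mid Y\<^esub> f (b j)) (carrier_vec n) (carrier (mid Y))"
      using bij_betw_trans[OF bij f(2)] by (simp add: comp_def sums)
    show "[:0, 1:] \<odot>\<^bsub>mid Y\<^esub> f (b j) = (\<Oplus>\<^bsub>mid Y\<^esub>i\<in>{..<n}. [:B $$ (i, j):] \<odot>\<^bsub>mid Y\<^esub> f (b i))" if "j < n" for j
      using F(3)[of "[:0,1:]" "b j"] b(1) that tb sums by simp
  qed (use B b F f in auto)
qed

section \<open>Square-zero lifts of a matrix\<close>

lemma monic_power_ring:
  fixes f :: "'a::comm_ring_1 poly"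
  assumes "lead_coeff f = 1"
  shows "lead_coeff (f ^ m) = 1 \<and> degree (f ^ m) = degree f * m"
proof (induction m)
  case (Suc m)
  have "coeff (f * f ^ m) (degree f + degree (f ^ m)) = 1"
    unfolding coeff_mult_degree_sum assms conjunct1[OF Suc.IH] by simp
  moreover have "degree (f * f ^ m) = degree f + degree (f ^ m)"
    using calculation degree_mult_le[of f "f ^ m"] le_degree[of "f * f ^ m" "degree f + degree (f ^ m)"] by simp
  ultimately show ?case using Suc by simp
qed simp

lemma (in comm_ring_hom) map_mat_diag_block_mat:
  "mat\<^sub>h (diag_block_mat Bs) = diag_block_mat (map mat\<^sub>h Bs)"
proof (induction Bs)
  case (Cons B Bs)
  have "mat\<^sub>h (four_block_mat B (0\<^sub>m (dim_row B) c) (0\<^sub>m r (dim_col B)) C)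
      = four_block_mat (mat\<^sub>h B) (0\<^sub>m (dim_row B) c) (0\<^sub>m r (dim_col B)) (mat\<^sub>h C)"
    if "r = dim_row C" "c = dim_col C" for C r c
    using that by (intro eq_matI) (auto simp: Let_def)
  then show ?case by (simp add: Let_def Cons.IH[symmetric])
qed (auto intro!: eq_matI)

text \<open>What is used of the ring \<open>R\<close>: multiplication by \<open>\<pi>\<close> induces an isomorphism from \<open>k\<close> onto the
  kernel of the reduction map.\<close>

locale length_two_reduction =
  comm_ring_hom red for red :: "'r::comm_ring_1 \<Rightarrow> 'k::field" +
  fixes \<pi> :: 'r
  assumes red_surj: "surj red"
    and red_zero_iff: "red x = 0 \<longleftrightarrow> (\<exists>y. x = \<pi> * y)"
    and annihilator: "\<pi> * x = 0 \<longleftrightarrow> red x = 0"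
begin

abbreviation "\<iota> \<equiv> pi_lift \<pi> red"

lemma pi_lift_red: "\<iota> (red y) = \<pi> * y"
proof -
  have "red (SOME z. red z = red y) = red y" by (rule someI) simp
  then have "\<pi> * ((SOME z. red z = red y) - y) = 0" by (simp add: annihilator hom_minus)
  then show ?thesis by (simp add: pi_lift_def right_diff_distrib)
qed

lemma red_preimage: obtains y where "x = red y"
  using red_surj by (metis surjD)

lemma pi_lift_add: "\<iota> (x + y) = \<iota> x + \<iota> y"
  by (rule red_preimage[of x], rule red_preimage[of y])
    (simp add: pi_lift_red distrib_left flip: hom_add)

lemma pi_lift_mult: "\<iota> (red c * x) = c * \<iota> x"
  by (rule red_preimage[of x]) (simp add: pi_lift_red mult.left_commute flip: hom_mult)

lemma pi_lift_zero [simp]: "\<iota> 0 = 0"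
  using pi_lift_red[of 0] by simp

lemma pi_lift_uminus: "\<iota> (- x) = - \<iota> x"
  by (metis add.right_neutral add_diff_cancel_left' add_eq_0_iff minus_add_cancel pi_lift_add pi_lift_zero)

lemma pi_lift_diff: "\<iota> (x - y) = \<iota> x - \<iota> y"
  using pi_lift_add[of x "-y"] by (simp add: pi_lift_uminus)

lemma pi_lift_sum: "\<iota> (sum f I) = (\<Sum>i\<in>I. \<iota> (f i))"
  by (induction I rule: infinite_finite_induct) (simp_all add: pi_lift_add)

lemma pi_lift_eq_0_iff: "\<iota> x = 0 \<longleftrightarrow> x = 0"
  by (rule red_preimage[of x]) (simp add: pi_lift_red annihilator)

lemma pi_lift_inj: "\<iota> x = \<iota> y \<longleftrightarrow> x = y"
  using pi_lift_eq_0_iff[of "x - y"] by (simp add: pi_lift_diff)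

lemma red_pi_lift [simp]: "red (\<iota> x) = 0"
  by (rule red_preimage[of x]) (auto simp: pi_lift_red red_zero_iff)

lemma red_zeroD: "red x = 0 \<Longrightarrow> \<exists>y. x = \<iota> y"
  by (metis red_zero_iff pi_lift_red)

lemma pi_lift_vec_add:
  "dim_vec v = dim_vec w \<Longrightarrow> map_vec \<iota> (v + w) = map_vec \<iota> v + map_vec \<iota> w"
  by (intro eq_vecI) (auto simp: pi_lift_add)

lemma red_vec_add: "dim_vec v = dim_vec w \<Longrightarrow> map_vec red (v + w) = map_vec red v + map_vec red w"
  by (intro eq_vecI) (auto simp: hom_add)

lemma pi_lift_vec_smult: "map_vec \<iota> (red c \<cdot>\<^sub>v v) = c \<cdot>\<^sub>v map_vec \<iota> v"
  by (intro eq_vecI) (auto simp: pi_lift_mult)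

lemma pi_lift_mat_vec:
  assumes "dim_vec v = dim_col B"
  shows "map_vec \<iota> (map_mat red B *\<^sub>v v) = B *\<^sub>v map_vec \<iota> v"
  using assms by (intro eq_vecI) (auto simp: scalar_prod_def pi_lift_sum pi_lift_mult)

lemma pi_lift_mat_mult_vec:
  assumes "dim_vec y = dim_col \<Phi>"
  shows "map_mat \<iota> \<Phi> *\<^sub>v y = map_vec \<iota> (\<Phi> *\<^sub>v map_vec red y)"
proof -
  have "\<iota> (a * red b) = \<iota> a * b" for a b using pi_lift_mult[of b a] by (simp add: mult.commute)
  then show ?thesis using assms by (intro eq_vecI) (auto simp: scalar_prod_def pi_lift_sum)
qed

text \<open>Adding \<open>\<pi> \<Phi>\<close> to \<open>A0\<close> changes the action by \<open>\<pi> \<Phi> y\<close>, which depends only on the reduction of \<open>y\<close>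
  and vanishes on the multiples of \<open>\<pi>\<close>.\<close>

lemma deformed_action:
  assumes A0: "A0 \<in> carrier_mat n n" and \<Phi>: "\<Phi> \<in> carrier_mat n n"
    and y: "y \<in> carrier_vec n" and u: "u \<in> carrier_vec n"
  shows "(A0 + map_mat \<iota> \<Phi>) *\<^sub>v (y + map_vec \<iota> u) =
    A0 *\<^sub>v y + map_vec \<iota> (map_mat red A0 *\<^sub>v u + \<Phi> *\<^sub>v map_vec red y)"
proof -
  let ?u = "map_vec \<iota> u" and ?\<Phi> = "map_mat \<iota> \<Phi>"
  have u': "?u \<in> carrier_vec n" and \<Phi>': "?\<Phi> \<in> carrier_mat n n" using u \<Phi> by auto
  have red0: "map_vec red (y + ?u) = map_vec red y"
    using y u by (intro eq_vecI) (auto simp: hom_add)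
  have c: "map_mat red A0 *\<^sub>v u \<in> carrier_vec n" "\<Phi> *\<^sub>v map_vec red y \<in> carrier_vec n"
    "A0 *\<^sub>v y \<in> carrier_vec n"
    using A0 \<Phi> u y by (auto intro!: mult_mat_vec_carrier[of _ n n])
  have "(A0 + ?\<Phi>) *\<^sub>v (y + ?u) = A0 *\<^sub>v (y + ?u) + ?\<Phi> *\<^sub>v (y + ?u)"
    using A0 \<Phi>' y u' by (intro add_mult_distrib_mat_vec) auto
  also have "A0 *\<^sub>v (y + ?u) = A0 *\<^sub>v y + map_vec \<iota> (map_mat red A0 *\<^sub>v u)"
    using A0 y u u' by (simp add: mult_add_distrib_mat_vec[OF A0] pi_lift_mat_vec)
  also have "?\<Phi> *\<^sub>v (y + ?u) = map_vec \<iota> (\<Phi> *\<^sub>v map_vec red y)"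
    using y u' \<Phi> red0 by (subst pi_lift_mat_mult_vec) auto
  finally have "(A0 + ?\<Phi>) *\<^sub>v (y + ?u) =
      A0 *\<^sub>v y + (map_vec \<iota> (map_mat red A0 *\<^sub>v u) + map_vec \<iota> (\<Phi> *\<^sub>v map_vec red y))"
    using c by (simp add: assoc_add_vec[of _ n])
  then show ?thesis
    using pi_lift_vec_add[of "map_mat red A0 *\<^sub>v u" "\<Phi> *\<^sub>v map_vec red y"] A0 \<Phi> by simp
qed

lemma red_map_poly_hom: "comm_ring_hom (map_poly red)"
proof
  fix f g :: "'r poly"
  show "map_poly red (f + g) = map_poly red f + map_poly red g"
    by (rule poly_eqI) (simp add: coeff_map_poly hom_add)
  show "map_poly red (f * g) = map_poly red f * map_poly red g"
    by (rule poly_eqI) (simp add: coeff_map_poly coeff_mult hom_sum hom_mult)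
qed simp_all

lemma red_companion_sum:
  assumes "lead_coeff f = 1"
  shows "map_mat red (companion_sum f ls) = companion_sum (map_poly red f) ls"
proof -
  interpret h: comm_ring_hom "map_poly red" by (rule red_map_poly_hom)
  have "map_mat red (companion (f ^ m)) = companion (map_poly red f ^ m)" for m
  proof -
    have m: "lead_coeff (f ^ m) = 1" using monic_power_ring[OF assms] by blast
    have "coeff (map_poly red (f ^ m)) (degree (f ^ m)) = 1" using m by (simp add: coeff_map_poly)
    then have "degree (map_poly red (f ^ m)) = degree (f ^ m)"
      using degree_le[of "degree (f ^ m)" "map_poly red (f ^ m)"] le_degree[of "map_poly red (f ^ m)" "degree (f ^ m)"]
      by (simp add: coeff_map_poly coeff_eq_0)
    then show ?thesis unfolding companion_def h.hom_power[symmetric]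
      by (intro eq_matI) (auto simp: coeff_map_poly hom_uminus)
  qed
  then show ?thesis unfolding companion_sum_def by (simp add: map_mat_diag_block_mat comp_def)
qed

lemma lift_extension_is_extension:
  assumes B: "B \<in> carrier_mat n n" and A: "map_mat red B = A"
  shows "is_extension class_ring (restrict_scalars (map_poly red) (matrix_module n A))
    (restrict_scalars (map_poly red) (matrix_module n A)) (lift_extension \<pi> red n B)"
proof -
  let ?M = "restrict_scalars (map_poly red) (matrix_module n A)"
  have An: "A \<in> carrier_mat n n" using A B by auto
  have M: "module class_ring ?M"
    by (rule restrict_scalars_module[OF red_map_poly_hom matrix_module_is_module[OF An]])
  have E: "module class_ring (matrix_module n B)" by (rule matrix_module_is_module[OF B])
  note simps = matrix_module_const[OF An] matrix_module_const[OF B] matrix_module_t[OF An] matrix_module_t[OF B]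
  have ker: "map_vec red v = 0\<^sub>v n \<longleftrightarrow> (\<exists>u\<in>carrier_vec n. v = map_vec \<iota> u)" if v: "v \<in> carrier_vec n" for v
  proof
    assume eq: "map_vec red v = 0\<^sub>v n"
    have "\<exists>y. v $ i = \<iota> y" if "i < n" for i
      using arg_cong[OF eq, of "\<lambda>w. w $ i"] that v by (intro red_zeroD) simp
    then obtain u where "\<And>i. i < n \<Longrightarrow> v $ i = \<iota> (u i)" by metis
    then show "\<exists>u\<in>carrier_vec n. v = map_vec \<iota> u" using v by (intro bexI[of _ "vec n u"]) auto
  qed (use v in auto)
  show ?thesis
    unfolding is_extension_def lift_extension_def extension.simps
  proof (intro conjI)
    show "map_vec \<iota> \<in> LinearCombinations.module_hom class_ring ?M (matrix_module n B)"
      by (rule module_hom_polyI[OF M E])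
        (use A B An in \<open>auto simp: simps pi_lift_vec_add pi_lift_vec_smult pi_lift_mat_vec[symmetric]
          map_poly_pCons\<close>)
    show "map_vec red \<in> LinearCombinations.module_hom class_ring (matrix_module n B) ?M"
      by (rule module_hom_polyI[OF E M])
        (use A B An in \<open>auto simp: simps red_vec_add vec_hom_smult mult_mat_vec_hom[OF B] map_poly_pCons\<close>)
    show "inj_on (map_vec \<iota>) (carrier ?M)"
    proof (rule inj_onI)
      fix v w assume vw: "v \<in> carrier ?M" "w \<in> carrier ?M" "map_vec \<iota> v = map_vec \<iota> w"
      show "v = w"
      proof (rule eq_vecI)
        fix i assume "i < dim_vec w"
        then show "v $ i = w $ i" using arg_cong[OF vw(3), of "\<lambda>u. u $ i"] vw(1,2)
          by (simp add: pi_lift_inj)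
      qed (use vw in simp)
    qed
    show "map_vec red ` carrier (matrix_module n B) = carrier ?M"
    proof -
      have "\<exists>v\<in>carrier_vec n. w = map_vec red v" if "w \<in> carrier_vec n" for w
      proof -
        have "\<forall>i. \<exists>y. w $ i = red y" using red_preimage by metis
        then obtain y where "\<And>i. w $ i = red (y i)" by metis
        then show ?thesis using that by (intro bexI[of _ "vec n y"]) auto
      qed
      then show ?thesis by auto
    qed
    show "map_vec \<iota> ` carrier ?M = {x \<in> carrier (matrix_module n B). map_vec red x = \<zero>\<^bsub>?M\<^esub>}"
      using ker by auto
  qed (fact E)
qed

text \<open>A basis lifting the standard basis is the same as an invertible matrix \<open>P\<close>, with the basis
  vectors as columns, that reduces to the identity; the matrix of \<open>t\<close> in this basis is
  \<open>P\<^sup>-\<^sup>1 B0 P\<close>.\<close>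

lemma t_matrices_of_lift:
  assumes B0: "B0 \<in> carrier_mat n n"
  shows "is_t_matrix n (lift_extension \<pi> red n B0) B \<longleftrightarrow> B \<in> congruence_conjugates red n B0"
proof -
  let ?E = "matrix_module n B0"
  have sums: "(\<Oplus>\<^bsub>?E\<^esub>j\<in>{..<n}. [:c j:] \<odot>\<^bsub>?E\<^esub> b j) = mat_of_cols n (map b [0..<n]) *\<^sub>v vec n c"
    if b: "\<And>j. j < n \<Longrightarrow> b j \<in> carrier_vec n" for b c
  proof (rule eq_vecI)
    have cl: "[:c j:] \<odot>\<^bsub>?E\<^esub> b j \<in> carrier_vec n" if "j \<in> {..<n}" for j
      using b that B0 by simp
    note fs = matrix_module_finsum[OF B0 finite_lessThan, of n "\<lambda>j. [:c j:] \<odot>\<^bsub>?E\<^esub> b j", OF cl]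
    show "dim_vec (\<Oplus>\<^bsub>?E\<^esub>j\<in>{..<n}. [:c j:] \<odot>\<^bsub>?E\<^esub> b j) = dim_vec (mat_of_cols n (map b [0..<n]) *\<^sub>v vec n c)"
      using fs(1) by simp
    fix i assume "i < dim_vec (mat_of_cols n (map b [0..<n]) *\<^sub>v vec n c)"
    then have i: "i < n" by simp
    have "(\<Oplus>\<^bsub>?E\<^esub>j\<in>{..<n}. [:c j:] \<odot>\<^bsub>?E\<^esub> b j) $ i = (\<Sum>j<n. ([:c j:] \<odot>\<^bsub>?E\<^esub> b j) $ i)"
      by (rule fs(2)[OF _ i])
    also have "\<dots> = (\<Sum>j<n. b j $ i * c j)"
      using b i by (intro sum.cong) (auto simp: matrix_module_const[OF B0] mult.commute carrier_vecD[OF b])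
    finally show "(\<Oplus>\<^bsub>?E\<^esub>j\<in>{..<n}. [:c j:] \<odot>\<^bsub>?E\<^esub> b j) $ i = (mat_of_cols n (map b [0..<n]) *\<^sub>v vec n c) $ i"
      using i by (simp add: scalar_prod_def mat_of_cols_index lessThan_atLeast0)
  qed
  show ?thesis
  proof
    assume "is_t_matrix n (lift_extension \<pi> red n B0) B"
    then obtain b where B: "B \<in> carrier_mat n n"
      and b: "\<And>j. j < n \<Longrightarrow> b j \<in> carrier_vec n" "\<And>j. j < n \<Longrightarrow> map_vec red (b j) = unit_vec n j"
      and bij: "bij_betw (\<lambda>c. \<Oplus>\<^bsub>?E\<^esub>j\<in>{..<n}. [:c $ j:] \<odot>\<^bsub>?E\<^esub> b j) (carrier_vec n) (carrier_vec n)"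
      and t: "\<And>j. j < n \<Longrightarrow> [:0, 1:] \<odot>\<^bsub>?E\<^esub> b j = (\<Oplus>\<^bsub>?E\<^esub>i\<in>{..<n}. [:B $$ (i, j):] \<odot>\<^bsub>?E\<^esub> b i)"
      unfolding is_t_matrix_def lift_extension_def by auto
    define P where "P = mat_of_cols n (map b [0..<n])"
    have P: "P \<in> carrier_mat n n" unfolding P_def using mat_of_cols_carrier(1)[of n "map b [0..<n]"] by simp
    have col_P: "col P j = b j" if "j < n" for j
      unfolding P_def using that b(1) by (subst col_mat_of_cols) auto
    have bij_P: "bij_betw (\<lambda>c. P *\<^sub>v c) (carrier_vec n) (carrier_vec n)"
    proof (rule bij_betw_cong[THEN iffD1, OF _ bij])
      fix c :: "'r vec" assume "c \<in> carrier_vec n"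
      then have "vec n (\<lambda>j. c $ j) = c" by auto
      then show "(\<Oplus>\<^bsub>?E\<^esub>j\<in>{..<n}. [:c $ j:] \<odot>\<^bsub>?E\<^esub> b j) = P *\<^sub>v c"
        using sums[of b "\<lambda>j. c $ j", OF b(1)] unfolding P_def by simp
    qed
    have "\<exists>q. q \<in> carrier_vec n \<and> P *\<^sub>v q = unit_vec n j" for j
      using bij_P unfolding bij_betw_def by (metis imageE unit_vec_carrier)
    then obtain q where q: "\<And>j. q j \<in> carrier_vec n" "\<And>j. P *\<^sub>v q j = unit_vec n j" by metis
    define Q where "Q = mat_of_cols n (map q [0..<n])"
    have Q: "Q \<in> carrier_mat n n" unfolding Q_def using mat_of_cols_carrier(1)[of n "map q [0..<n]"] by simp
    have col_Q: "col Q j = q j" if "j < n" for j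
      unfolding Q_def using that q(1) by (subst col_mat_of_cols) auto
    have PQ: "P * Q = 1\<^sub>m n"
    proof (rule mat_col_eqI)
      fix j assume "j < dim_col (1\<^sub>m n :: 'r mat)"
      then have j: "j < n" by simp
      show "col (P * Q) j = col (1\<^sub>m n) j"
        using col_mult2[OF P Q j] col_Q[OF j] q(2)[of j] col_one[OF j] by metis
    qed (use P Q in auto)
    have QP: "Q * P = 1\<^sub>m n"
    proof (rule mat_col_eqI)
      fix j assume j: "j < dim_col (1\<^sub>m n :: 'r mat)"
      have c: "col P j \<in> carrier_vec n" "Q *\<^sub>v col P j \<in> carrier_vec n" "unit_vec n j \<in> carrier_vec n"
        using P Q j by auto
      have "P *\<^sub>v (Q *\<^sub>v col P j) = (P * Q) *\<^sub>v col P j" using P Q c by (intro assoc_mult_mat_vec[symmetric])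
      also have "\<dots> = P *\<^sub>v unit_vec n j" using PQ c P j by (auto intro!: eq_vecI)
      finally have "Q *\<^sub>v col P j = unit_vec n j"
        using bij_P c unfolding bij_betw_def inj_on_def by blast
      then show "col (Q * P) j = col (1\<^sub>m n) j" using col_mult2[OF Q P, of j] j by simp
    qed (use P Q in auto)
    have "B0 * P = P * B"
    proof (rule mat_col_eqI)
      fix j assume "j < dim_col (P * B)"
      then have j: "j < n" using B by simp
      have "vec n (\<lambda>i. B $$ (i, j)) = col B j" using B j by (intro eq_vecI) auto
      then have "P *\<^sub>v col B j = B0 *\<^sub>v b j"
        using t[OF j] sums[of b "\<lambda>i. B $$ (i, j)", OF b(1)] matrix_module_t[OF B0 b(1)[OF j]] unfolding P_def by simp
      then show "col (B0 * P) j = col (P * B) j"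
        using col_mult2[OF P B j] col_mult2[OF B0 P j] col_P[OF j] by simp
    qed (use P B B0 in auto)
    then have "Q * (B0 * P) = B" using assoc_mult_mat[OF Q P B] QP B by simp
    then have BQP: "B = Q * B0 * P" using assoc_mult_mat[OF Q B0 P] by simp
    have redP: "map_mat red P = 1\<^sub>m n"
    proof (rule mat_col_eqI)
      fix j assume "j < dim_col (1\<^sub>m n :: 'k mat)"
      then have j: "j < n" by simp
      have "col (map_mat red P) j = map_vec red (col P j)" using P j by (intro eq_vecI) auto
      then show "col (map_mat red P) j = col (1\<^sub>m n) j" using j col_P b(2) by simp
    qed (use P in auto)
    have "map_mat red (Q * P) = map_mat red Q" using redP mat_hom_mult[OF Q P] Q by simp
    then have "map_mat red Q = 1\<^sub>m n" using QP by (simp add: mat_hom_one)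
    moreover have "similar_mat_wit B B0 Q P"
      by (rule similar_mat_witI[of _ _ n]) (use PQ QP BQP B B0 P Q in auto)
    ultimately show "B \<in> congruence_conjugates red n B0" unfolding congruence_conjugates_def by blast
  next
    assume "B \<in> congruence_conjugates red n B0"
    then obtain Q P where w: "similar_mat_wit B B0 Q P" and redQ: "map_mat red Q = 1\<^sub>m n"
      unfolding congruence_conjugates_def by blast
    note D = similar_mat_witD[OF refl w]
    have "dim_row B = n" using D(5) B0 by auto
    note D = D[unfolded this]
    note Q = D(6) and P = D(7)
    define b where "b j = col P j" for j
    have b: "b j \<in> carrier_vec n" if "j < n" for j using P that unfolding b_def by auto
    have P_cols: "mat_of_cols n (map b [0..<n]) = P"
      by (rule mat_col_eqI) (use P b in \<open>auto simp: b_def\<close>)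
    have "map_mat red (Q * P) = map_mat red P" using redQ mat_hom_mult[OF Q P] P by simp
    then have redP: "map_mat red P = 1\<^sub>m n" using D(1) by (simp add: mat_hom_one)
    have "map_vec red (b j) = unit_vec n j" if "j < n" for j
    proof -
      have "map_vec red (b j) = col (map_mat red P) j" unfolding b_def using P that by (intro eq_vecI) auto
      then show ?thesis using redP that by simp
    qed
    moreover have "bij_betw (\<lambda>c. \<Oplus>\<^bsub>?E\<^esub>j\<in>{..<n}. [:c $ j:] \<odot>\<^bsub>?E\<^esub> b j) (carrier_vec n) (carrier_vec n)"
    proof (rule bij_betw_cong[THEN iffD1])
      show "bij_betw (\<lambda>c. P *\<^sub>v c) (carrier_vec n) (carrier_vec n)"
      proof (rule bij_betw_byWitness[where f' = "\<lambda>c. Q *\<^sub>v c"])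
        show "\<forall>c\<in>carrier_vec n. Q *\<^sub>v (P *\<^sub>v c) = c" "\<forall>c\<in>carrier_vec n. P *\<^sub>v (Q *\<^sub>v c) = c"
          using P Q D(1,2) assoc_mult_mat_vec[OF Q P] assoc_mult_mat_vec[OF P Q] by (metis one_mult_mat_vec)+
      qed (use P Q in auto)
      fix c :: "'r vec" assume "c \<in> carrier_vec n"
      then have "vec n (\<lambda>j. c $ j) = c" by auto
      then show "P *\<^sub>v c = (\<Oplus>\<^bsub>?E\<^esub>j\<in>{..<n}. [:c $ j:] \<odot>\<^bsub>?E\<^esub> b j)"
        using sums[of b "\<lambda>j. c $ j", OF b] unfolding P_cols by simp
    qed
    moreover have "[:0, 1:] \<odot>\<^bsub>?E\<^esub> b j = (\<Oplus>\<^bsub>?E\<^esub>i\<in>{..<n}. [:B $$ (i, j):] \<odot>\<^bsub>?E\<^esub> b i)" if j: "j < n" for j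
    proof -
      have "P * B = P * (Q * (B0 * P))" using D(3) assoc_mult_mat[OF Q B0 P] by simp
      also have "\<dots> = B0 * P"
        using assoc_mult_mat[OF P Q, of "B0 * P" n] D(2) P B0 by (simp add: left_mult_one_mat)
      finally have "P * B = B0 * P" .
      then have "P *\<^sub>v col B j = B0 *\<^sub>v b j" using P D(4) B0 j by (metis b_def carrier_matD(2) col_mult2)
      moreover have "vec n (\<lambda>i. B $$ (i, j)) = col B j" using D(4) j by (intro eq_vecI) auto
      ultimately show ?thesis
        using sums[of b "\<lambda>i. B $$ (i, j)", OF b] matrix_module_t[OF B0 b[OF j]] unfolding P_cols by simp
    qed
    ultimately show "is_t_matrix n (lift_extension \<pi> red n B0) B"
      unfolding is_t_matrix_def lift_extension_def using b D(4) by auto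
  qed
qed

end

section \<open>Block indices and block diagonal matrices\<close>

abbreviation offset :: "nat list \<Rightarrow> nat \<Rightarrow> nat" where
  "offset ss j \<equiv> sum_list (take j ss)"

lemma block_pos_offset:
  "j < length ss \<Longrightarrow> a < ss ! j \<Longrightarrow> block_pos ss (offset ss j + a) = (j, a)"
proof (induction ss arbitrary: j)
  case (Cons s ss)
  then show ?case by (cases j) auto
qed simp

lemma offset_bound:
  "j < length ss \<Longrightarrow> a < ss ! j \<Longrightarrow> offset ss j + a < sum_list ss"
proof (induction ss arbitrary: j)
  case (Cons s ss)
  then show ?case by (cases j) force+
qed simp

lemma offset_inject:
  assumes "i < length ss" "a < ss ! i" "j < length ss" "b < ss ! j"
  shows "offset ss i + a = offset ss j + b \<longleftrightarrow> i = j \<and> a = b"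
  by (metis block_pos_offset[OF assms(1,2)] block_pos_offset[OF assms(3,4)] prod.inject)

lemma offset_cases:
  assumes "r < sum_list ss"
  obtains j a where "j < length ss" "a < ss ! j" "r = offset ss j + a"
proof -
  have "\<exists>j a. j < length ss \<and> a < ss ! j \<and> r = offset ss j + a"
    using assms
  proof (induction ss arbitrary: r)
    case (Cons s ss)
    show ?case
    proof (cases "r < s")
      case True
      then show ?thesis by (intro exI[of _ 0] exI[of _ r]) simp
    next
      case False
      then have "r - s < sum_list ss" using Cons.prems by simp
      then obtain j a where "j < length ss" "a < ss ! j" "r - s = offset ss j + a"
        using Cons.IH by blast
      then show ?thesis using False by (intro exI[of _ "Suc j"] exI[of _ a]) auto
    qed
  qed simp
  then show ?thesis using that by blast
qed

lemma sum_blocks: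
  "(\<Sum>r<sum_list ss. f r) = (\<Sum>j<length ss. \<Sum>a<ss ! j. f (offset ss j + a))"
proof (induction ss arbitrary: f)
  case (Cons s ss)
  have "(\<Sum>r<s + m. f r) = (\<Sum>r<s. f r) + (\<Sum>r<m. f (s + r))" for m
    by (induction m) (simp_all add: algebra_simps)
  then show ?case
    using Cons.IH[of "\<lambda>r. f (s + r)"] by (simp add: sum.lessThan_Suc_shift add.assoc del: sum.lessThan_Suc)
qed simp

lemma diag_block_mat_index:
  assumes "\<And>B. B \<in> set Bs \<Longrightarrow> square_mat B" "ss = map dim_row Bs"
    and "i < length ss" "a < ss ! i" "j < length ss" "b < ss ! j"
  shows "diag_block_mat Bs $$ (offset ss i + a, offset ss j + b) = (if i = j then Bs ! i $$ (a, b) else 0)"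
  using assms
proof (induction Bs arbitrary: ss i j)
  case (Cons B Bs)
  let ?ss = "map dim_row Bs"
  have sq: "dim_col B = dim_row B" and sqs: "\<And>B. B \<in> set Bs \<Longrightarrow> square_mat B"
    using Cons.prems(1) by auto
  have ss: "ss = dim_row B # ?ss" using Cons.prems(2) by simp
  have dims: "dim_row (diag_block_mat Bs) = sum_list ?ss" "dim_col (diag_block_mat Bs) = sum_list ?ss"
  proof -
    show "dim_row (diag_block_mat Bs) = sum_list ?ss" by (simp add: dim_diag_block_mat)
    have "map dim_col Bs = ?ss" using sqs by auto
    then show "dim_col (diag_block_mat Bs) = sum_list ?ss" unfolding dim_diag_block_mat by (rule arg_cong)
  qed
  have bnd: "i' < length ?ss \<Longrightarrow> a' < ?ss ! i' \<Longrightarrow> offset ?ss i' + a' < sum_list ?ss" for i' a'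
    by (rule offset_bound)
  show ?case
  proof (cases i; cases j)
    fix i' j' assume "i = Suc i'" "j = Suc j'"
    then show ?thesis
      using Cons.prems(3-) Cons.IH[OF sqs refl, of i' j'] bnd[of i' a] bnd[of j' b] sq dims
      by (simp add: ss Let_def add.assoc)
  next
    fix i' assume "i = Suc i'" "j = 0"
    then show ?thesis using Cons.prems(3-) bnd[of i' a] sq dims by (simp add: ss Let_def add.assoc)
  next
    fix j' assume "i = 0" "j = Suc j'"
    then show ?thesis using Cons.prems(3-) bnd[of j' b] sq dims by (simp add: ss Let_def add.assoc)
  next
    assume "i = 0" "j = 0"
    then show ?thesis using Cons.prems(3-) sq dims by (simp add: ss Let_def)
  qed
qed simp

text \<open>The identification of \<open>k\<^sup>n\<close> with polynomials: the \<open>j\<close>-th block of a vector lists the coefficients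
  of a polynomial, which represents its component in \<open>k[t]/p ^ \<lambda>\<^sub>j\<close>.\<close>

definition coord :: "nat list \<Rightarrow> nat \<Rightarrow> 'a::comm_ring_1 vec \<Rightarrow> 'a poly" where
  "coord ss j v = (\<Sum>a<ss ! j. monom (v $ (offset ss j + a)) a)"

lemma coeff_coord: "coeff (coord ss j v) a = (if a < ss ! j then v $ (offset ss j + a) else 0)"
  by (simp add: coord_def coeff_sum)

lemma coord_add:
  assumes "v \<in> carrier_vec (sum_list ss)" "w \<in> carrier_vec (sum_list ss)" "j < length ss"
  shows "coord ss j (v + w) = coord ss j v + coord ss j w"
  using assms by (intro poly_eqI) (auto simp: coeff_coord offset_bound dest: carrier_vecD)

lemma coord_smult:
  assumes "v \<in> carrier_vec (sum_list ss)" "j < length ss"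
  shows "coord ss j (c \<cdot>\<^sub>v v) = Polynomial.smult c (coord ss j v)"
  using assms by (intro poly_eqI) (auto simp: coeff_coord offset_bound dest: carrier_vecD)

lemma coord_zero: "j < length ss \<Longrightarrow> coord ss j (0\<^sub>v (sum_list ss)) = 0"
  by (intro poly_eqI) (auto simp: coeff_coord offset_bound)

lemma degree_coord: "ss ! j > 0 \<Longrightarrow> degree (coord ss j v) < ss ! j"
  by (rule degree_lessI) (auto simp: coeff_coord)

lemma coord_eqI:
  assumes "v \<in> carrier_vec (sum_list ss)" "w \<in> carrier_vec (sum_list ss)"
    and "\<And>j. j < length ss \<Longrightarrow> coord ss j v = coord ss j w"
  shows "v = w"
proof (rule eq_vecI)
  fix r assume "r < dim_vec w"
  then have "r < sum_list ss" using assms(2) by simp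
  then obtain j a where ja: "j < length ss" "a < ss ! j" "r = offset ss j + a" by (rule offset_cases)
  then show "v $ r = w $ r"
    using arg_cong[OF assms(3)[OF ja(1)], of "\<lambda>f. coeff f a"] by (simp add: coeff_coord)
qed (use assms in simp)

section \<open>The module of a sum of companion matrices\<close>

locale primary_matrix =
  fixes p :: "'k::field poly" and ls :: "nat list" and d n :: nat and A :: "'k mat"
  assumes monic: "lead_coeff p = 1" and deg: "degree p = d" "d > 0"
    and ls_pos: "\<And>m. m \<in> set ls \<Longrightarrow> m \<ge> 1"
    and n_def: "n = d * sum_list ls" and A_def: "A = companion_sum p ls"
begin

abbreviation "ss \<equiv> block_sizes d ls"
abbreviation "l \<equiv> length ls"
abbreviation "M \<equiv> matrix_module n A"
abbreviation "e \<equiv> gen d ls :: nat \<Rightarrow> 'k vec"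

lemma ss_nth: "j < l \<Longrightarrow> ss ! j = d * ls ! j"
  by (simp add: block_sizes_def)

lemma ss_pos: "j < l \<Longrightarrow> ss ! j > 0"
  using deg(2) ls_pos[OF nth_mem, of j] by (simp add: ss_nth)

lemma length_ss: "length ss = l"
  by (simp add: block_sizes_def)

lemma sum_ss: "sum_list ss = n"
  by (simp add: block_sizes_def n_def sum_list_const_mult)

lemma degree_power_p: "degree (p ^ m) = d * m" "coeff (p ^ m) (d * m) = 1"
proof -
  have lead: "lead_coeff (p ^ m) = 1" using monic by (simp add: lead_coeff_power)
  have "p \<noteq> 0" using monic by auto
  then show deg_pm: "degree (p ^ m) = d * m" using deg(1) by (simp add: degree_power_eq)
  show "coeff (p ^ m) (d * m) = 1" using lead unfolding deg_pm .
qed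

lemma A_carrier: "A \<in> carrier_mat n n"
proof -
  have "sum_list (map dim_row (map (\<lambda>m. companion (p ^ m)) ls)) = n"
      "sum_list (map dim_col (map (\<lambda>m. companion (p ^ m)) ls)) = n"
    using sum_ss by (simp_all add: companion_def degree_power_p block_sizes_def comp_def)
  then show ?thesis unfolding A_def companion_sum_def
    by (metis carrier_matI dim_diag_block_mat)
qed

sublocale M: Module.module "class_ring :: 'k poly ring" M
  by (rule matrix_module_is_module[OF A_carrier])

lemma M_smult_closed: "v \<in> carrier_vec n \<Longrightarrow> f \<odot>\<^bsub>M\<^esub> v \<in> carrier_vec n"
  using A_carrier by simp

lemma A_index:
  assumes "i < l" "a < ss ! i" "j < l" "b < ss ! j"
  shows "A $$ (offset ss i + a, offset ss j + b) = (if i = j then companion (p ^ (ls ! i)) $$ (a, b) else 0)"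
proof -
  let ?Bs = "map (\<lambda>m. companion (p ^ m)) ls"
  have "ss = map dim_row ?Bs" by (simp add: block_sizes_def companion_def degree_power_p)
  moreover have "square_mat B" if "B \<in> set ?Bs" for B using that by (auto simp: companion_def)
  ultimately show ?thesis
    unfolding A_def companion_sum_def
    using diag_block_mat_index[of ?Bs ss i a j b] assms by (simp add: length_ss)
qed

abbreviation "top_coeff j v \<equiv> v $ (offset ss j + (ss ! j - 1))"

lemma A_mult_index:
  assumes v: "v \<in> carrier_vec n" and i: "i < l" "a < ss ! i"
  shows "(A *\<^sub>v v) $ (offset ss i + a) =
    (if a = 0 then 0 else v $ (offset ss i + (a - 1))) - coeff (p ^ (ls ! i)) a * top_coeff i v"
proof -
  let ?f = "p ^ (ls ! i)" and ?N = "ss ! i"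
  have N: "degree ?f = ?N" using i(1) by (simp add: degree_power_p ss_nth)
  have bnd: "offset ss i + a < n" using offset_bound[of i ss a] i by (simp add: length_ss sum_ss)
  have "(A *\<^sub>v v) $ (offset ss i + a) = (\<Sum>r<n. A $$ (offset ss i + a, r) * v $ r)"
    using A_carrier v bnd by (simp add: scalar_prod_def lessThan_atLeast0)
  also have "\<dots> = (\<Sum>j<l. \<Sum>b<ss ! j. A $$ (offset ss i + a, offset ss j + b) * v $ (offset ss j + b))"
    using sum_blocks[of "\<lambda>r. A $$ (offset ss i + a, r) * v $ r" ss] by (simp add: length_ss sum_ss)
  also have "\<dots> = (\<Sum>j<l. if j = i then \<Sum>b<?N. companion ?f $$ (a, b) * v $ (offset ss i + b) else 0)"
    using A_index[OF i] by (intro sum.cong) auto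
  also have "\<dots> = (\<Sum>b<?N. companion ?f $$ (a, b) * v $ (offset ss i + b))"
    using i(1) by simp
  also have "\<dots> = (\<Sum>b<?N. (if b = ?N - 1 then - coeff ?f a * top_coeff i v else 0) +
      (if a = Suc b then v $ (offset ss i + (a - 1)) else 0))"
    using i ss_pos[OF i(1)] by (intro sum.cong refl) (auto simp: companion_def N)
  also have "\<dots> = - coeff ?f a * top_coeff i v + (\<Sum>b<?N. if a = Suc b then v $ (offset ss i + (a - 1)) else 0)"
    using ss_pos[OF i(1)] by (simp add: sum.distrib)
  also have "(\<Sum>b<?N. if a = Suc b then v $ (offset ss i + (a - 1)) else 0) =
      (if a = 0 then 0 else v $ (offset ss i + (a - 1)))"
  proof (cases a)
    case (Suc a')
    then show ?thesis using i(2) by simp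
  qed simp
  finally show ?thesis by simp
qed

text \<open>The last entry of the block is the coefficient that multiplication by \<open>t\<close> moves to degree
  \<open>d \<lambda>\<^sub>i\<close>; subtracting that multiple of the monic \<open>p ^ \<lambda>\<^sub>i\<close> is the reduction step of the companion
  matrix.\<close>

lemma coord_A:
  assumes v: "v \<in> carrier_vec n" and i: "i < l"
  shows "coord ss i (A *\<^sub>v v) = [:0, 1:] * coord ss i v - Polynomial.smult (top_coeff i v) (p ^ (ls ! i))"
proof (rule poly_eqI)
  fix a
  let ?N = "ss ! i"
  note pos = ss_pos[OF i]
  have N: "degree (p ^ (ls ! i)) = ?N" "coeff (p ^ (ls ! i)) ?N = 1"
    using i by (simp_all add: degree_power_p ss_nth)
  have t: "coeff ([:0, 1:] * coord ss i v) a = (if a = 0 then 0 else coeff (coord ss i v) (a - 1))"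
    by (cases a) simp_all
  consider "a < ?N" | "a = ?N" | "a > ?N" by linarith
  then show "coeff (coord ss i (A *\<^sub>v v)) a =
      coeff ([:0, 1:] * coord ss i v - Polynomial.smult (top_coeff i v) (p ^ (ls ! i))) a"
  proof cases
    case 1
    then show ?thesis unfolding coeff_diff t using A_mult_index[OF v i 1]
      by (simp add: coeff_coord mult.commute)
  next
    case 2
    then show ?thesis unfolding coeff_diff t using N pos by (simp add: coeff_coord)
  next
    case 3
    then show ?thesis unfolding coeff_diff t using N by (auto simp: coeff_coord coeff_eq_0)
  qed
qed

lemma coord_zero_vec: "i < l \<Longrightarrow> coord ss i (0\<^sub>v n :: 'k vec) = 0"
  using coord_zero[of i ss] by (simp add: length_ss sum_ss)

lemma coord_act:
  assumes v: "v \<in> carrier_vec n" and i: "i < l"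
  shows "p ^ (ls ! i) dvd coord ss i (f \<odot>\<^bsub>M\<^esub> v) - f * coord ss i v"
proof (induction f)
  case 0
  then show ?case using v i
    by (simp add: matrix_module_zero_poly[OF A_carrier] coord_zero_vec)
next
  case (pCons c f)
  note fv = M_smult_closed[OF v, of f]
  have Afv: "A *\<^sub>v (f \<odot>\<^bsub>M\<^esub> v) \<in> carrier_vec n" using A_carrier fv by (rule mult_mat_vec_carrier)
  have step: "coord ss i (pCons c f \<odot>\<^bsub>M\<^esub> v) = Polynomial.smult c (coord ss i v) +
      ([:0, 1:] * coord ss i (f \<odot>\<^bsub>M\<^esub> v) - Polynomial.smult (top_coeff i (f \<odot>\<^bsub>M\<^esub> v)) (p ^ (ls ! i)))"
    using coord_add[of "c \<cdot>\<^sub>v v" ss "A *\<^sub>v (f \<odot>\<^bsub>M\<^esub> v)" i] coord_smult[of v ss i c] v Afv i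
    unfolding matrix_module_pCons[OF A_carrier v] coord_A[OF fv i, symmetric] by (simp add: length_ss sum_ss)
  have "coord ss i (pCons c f \<odot>\<^bsub>M\<^esub> v) - pCons c f * coord ss i v =
      [:0, 1:] * (coord ss i (f \<odot>\<^bsub>M\<^esub> v) - f * coord ss i v)
      - Polynomial.smult (top_coeff i (f \<odot>\<^bsub>M\<^esub> v)) (p ^ (ls ! i))"
    unfolding step mult_pCons_left by (simp add: right_diff_distrib)
  also have "p ^ (ls ! i) dvd \<dots>"
    by (rule dvd_diff[OF dvd_mult[OF pCons.IH]]) (simp add: dvd_smult)
  finally show ?case .
qed

lemma e_carrier [simp]: "e i \<in> carrier_vec n"
  by (simp add: gen_def n_def)

lemma coord_e:
  assumes "i < l" "j < l"
  shows "coord ss j (e i) = (if i = j then 1 else 0)"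
proof (rule poly_eqI)
  fix a
  have "e i $ (offset ss j + a) = (if i = j \<and> a = 0 then 1 else 0)" if "a < ss ! j"
    using offset_inject[of j ss a i 0] offset_bound[of j ss a] offset_bound[of i ss 0] that assms ss_pos
    by (auto simp: gen_def length_ss sum_ss n_def[symmetric])
  then show "coeff (coord ss j (e i)) a = coeff (if i = j then 1 else 0) a"
    using ss_pos assms by (auto simp: coeff_coord)
qed

text \<open>Both coordinates have degree less than \<open>d \<lambda>\<^sub>i\<close>, so they agree once they are congruent modulo
  \<open>p ^ \<lambda>\<^sub>i\<close>.\<close>

lemma coord_eq_mod:
  assumes v: "v \<in> carrier_vec n" and w: "w \<in> carrier_vec n"
    and dvd: "\<And>i. i < l \<Longrightarrow> p ^ (ls ! i) dvd coord ss i v - coord ss i w"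
  shows "v = w"
proof (rule coord_eqI[of _ ss])
  fix i assume "i < length ss"
  then have i: "i < l" by (simp add: length_ss)
  have "degree (coord ss i v - coord ss i w) < degree (p ^ (ls ! i))"
    using degree_diff_less[of "coord ss i v" "ss ! i" "coord ss i w",
        OF degree_coord[OF ss_pos[OF i]] degree_coord[OF ss_pos[OF i]]]
    by (simp add: degree_power_p ss_nth[OF i, symmetric])
  then show "coord ss i v = coord ss i w"
    using dvd_imp_degree_le[OF dvd[OF i]] by fastforce
qed (use v w in \<open>simp_all add: sum_ss\<close>)

definition comb :: "(nat \<Rightarrow> 'k poly) \<Rightarrow> 'k vec" where
  "comb h = (\<Oplus>\<^bsub>M\<^esub>i\<in>{..<l}. h i \<odot>\<^bsub>M\<^esub> e i)"

lemma comb_carrier: "comb h \<in> carrier_vec n"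
  unfolding comb_def by (rule matrix_module_finsum(1)[OF A_carrier]) (auto intro: M_smult_closed)

lemma coord_finsum:
  assumes "finite I" "\<And>i. i \<in> I \<Longrightarrow> g i \<in> carrier_vec n" "j < l"
  shows "coord ss j (\<Oplus>\<^bsub>M\<^esub>i\<in>I. g i) = (\<Sum>i\<in>I. coord ss j (g i))"
  using matrix_module_finsum(2)[OF A_carrier assms(1,2)] offset_bound[of j ss] assms(3)
  by (intro poly_eqI) (auto simp: coeff_coord coeff_sum length_ss sum_ss)

lemma coord_comb:
  assumes j: "j < l"
  shows "p ^ (ls ! j) dvd coord ss j (comb h) - h j"
proof -
  have "coord ss j (comb h) = (\<Sum>i<l. coord ss j (h i \<odot>\<^bsub>M\<^esub> e i))"
    unfolding comb_def by (rule coord_finsum) (use j in \<open>auto intro: M_smult_closed\<close>)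
  moreover have "h j = (\<Sum>i<l. h i * coord ss j (e i))"
    using j by (simp add: coord_e if_distrib cong: if_cong)
  ultimately have "coord ss j (comb h) - h j = (\<Sum>i<l. coord ss j (h i \<odot>\<^bsub>M\<^esub> e i) - h i * coord ss j (e i))"
    by (simp add: sum_subtractf)
  also have "p ^ (ls ! j) dvd \<dots>" using j by (intro dvd_sum coord_act) auto
  finally show ?thesis .
qed

lemma comb_coord:
  assumes "v \<in> carrier_vec n"
  shows "comb (\<lambda>j. coord ss j v) = v"
  by (rule coord_eq_mod[OF comb_carrier assms]) (rule coord_comb)

lemma coord_comb_eq:
  assumes j: "j < l" and "degree (h j) < ss ! j"
  shows "coord ss j (comb h) = h j"
proof -
  have "degree (coord ss j (comb h) - h j) < degree (p ^ (ls ! j))"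
    using degree_diff_less[of "coord ss j (comb h)" "ss ! j" "h j", OF degree_coord[OF ss_pos[OF j]] assms(2)]
    by (simp add: degree_power_p ss_nth[OF j, symmetric])
  then show ?thesis using dvd_imp_degree_le[OF coord_comb[OF j, of h]] by fastforce
qed

lemma p_power_e: "j < l \<Longrightarrow> p ^ (ls ! j) \<odot>\<^bsub>M\<^esub> e j = 0\<^sub>v n"
proof (rule coord_eq_mod)
  fix i assume j: "j < l" and i: "i < l"
  have "p ^ (ls ! i) dvd p ^ (ls ! j) * coord ss i (e j)" using i j by (simp add: coord_e)
  from dvd_add[OF coord_act[OF e_carrier i, of "p ^ (ls ! j)" j] this]
  show "p ^ (ls ! i) dvd coord ss i (p ^ (ls ! j) \<odot>\<^bsub>M\<^esub> e j) - coord ss i (0\<^sub>v n)"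
    using i by (simp add: coord_zero_vec)
qed (simp_all add: M_smult_closed)

lemma phi_mat_carrier: "phi_mat ss \<epsilon> \<in> carrier_mat n n"
  by (simp add: phi_mat_def block_mat_def sum_ss)

text \<open>Every block of \<open>\<phi>(\<epsilon>)\<close> has a single nonzero column, the last one, so only the last entries of the
  blocks of \<open>v\<close> contribute.\<close>

lemma coord_phi_mat:
  fixes \<epsilon> :: "nat \<Rightarrow> nat \<Rightarrow> 'k poly"
  assumes v: "v \<in> carrier_vec n" and i: "i < l" and deg: "\<And>j. j < l \<Longrightarrow> degree (\<epsilon> i j) < ss ! i"
  shows "coord ss i (phi_mat ss \<epsilon> *\<^sub>v v) = (\<Sum>j<l. Polynomial.smult (top_coeff j v) (\<epsilon> i j))"
proof (rule poly_eqI)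
  fix a
  let ?F = "phi_mat ss \<epsilon>"
  show "coeff (coord ss i (?F *\<^sub>v v)) a = coeff (\<Sum>j<l. Polynomial.smult (top_coeff j v) (\<epsilon> i j)) a"
  proof (cases "a < ss ! i")
    case False
    have "coeff (\<epsilon> i j) a = 0" if "j < l" for j
      using deg[OF that] False by (intro coeff_eq_0) simp
    then show ?thesis using False by (simp add: coeff_coord coeff_sum)
  next
    case a: True
    have bnd: "offset ss j + b < n" if "j < l" "b < ss ! j" for j b
      using offset_bound[of j ss b] that by (simp add: length_ss sum_ss)
    have idx: "?F $$ (offset ss i + a, offset ss j + b) = (if b = ss ! j - 1 then coeff (\<epsilon> i j) a else 0)"
      if "j < l" "b < ss ! j" for j b
      using bnd[OF i a] bnd[OF that] block_pos_offset[of i ss a] block_pos_offset[of j ss b] i a that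
      by (auto simp: phi_mat_def block_mat_def length_ss sum_ss)
    have "coeff (coord ss i (?F *\<^sub>v v)) a = (\<Sum>r<n. ?F $$ (offset ss i + a, r) * v $ r)"
      using a v phi_mat_carrier[of \<epsilon>] bnd[OF i a] by (simp add: coeff_coord scalar_prod_def lessThan_atLeast0)
    also have "\<dots> = (\<Sum>j<l. \<Sum>b<ss ! j. ?F $$ (offset ss i + a, offset ss j + b) * v $ (offset ss j + b))"
      using sum_blocks[of "\<lambda>r. ?F $$ (offset ss i + a, r) * v $ r" ss] by (simp add: length_ss sum_ss)
    also have "\<dots> = (\<Sum>j<l. \<Sum>b<ss ! j. if b = ss ! j - 1 then coeff (\<epsilon> i j) a * top_coeff j v else 0)"
      using idx by (intro sum.cong) auto
    also have "\<dots> = (\<Sum>j<l. coeff (\<epsilon> i j) a * top_coeff j v)"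
      using ss_pos by (intro sum.cong) auto
    finally show ?thesis by (simp add: coeff_sum mult.commute)
  qed
qed

section \<open>Normal form of an extension\<close>

lemma inj_map_comb:
  assumes X: "is_extension class_ring M' M X"
  shows "inj_map X (comb h) = (\<Oplus>\<^bsub>mid X\<^esub>i\<in>{..<l}. h i \<odot>\<^bsub>mid X\<^esub> inj_map X (e i))"
proof -
  note D = is_extensionD[OF X] and I = module_homD[OF is_extensionD(2)[OF X]]
  interpret X: Module.module class_ring "mid X" by (rule D(1))
  have "inj_map X (comb h) = (\<Oplus>\<^bsub>mid X\<^esub>i\<in>{..<l}. inj_map X (h i \<odot>\<^bsub>M\<^esub> e i))"
    unfolding comb_def by (rule module_hom_finsum[OF M.module_axioms D(1,2)]) (simp add: M_smult_closed)
  also have "\<dots> = (\<Oplus>\<^bsub>mid X\<^esub>i\<in>{..<l}. h i \<odot>\<^bsub>mid X\<^esub> inj_map X (e i))"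
    using I X.smult_closed by (intro X.finsum_cong') auto
  finally show ?thesis .
qed

text \<open>The entries of \<open>E(\<xi>)\<close> do not depend on the choices modulo \<open>p ^ min \<lambda>\<^sub>i \<lambda>\<^sub>j\<close>: two lifts of \<open>e\<^sub>j\<close> differ
  by some \<open>u\<close> in \<open>M\<close>, which changes the relation by \<open>p ^ \<lambda>\<^sub>j u\<close>, and the \<open>i\<close>-th component is
  determined modulo \<open>p ^ \<lambda>\<^sub>i\<close>.\<close>

lemma ext_matrix_well_defined:
  assumes X: "is_extension class_ring M M X" and Y: "is_extension class_ring M M Y"
    and YX: "ext_equiv class_ring M Y X" and ij: "i < l" "j < l"
    and f: "f \<in> carrier (mid X)" "proj_map X f = e j"
    and w: "w \<in> carrier_vec n" "p ^ (ls ! j) \<odot>\<^bsub>mid X\<^esub> f = inj_map X w"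
    and g: "g \<in> carrier (mid Y)" "proj_map Y g = e j" "p ^ (ls ! j) \<odot>\<^bsub>mid Y\<^esub> g = inj_map Y (comb h)"
  shows "p ^ min (ls ! i) (ls ! j) dvd coord ss i w - h i"
proof -
  let ?q = "p ^ (ls ! j)"
  note D = is_extensionD[OF X] and I = module_homD[OF is_extensionD(2)[OF X]]
  interpret X: Module.module class_ring "mid X" by (rule D(1))
  obtain \<phi> where \<phi>: "\<phi> \<in> LinearCombinations.module_hom class_ring (mid Y) (mid X)"
      "\<And>a. a \<in> carrier M \<Longrightarrow> \<phi> (inj_map Y a) = inj_map X a"
      "\<And>y. y \<in> carrier (mid Y) \<Longrightarrow> proj_map X (\<phi> y) = proj_map Y y"
    using YX unfolding ext_equiv_def by blast
  note F = module_homD[OF \<phi>(1)]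
  obtain u where u: "u \<in> carrier_vec n" "\<phi> g = inj_map X u \<oplus>\<^bsub>mid X\<^esub> f"
    using extension_same_proj[OF M.module_axioms X F(1)[OF g(1)] f(1)] \<phi>(3)[OF g(1)] f(2) g(2) by auto
  note qu = M_smult_closed[OF u(1), of ?q]
  have "inj_map X (comb h) = ?q \<odot>\<^bsub>mid X\<^esub> \<phi> g"
    using F(3)[of ?q g] g(1,3) \<phi>(2)[of "comb h"] comb_carrier by simp
  also have "\<dots> = inj_map X (?q \<odot>\<^bsub>M\<^esub> u) \<oplus>\<^bsub>mid X\<^esub> inj_map X w"
    using X.smult_r_distr[of ?q "inj_map X u" f] D(8)[of u] I(3)[of ?q u] u f w by simp
  also have "\<dots> = inj_map X (?q \<odot>\<^bsub>M\<^esub> u + w)"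
    using I(2)[of "?q \<odot>\<^bsub>M\<^esub> u" w] qu w by simp
  finally have "comb h = ?q \<odot>\<^bsub>M\<^esub> u + w"
    using inj_onD[OF D(4), of "comb h" "?q \<odot>\<^bsub>M\<^esub> u + w"] comb_carrier qu w by simp
  then have "coord ss i (comb h) = coord ss i (?q \<odot>\<^bsub>M\<^esub> u) + coord ss i w"
    using coord_add[of "?q \<odot>\<^bsub>M\<^esub> u" ss w i] qu w ij(1) by (simp add: sum_ss length_ss)
  then have "coord ss i w - h i = (coord ss i (comb h) - h i)
      - (coord ss i (?q \<odot>\<^bsub>M\<^esub> u) - ?q * coord ss i u) - ?q * coord ss i u"
    by simp
  also have "p ^ min (ls ! i) (ls ! j) dvd \<dots>"
  proof (rule dvd_diff[OF dvd_diff])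
    have m: "p ^ min (ls ! i) (ls ! j) dvd p ^ (ls ! i)" by (rule le_imp_power_dvd) simp
    show "p ^ min (ls ! i) (ls ! j) dvd coord ss i (comb h) - h i"
      by (rule dvd_trans[OF m coord_comb[OF ij(1)]])
    show "p ^ min (ls ! i) (ls ! j) dvd coord ss i (?q \<odot>\<^bsub>M\<^esub> u) - ?q * coord ss i u"
      by (rule dvd_trans[OF m coord_act[OF u(1) ij(1)]])
    show "p ^ min (ls ! i) (ls ! j) dvd ?q * coord ss i u"
      by (intro dvd_mult2 le_imp_power_dvd) simp
  qed
  finally show ?thesis .
qed

text \<open>Each entry \<open>\<epsilon> i j\<close> may come from its own extension in the class and its own choice of lifts. By
  well-definedness, all of them are congruent modulo \<open>p ^ min \<lambda>\<^sub>i \<lambda>\<^sub>j\<close> to the entries obtained from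
  one fixed extension with one fixed lift of \<open>e\<^sub>j\<close>. Adding \<open>\<Sum>\<^sub>i g\<^sub>i e\<^sub>i\<close> to this lift changes the
  \<open>i\<close>-th entry by \<open>p ^ \<lambda>\<^sub>j g\<^sub>i\<close>, and modulo \<open>p ^ \<lambda>\<^sub>i\<close> every multiple of \<open>p ^ min \<lambda>\<^sub>i \<lambda>\<^sub>j\<close> is of this
  form; so one choice of lifts realises all the entries at once.\<close>

lemma adapted_lifts:
  assumes X: "is_extension class_ring M M X"
    and \<xi>: "\<And>Y. Y \<in> \<xi> \<Longrightarrow> is_extension class_ring M M Y \<and> ext_equiv class_ring M Y X"
    and \<epsilon>: "\<And>i j. i < l \<Longrightarrow> j < l \<Longrightarrow> \<epsilon> i j \<in> ext_matrix p ls \<xi> i j"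
  shows "\<exists>f. \<forall>j<l. f j \<in> carrier (mid X) \<and> proj_map X (f j) = e j \<and>
    p ^ (ls ! j) \<odot>\<^bsub>mid X\<^esub> f j = inj_map X (comb (\<lambda>i. \<epsilon> i j))"
proof -
  note D = is_extensionD[OF X]
  note I = module_homD[OF D(2)] and P = module_homD[OF D(3)]
  interpret X: Module.module class_ring "mid X" by (rule D(1))
  have "\<exists>f. f \<in> carrier (mid X) \<and> proj_map X f = e j \<and>
    p ^ (ls ! j) \<odot>\<^bsub>mid X\<^esub> f = inj_map X (comb (\<lambda>i. \<epsilon> i j))" if j: "j < l" for j
  proof -
    let ?q = "p ^ (ls ! j)"
    obtain f where f: "f \<in> carrier (mid X)" "proj_map X f = e j"
      using D(5)[of "e j"] by auto
    have "proj_map X (?q \<odot>\<^bsub>mid X\<^esub> f) = \<zero>\<^bsub>M\<^esub>"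
      using P(3)[of ?q f] f p_power_e[OF j] by simp
    then obtain w where w: "w \<in> carrier_vec n" "?q \<odot>\<^bsub>mid X\<^esub> f = inj_map X w"
      using D(6)[of "?q \<odot>\<^bsub>mid X\<^esub> f"] X.smult_closed f(1) by auto
    have "\<exists>g. p ^ (ls ! i) dvd coord ss i w + ?q * g - \<epsilon> i j" if i: "i < l" for i
    proof -
      let ?m = "min (ls ! i) (ls ! j)"
      obtain Y g \<eta> where Y: "Y \<in> \<xi>" and g: "g j \<in> carrier (mid Y)" "proj_map Y (g j) = gen (degree p) ls j"
          "?q \<odot>\<^bsub>mid Y\<^esub> g j = (\<Oplus>\<^bsub>mid Y\<^esub>i'\<in>{..<l}. \<eta> i' j \<odot>\<^bsub>mid Y\<^esub> inj_map Y (gen (degree p) ls i'))"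
          and "p ^ ?m dvd \<epsilon> i j - \<eta> i j"
        using \<epsilon>[OF i j] j unfolding ext_matrix_def by blast
      moreover have "p ^ ?m dvd coord ss i w - \<eta> i j"
        using ext_matrix_well_defined[OF X _ _ i j f w, of Y "g j" "\<lambda>i. \<eta> i j"] \<xi>[OF Y] g
          inj_map_comb[of M Y "\<lambda>i. \<eta> i j"] unfolding deg(1) by simp
      ultimately have "p ^ ?m dvd (\<epsilon> i j - \<eta> i j) - (coord ss i w - \<eta> i j)" using dvd_diff by blast
      then have diff: "p ^ ?m dvd \<epsilon> i j - coord ss i w" by simp
      show ?thesis
      proof (cases "ls ! j \<le> ls ! i")
        case True
        then obtain c where "\<epsilon> i j - coord ss i w = ?q * c" using diff by (auto simp: min_absorb2 dvd_def)
        then have "coord ss i w + ?q * c - \<epsilon> i j = 0" by (simp add: algebra_simps)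
        then show ?thesis by (intro exI[of _ c]) simp
      next
        case False
        then have "p ^ (ls ! i) dvd \<epsilon> i j - coord ss i w" using diff by (simp add: min_absorb1)
        then show ?thesis by (intro exI[of _ 0]) (simp add: dvd_diff_commute)
      qed
    qed
    then obtain g where g: "\<And>i. i < l \<Longrightarrow> p ^ (ls ! i) dvd coord ss i w + ?q * g i - \<epsilon> i j" by metis
    let ?v = "comb g"
    note v = comb_carrier[of g]
    note qv = M_smult_closed[OF v, of ?q]
    have eq: "?q \<odot>\<^bsub>M\<^esub> ?v + w = comb (\<lambda>i. \<epsilon> i j)"
    proof (rule coord_eq_mod)
      fix i assume i: "i < l"
      have "coord ss i (?q \<odot>\<^bsub>M\<^esub> ?v + w) - coord ss i (comb (\<lambda>i. \<epsilon> i j)) =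
          (coord ss i (?q \<odot>\<^bsub>M\<^esub> ?v) - ?q * coord ss i ?v) + ?q * (coord ss i ?v - g i)
          + (coord ss i w + ?q * g i - \<epsilon> i j) - (coord ss i (comb (\<lambda>i. \<epsilon> i j)) - \<epsilon> i j)"
        using coord_add[of "?q \<odot>\<^bsub>M\<^esub> ?v" ss w i] qv w i by (simp add: sum_ss length_ss algebra_simps)
      also have "p ^ (ls ! i) dvd \<dots>"
        by (intro dvd_diff dvd_add dvd_mult coord_comb coord_act g i v)
      finally show "p ^ (ls ! i) dvd coord ss i (?q \<odot>\<^bsub>M\<^esub> ?v + w) - coord ss i (comb (\<lambda>i. \<epsilon> i j))" .
    qed (use qv w comb_carrier in auto)
    have "inj_map X ?v \<in> carrier (mid X)" using D(8) v by simp
    moreover have "proj_map X (inj_map X ?v \<oplus>\<^bsub>mid X\<^esub> f) = e j"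
      using P(2)[of "inj_map X ?v" f] D(7,8)[of ?v] v f by simp
    moreover have "?q \<odot>\<^bsub>mid X\<^esub> (inj_map X ?v \<oplus>\<^bsub>mid X\<^esub> f) = inj_map X (comb (\<lambda>i. \<epsilon> i j))"
      using X.smult_r_distr[of ?q "inj_map X ?v" f] D(8)[of ?v] I(3)[of ?q ?v] I(2)[of "?q \<odot>\<^bsub>M\<^esub> ?v" w]
        v f w qv eq by simp
    ultimately show ?thesis using f(1) by (intro exI[of _ "inj_map X ?v \<oplus>\<^bsub>mid X\<^esub> f"]) simp
  qed
  then show ?thesis by metis
qed

text \<open>The normal form of the extension. In terms of the section \<open>s v = \<Sum>\<^sub>j (coord j v) f\<^sub>j\<close>, which is
  linear over the constants, \<open>r x\<close> is the element of \<open>M\<close> with \<open>x = r x + s (x mod M)\<close>.\<close>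

lemma retraction:
  fixes \<epsilon> :: "nat \<Rightarrow> nat \<Rightarrow> 'k poly"
  assumes X: "is_extension class_ring M M X"
    and f: "\<And>j. j < l \<Longrightarrow> f j \<in> carrier (mid X)" "\<And>j. j < l \<Longrightarrow> proj_map X (f j) = e j"
      "\<And>j. j < l \<Longrightarrow> p ^ (ls ! j) \<odot>\<^bsub>mid X\<^esub> f j = inj_map X (comb (\<lambda>i. \<epsilon> i j))"
    and deg: "\<And>i j. i < l \<Longrightarrow> j < l \<Longrightarrow> degree (\<epsilon> i j) < ss ! i"
  obtains r where "\<And>x. x \<in> carrier (mid X) \<Longrightarrow> r x \<in> carrier_vec n"
    and "\<And>x y. x \<in> carrier (mid X) \<Longrightarrow> y \<in> carrier (mid X) \<Longrightarrow> r (x \<oplus>\<^bsub>mid X\<^esub> y) = r x + r y"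
    and "\<And>c x. x \<in> carrier (mid X) \<Longrightarrow> r ([:c:] \<odot>\<^bsub>mid X\<^esub> x) = c \<cdot>\<^sub>v r x"
    and "\<And>x. x \<in> carrier (mid X) \<Longrightarrow>
      r ([:0, 1:] \<odot>\<^bsub>mid X\<^esub> x) = A *\<^sub>v r x + phi_mat ss \<epsilon> *\<^sub>v proj_map X x"
    and "\<And>a. a \<in> carrier_vec n \<Longrightarrow> r (inj_map X a) = a"
proof -
  note D = is_extensionD[OF X]
  note I = module_homD[OF D(2)] and P = module_homD[OF D(3)]
  interpret X: Module.module class_ring "mid X" by (rule D(1))
  let ?\<Phi> = "phi_mat ss \<epsilon>"
  have \<Phi>v: "?\<Phi> *\<^sub>v v \<in> carrier_vec n" if "v \<in> carrier_vec n" for v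
    using phi_mat_carrier that by (rule mult_mat_vec_carrier)
  have Av: "A *\<^sub>v v \<in> carrier_vec n" if "v \<in> carrier_vec n" for v
    using A_carrier that by (rule mult_mat_vec_carrier)
  have Xs: "g \<odot>\<^bsub>mid X\<^esub> x \<in> carrier (mid X)" if "x \<in> carrier (mid X)" for g x
    using X.smult_closed that by simp
  define s where "s v = (\<Oplus>\<^bsub>mid X\<^esub>j\<in>{..<l}. coord ss j v \<odot>\<^bsub>mid X\<^esub> f j)" for v
  have s_closed: "s v \<in> carrier (mid X)" for v
    unfolding s_def using f(1) Xs by (intro X.finsum_closed) auto
  have s_add: "s (v + w) = s v \<oplus>\<^bsub>mid X\<^esub> s w" if "v \<in> carrier_vec n" "w \<in> carrier_vec n" for v w
  proof -
    have "s (v + w) = (\<Oplus>\<^bsub>mid X\<^esub>j\<in>{..<l}. coord ss j v \<odot>\<^bsub>mid X\<^esub> f j \<oplus>\<^bsub>mid X\<^esub> coord ss j w \<odot>\<^bsub>mid X\<^esub> f j)"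
      unfolding s_def using f(1) Xs that X.smult_l_distr coord_add[of v ss w]
      by (intro X.finsum_cong') (auto simp: sum_ss length_ss)
    also have "\<dots> = s v \<oplus>\<^bsub>mid X\<^esub> s w"
      unfolding s_def using f(1) Xs by (intro X.finsum_addf) auto
    finally show ?thesis .
  qed
  have s_const: "s (c \<cdot>\<^sub>v v) = [:c:] \<odot>\<^bsub>mid X\<^esub> s v" if "v \<in> carrier_vec n" for c v
  proof -
    have "s (c \<cdot>\<^sub>v v) = (\<Oplus>\<^bsub>mid X\<^esub>j\<in>{..<l}. [:c:] \<odot>\<^bsub>mid X\<^esub> (coord ss j v \<odot>\<^bsub>mid X\<^esub> f j))"
      unfolding s_def
    proof (intro X.finsum_cong')
      fix j assume "j \<in> {..<l}"
      then show "coord ss j (c \<cdot>\<^sub>v v) \<odot>\<^bsub>mid X\<^esub> f j = [:c:] \<odot>\<^bsub>mid X\<^esub> (coord ss j v \<odot>\<^bsub>mid X\<^esub> f j)"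
        using X.smult_assoc1[of "[:c:]" "coord ss j v" "f j"] f(1) coord_smult[of v ss j c] that
        by (simp add: sum_ss length_ss)
    qed (use f(1) Xs in auto)
    also have "\<dots> = [:c:] \<odot>\<^bsub>mid X\<^esub> s v"
      unfolding s_def using f(1) Xs by (intro X.finsum_smult_ldistr[symmetric]) auto
    finally show ?thesis .
  qed
  have s_proj: "proj_map X (s v) = v" if v: "v \<in> carrier_vec n" for v
  proof -
    have "proj_map X (s v) = (\<Oplus>\<^bsub>M\<^esub>j\<in>{..<l}. proj_map X (coord ss j v \<odot>\<^bsub>mid X\<^esub> f j))"
      unfolding s_def using f(1) Xs by (intro module_hom_finsum[OF D(1) M.module_axioms D(3)]) auto
    also have "\<dots> = comb (\<lambda>j. coord ss j v)"
      unfolding comb_def using P(3) f(1,2) M_smult_closed by (intro M.finsum_cong') auto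
    finally show ?thesis using comb_coord[OF v] by simp
  qed
  have s_t: "[:0, 1:] \<odot>\<^bsub>mid X\<^esub> s v = s (A *\<^sub>v v) \<oplus>\<^bsub>mid X\<^esub> inj_map X (?\<Phi> *\<^sub>v v)"
    if v: "v \<in> carrier_vec n" for v
  proof -
    let ?w = "\<lambda>j. [:top_coeff j v:] \<odot>\<^bsub>M\<^esub> comb (\<lambda>i. \<epsilon> i j)"
    have w: "?w j \<in> carrier_vec n" for j by (intro M_smult_closed comb_carrier)
    \<comment> \<open>what the section misses is the multiple of \<open>p ^ \<lambda>\<^sub>j\<close> subtracted in reducing \<open>t (coord j v)\<close>\<close>
    have summand: "[:0, 1:] \<odot>\<^bsub>mid X\<^esub> (coord ss j v \<odot>\<^bsub>mid X\<^esub> f j) =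
        coord ss j (A *\<^sub>v v) \<odot>\<^bsub>mid X\<^esub> f j \<oplus>\<^bsub>mid X\<^esub> inj_map X (?w j)" if j: "j < l" for j
    proof -
      let ?q = "p ^ (ls ! j)"
      have "[:0, 1:] * coord ss j v = coord ss j (A *\<^sub>v v) + [:top_coeff j v:] * ?q"
        unfolding coord_A[OF v j] by simp
      then have "[:0, 1:] \<odot>\<^bsub>mid X\<^esub> (coord ss j v \<odot>\<^bsub>mid X\<^esub> f j) =
          (coord ss j (A *\<^sub>v v) + [:top_coeff j v:] * ?q) \<odot>\<^bsub>mid X\<^esub> f j"
        using X.smult_assoc1[of "[:0,1:]" "coord ss j v" "f j"] f(1)[OF j] by simp
      also have "\<dots> = coord ss j (A *\<^sub>v v) \<odot>\<^bsub>mid X\<^esub> f j \<oplus>\<^bsub>mid X\<^esub> [:top_coeff j v:] \<odot>\<^bsub>mid X\<^esub> (?q \<odot>\<^bsub>mid X\<^esub> f j)"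
        using X.smult_l_distr[of "coord ss j (A *\<^sub>v v)" "[:top_coeff j v:] * ?q" "f j"]
          X.smult_assoc1[of "[:top_coeff j v:]" ?q "f j"] f(1)[OF j] by simp
      also have "[:top_coeff j v:] \<odot>\<^bsub>mid X\<^esub> (?q \<odot>\<^bsub>mid X\<^esub> f j) = inj_map X (?w j)"
        using I(3)[of "[:top_coeff j v:]" "comb (\<lambda>i. \<epsilon> i j)"] comb_carrier f(3)[OF j] by simp
      finally show ?thesis .
    qed
    have "[:0, 1:] \<odot>\<^bsub>mid X\<^esub> s v = (\<Oplus>\<^bsub>mid X\<^esub>j\<in>{..<l}. [:0, 1:] \<odot>\<^bsub>mid X\<^esub> (coord ss j v \<odot>\<^bsub>mid X\<^esub> f j))"
      unfolding s_def using f(1) Xs by (intro X.finsum_smult_ldistr) auto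
    also have "\<dots> = (\<Oplus>\<^bsub>mid X\<^esub>j\<in>{..<l}. coord ss j (A *\<^sub>v v) \<odot>\<^bsub>mid X\<^esub> f j \<oplus>\<^bsub>mid X\<^esub> inj_map X (?w j))"
      using f(1) Xs D(8) w summand by (intro X.finsum_cong') auto
    also have "\<dots> = s (A *\<^sub>v v) \<oplus>\<^bsub>mid X\<^esub> (\<Oplus>\<^bsub>mid X\<^esub>j\<in>{..<l}. inj_map X (?w j))"
      unfolding s_def using f(1) Xs D(8) w by (intro X.finsum_addf) auto
    also have "(\<Oplus>\<^bsub>mid X\<^esub>j\<in>{..<l}. inj_map X (?w j)) = inj_map X (\<Oplus>\<^bsub>M\<^esub>j\<in>{..<l}. ?w j)"
      using w by (intro module_hom_finsum[OF M.module_axioms D(1,2), symmetric]) auto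
    also have "(\<Oplus>\<^bsub>M\<^esub>j\<in>{..<l}. ?w j) = ?\<Phi> *\<^sub>v v"
    proof (rule coord_eqI[of _ ss])
      fix i assume "i < length ss"
      then have i: "i < l" by (simp add: length_ss)
      have "coord ss i (\<Oplus>\<^bsub>M\<^esub>j\<in>{..<l}. ?w j) = (\<Sum>j<l. coord ss i (?w j))"
        using w i by (intro coord_finsum) auto
      also have "\<dots> = (\<Sum>j<l. Polynomial.smult (top_coeff j v) (\<epsilon> i j))"
      proof (intro sum.cong refl)
        fix j assume "j \<in> {..<l}"
        then have j: "j < l" by simp
        have "coord ss i (?w j) = Polynomial.smult (top_coeff j v) (coord ss i (comb (\<lambda>i. \<epsilon> i j)))"
          using coord_smult[of "comb (\<lambda>i. \<epsilon> i j)" ss i "top_coeff j v"] comb_carrier i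
          by (simp add: matrix_module_const[OF A_carrier comb_carrier] sum_ss length_ss)
        then show "coord ss i (?w j) = Polynomial.smult (top_coeff j v) (\<epsilon> i j)"
          using coord_comb_eq[OF i, of "\<lambda>i. \<epsilon> i j"] deg[OF i j] by simp
      qed
      also have "\<dots> = coord ss i (?\<Phi> *\<^sub>v v)"
        using coord_phi_mat[OF v i, of \<epsilon>] deg[OF i] by simp
      finally show "coord ss i (\<Oplus>\<^bsub>M\<^esub>j\<in>{..<l}. ?w j) = coord ss i (?\<Phi> *\<^sub>v v)" .
    qed (use w v \<Phi>v matrix_module_finsum(1)[OF A_carrier, of "{..<l}" ?w] in \<open>auto simp: sum_ss\<close>)
    finally show ?thesis .
  qed
  have "\<exists>a\<in>carrier M. x = inj_map X a \<oplus>\<^bsub>mid X\<^esub> s (proj_map X x)" if x: "x \<in> carrier (mid X)" for x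
    using extension_same_proj[OF M.module_axioms X x s_closed] s_proj D(9)[OF x] by simp
  then obtain r where r: "\<And>x. x \<in> carrier (mid X) \<Longrightarrow> r x \<in> carrier_vec n"
      "\<And>x. x \<in> carrier (mid X) \<Longrightarrow> x = inj_map X (r x) \<oplus>\<^bsub>mid X\<^esub> s (proj_map X x)"
    by (metis matrix_module_simps(1))
  have pr: "proj_map X x \<in> carrier_vec n" if "x \<in> carrier (mid X)" for x using D(9)[OF that] by simp
  have i_cl: "inj_map X a \<in> carrier (mid X)" if "a \<in> carrier_vec n" for a using D(8) that by simp
  have i_add: "inj_map X (a + b) = inj_map X a \<oplus>\<^bsub>mid X\<^esub> inj_map X b"
    if "a \<in> carrier_vec n" "b \<in> carrier_vec n" for a b using I(2)[of a b] that by simp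
  have r_unique: "r x = a"
    if x: "x \<in> carrier (mid X)" and a: "a \<in> carrier_vec n" and eq: "x = inj_map X a \<oplus>\<^bsub>mid X\<^esub> s (proj_map X x)"
    for x a
  proof -
    have "inj_map X (r x) \<oplus>\<^bsub>mid X\<^esub> s (proj_map X x) = inj_map X a \<oplus>\<^bsub>mid X\<^esub> s (proj_map X x)"
      using r(2)[OF x] eq by metis
    then have "inj_map X (r x) = inj_map X a"
      using X.add.right_cancel[of "s (proj_map X x)" "inj_map X (r x)" "inj_map X a"] i_cl r(1)[OF x] a s_closed by simp
    then show ?thesis using inj_onD[OF D(4)] r(1)[OF x] a by simp
  qed
  show ?thesis
  proof (rule that[of r])
    show "r x \<in> carrier_vec n" if "x \<in> carrier (mid X)" for x by (rule r(1)[OF that])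
  next
    fix x y assume xy: "x \<in> carrier (mid X)" "y \<in> carrier (mid X)"
    have "x \<oplus>\<^bsub>mid X\<^esub> y = (inj_map X (r x) \<oplus>\<^bsub>mid X\<^esub> s (proj_map X x)) \<oplus>\<^bsub>mid X\<^esub> (inj_map X (r y) \<oplus>\<^bsub>mid X\<^esub> s (proj_map X y))"
      using r(2)[OF xy(1)] r(2)[OF xy(2)] by simp
    also have "\<dots> = inj_map X (r x + r y) \<oplus>\<^bsub>mid X\<^esub> s (proj_map X x + proj_map X y)"
      using r(1)[OF xy(1)] r(1)[OF xy(2)] pr[OF xy(1)] pr[OF xy(2)] i_cl s_closed
      by (simp add: i_add s_add X.a_ac)
    finally have eq: "x \<oplus>\<^bsub>mid X\<^esub> y = inj_map X (r x + r y) \<oplus>\<^bsub>mid X\<^esub> s (proj_map X x + proj_map X y)" .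
    show "r (x \<oplus>\<^bsub>mid X\<^esub> y) = r x + r y"
    proof (rule r_unique)
      show "x \<oplus>\<^bsub>mid X\<^esub> y = inj_map X (r x + r y) \<oplus>\<^bsub>mid X\<^esub> s (proj_map X (x \<oplus>\<^bsub>mid X\<^esub> y))"
        using eq P(2)[OF xy] by simp
    qed (use xy r(1) in auto)
  next
    fix c x assume x: "x \<in> carrier (mid X)"
    have "[:c:] \<odot>\<^bsub>mid X\<^esub> x = [:c:] \<odot>\<^bsub>mid X\<^esub> (inj_map X (r x) \<oplus>\<^bsub>mid X\<^esub> s (proj_map X x))"
      using r(2)[OF x] by simp
    also have "\<dots> = inj_map X (c \<cdot>\<^sub>v r x) \<oplus>\<^bsub>mid X\<^esub> s (c \<cdot>\<^sub>v proj_map X x)"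
      using X.smult_r_distr[of "[:c:]" "inj_map X (r x)" "s (proj_map X x)"] I(3)[of "[:c:]" "r x"]
        r(1)[OF x] pr[OF x] i_cl s_closed s_const
      by (simp add: matrix_module_const[OF A_carrier])
    finally have eq: "[:c:] \<odot>\<^bsub>mid X\<^esub> x = inj_map X (c \<cdot>\<^sub>v r x) \<oplus>\<^bsub>mid X\<^esub> s (c \<cdot>\<^sub>v proj_map X x)" .
    show "r ([:c:] \<odot>\<^bsub>mid X\<^esub> x) = c \<cdot>\<^sub>v r x"
    proof (rule r_unique)
      show "[:c:] \<odot>\<^bsub>mid X\<^esub> x = inj_map X (c \<cdot>\<^sub>v r x) \<oplus>\<^bsub>mid X\<^esub> s (proj_map X ([:c:] \<odot>\<^bsub>mid X\<^esub> x))"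
        using eq P(3)[of "[:c:]" x] x pr[OF x] by (simp add: matrix_module_const[OF A_carrier])
    qed (use x r(1) Xs in auto)
  next
    fix x assume x: "x \<in> carrier (mid X)"
    let ?t = "[:0, 1:] :: 'k poly" and ?y = "proj_map X x"
    have "?t \<odot>\<^bsub>mid X\<^esub> x = ?t \<odot>\<^bsub>mid X\<^esub> (inj_map X (r x) \<oplus>\<^bsub>mid X\<^esub> s ?y)"
      using r(2)[OF x] by simp
    also have "\<dots> = inj_map X (A *\<^sub>v r x) \<oplus>\<^bsub>mid X\<^esub> (s (A *\<^sub>v ?y) \<oplus>\<^bsub>mid X\<^esub> inj_map X (?\<Phi> *\<^sub>v ?y))"
      using X.smult_r_distr[of ?t "inj_map X (r x)" "s ?y"] I(3)[of ?t "r x"] r(1)[OF x] pr[OF x] i_cl s_closed s_t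
      by (simp add: matrix_module_t[OF A_carrier])
    also have "\<dots> = inj_map X (A *\<^sub>v r x + ?\<Phi> *\<^sub>v ?y) \<oplus>\<^bsub>mid X\<^esub> s (A *\<^sub>v ?y)"
      using i_add[of "A *\<^sub>v r x" "?\<Phi> *\<^sub>v ?y"] r(1)[OF x] pr[OF x] Av \<Phi>v i_cl s_closed
      by (simp add: X.a_ac)
    finally have eq: "?t \<odot>\<^bsub>mid X\<^esub> x = inj_map X (A *\<^sub>v r x + ?\<Phi> *\<^sub>v ?y) \<oplus>\<^bsub>mid X\<^esub> s (A *\<^sub>v ?y)" .
    show "r (?t \<odot>\<^bsub>mid X\<^esub> x) = A *\<^sub>v r x + ?\<Phi> *\<^sub>v ?y"
    proof (rule r_unique)
      show "?t \<odot>\<^bsub>mid X\<^esub> x = inj_map X (A *\<^sub>v r x + ?\<Phi> *\<^sub>v ?y) \<oplus>\<^bsub>mid X\<^esub> s (proj_map X (?t \<odot>\<^bsub>mid X\<^esub> x))"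
        using eq P(3)[of ?t x] x pr[OF x] by (simp add: matrix_module_t[OF A_carrier])
    qed (use x r(1)[OF x] Xs Av \<Phi>v pr in auto)
  next
    fix a :: "'k vec" assume a: "a \<in> carrier_vec n"
    have "s (0\<^sub>v n) = s (0\<^sub>v n) \<oplus>\<^bsub>mid X\<^esub> s (0\<^sub>v n)" using s_add[of "0\<^sub>v n" "0\<^sub>v n"] by simp
    then have "s (0\<^sub>v n) = \<zero>\<^bsub>mid X\<^esub>" using X.add.r_cancel_one'[OF s_closed s_closed] by blast
    then show "r (inj_map X a) = a"
      using a D(7)[of a] i_cl[OF a] by (intro r_unique) auto
  qed
qed

end

section \<open>The matrix of the sum of the two classes\<close>

theorem theorem6p17:
  fixes \<pi> :: "'r::comm_ring_1"
    and red :: "'r \<Rightarrow> 'k::field"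
    and p :: "'k poly" and pR :: "'r poly"
    and ls :: "nat list" and d n :: nat
    and A :: "'k mat" and A0 :: "'r mat"
    and \<xi> :: "('k poly, 'k vec, 'k vec \<times> 'k vec, 'k vec) extension set"
    and \<epsilon> :: "nat \<Rightarrow> nat \<Rightarrow> 'k poly"
  assumes "local_ring (class_ring :: 'r ring)"
    and "principal_ideal_ring (class_ring :: 'r ring)"
    and "has_length (class_ring :: 'r ring) 2"
    and "maximalideal (PIdl\<^bsub>class_ring\<^esub> \<pi>) (class_ring :: 'r ring)"
    and "residue_map \<pi> red"
    and "lead_coeff p = 1" and "irreducible p" and "degree p = d"
    and "sorted_wrt (\<ge>) ls" and "\<forall>m\<in>set ls. m \<ge> 1"
    and "n = d * sum_list ls"
    and "A = companion_sum p ls"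
    and "lead_coeff pR = 1" and "map_poly red pR = p"
    and "A0 = companion_sum pR ls"
    and "\<xi> \<in> Ext1 class_ring (matrix_module n A) (matrix_module n A)"
    and "\<forall>i<length ls. \<forall>j<length ls.
           \<epsilon> i j \<in> ext_matrix p ls \<xi> i j \<and> degree (\<epsilon> i j) < d * ls ! i"
  shows "A_xi \<pi> red n A A0 \<xi> =
    congruence_conjugates red n
      (A0 + map_mat (pi_lift \<pi> red) (phi_mat (block_sizes d ls) \<epsilon>))"
proof -
  note loc = assms(1) and len = assms(3) and max = assms(4) and resid = assms(5)
  note \<epsilon> = assms(17)
  have "p \<noteq> 0" "\<not> p dvd 1" using assms(6,7) by auto
  then have "d > 0" using is_unit_iff_degree[of p] assms(8) by simp
  interpret primary_matrix p ls d n A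
    by unfold_locales (use assms \<open>d > 0\<close> in auto)
  have red: "comm_ring_hom red" "surj red" "red x = 0 \<longleftrightarrow> x \<in> PIdl\<^bsub>class_ring\<^esub> \<pi>" for x
    using resid unfolding residue_map_def by auto
  interpret comm_ring_hom red by (rule red(1))
  interpret length_two_reduction red \<pi>
  proof
    show "surj red" by (rule red(2))
    show "red x = 0 \<longleftrightarrow> (\<exists>y. x = \<pi> * y)" for x
      unfolding red(3) PIdl_class_ring by (auto simp: mult.commute)
    show "\<pi> * x = 0 \<longleftrightarrow> red x = 0" for x
      unfolding red(3) by (rule annihilator_of_uniformizer[OF loc len max])
  qed
  let ?h = "map_poly red" and ?\<Phi> = "phi_mat ss \<epsilon>"
  let ?M' = "restrict_scalars ?h M"
  let ?R = "\<lambda>X. \<lparr>mid = restrict_scalars ?h (mid X), inj_map = inj_map X, proj_map = proj_map X\<rparr>"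
  let ?Ae = "A0 + map_mat \<iota> ?\<Phi>"
  let ?W = "lift_extension \<pi> red n ?Ae"
  have redA0: "map_mat red A0 = A" using red_companion_sum[OF assms(13)] assms(12,14,15) by simp
  have A0: "A0 \<in> carrier_mat n n" using A_carrier redA0 by auto
  have Ae: "?Ae \<in> carrier_mat n n" using phi_mat_carrier[of \<epsilon>] by auto
  have redAe: "map_mat red ?Ae = A"
  proof (rule eq_matI)
    fix i j assume "i < dim_row A" "j < dim_col A"
    then have "i < n" "j < n" using A_carrier by auto
    then show "map_mat red ?Ae $$ (i, j) = A $$ (i, j)"
      using A0 phi_mat_carrier[of \<epsilon>] redA0 by (auto simp: hom_add)
  qed (use Ae A_carrier in auto)
  have M': "module class_ring ?M'" by (rule restrict_scalars_module[OF red_map_poly_hom M.module_axioms])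
  have W: "is_extension class_ring ?M' ?M' ?W" by (rule lift_extension_is_extension[OF Ae redAe])
  have L: "is_extension class_ring ?M' ?M' (lift_extension \<pi> red n A0)"
    by (rule lift_extension_is_extension[OF A0 redA0])
  obtain X0 :: "('k poly, 'k vec, 'k vec \<times> 'k vec, 'k vec) extension"
    where X0: "is_extension class_ring M M X0" and \<xi>_eq: "\<xi> = ext_class class_ring M M X0"
    using assms(16) unfolding Ext1_def by auto
  have \<xi>_ext: "is_extension class_ring M M X" and \<xi>_equiv: "ext_equiv class_ring M Y X"
    if "X \<in> \<xi>" "Y \<in> \<xi>" for X Y
    using that ext_equiv_trans[OF ext_equiv_sym[OF X0]] unfolding \<xi>_eq ext_class_def by auto
  \<comment> \<open>The members \<open>X'\<close> and \<open>Y\<close> of the two classes are only equivalent to \<open>X\<close> and to the extension given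
    by \<open>A0\<close>, so \<open>\<theta>\<close> is composed with the equivalences \<open>\<psi>\<close> and \<open>\<eta>\<close>.\<close>
  have baer: "ext_equiv class_ring ?M' ?W (baer_sum ?M' X' Y)"
    if X: "X \<in> \<xi>" and X': "X' \<in> ext_class class_ring ?M' ?M' (?R X)"
      and Y: "Y \<in> ext_class class_ring ?M' ?M' (lift_extension \<pi> red n A0)"
    for X and X' Y :: "('r poly, 'k vec, 'k vec \<times> 'k vec, 'k vec) extension"
  proof -
    have Xe: "is_extension class_ring M M X" by (rule \<xi>_ext[OF X X])
    have X'e: "is_extension class_ring ?M' ?M' X'" and Ye: "is_extension class_ring ?M' ?M' Y"
      using X' Y unfolding ext_class_def by auto
    obtain f where f: "\<And>j. j < l \<Longrightarrow> f j \<in> carrier (mid X)" "\<And>j. j < l \<Longrightarrow> proj_map X (f j) = e j"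
        "\<And>j. j < l \<Longrightarrow> p ^ (ls ! j) \<odot>\<^bsub>mid X\<^esub> f j = inj_map X (comb (\<lambda>i. \<epsilon> i j))"
      using adapted_lifts[OF Xe, of \<xi> \<epsilon>] \<xi>_ext \<xi>_equiv X \<epsilon> by blast
    have deg: "degree (\<epsilon> i j) < ss ! i" if "i < l" "j < l" for i j
      using \<epsilon> that by (simp add: ss_nth)
    obtain r where r: "\<And>x. x \<in> carrier (mid X) \<Longrightarrow> r x \<in> carrier_vec n"
        "\<And>x y. x \<in> carrier (mid X) \<Longrightarrow> y \<in> carrier (mid X) \<Longrightarrow> r (x \<oplus>\<^bsub>mid X\<^esub> y) = r x + r y"
        "\<And>c x. x \<in> carrier (mid X) \<Longrightarrow> r ([:c:] \<odot>\<^bsub>mid X\<^esub> x) = c \<cdot>\<^sub>v r x"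
        "\<And>x. x \<in> carrier (mid X) \<Longrightarrow> r ([:0, 1:] \<odot>\<^bsub>mid X\<^esub> x) = A *\<^sub>v r x + ?\<Phi> *\<^sub>v proj_map X x"
        "\<And>a. a \<in> carrier_vec n \<Longrightarrow> r (inj_map X a) = a"
    proof (rule retraction[OF Xe, of f \<epsilon>])
      fix r assume "\<And>x. x \<in> carrier (mid X) \<Longrightarrow> r x \<in> carrier_vec n"
        "\<And>x y. x \<in> carrier (mid X) \<Longrightarrow> y \<in> carrier (mid X) \<Longrightarrow> r (x \<oplus>\<^bsub>mid X\<^esub> y) = r x + r y"
        "\<And>c x. x \<in> carrier (mid X) \<Longrightarrow> r ([:c:] \<odot>\<^bsub>mid X\<^esub> x) = c \<cdot>\<^sub>v r x"
        "\<And>x. x \<in> carrier (mid X) \<Longrightarrow> r ([:0, 1:] \<odot>\<^bsub>mid X\<^esub> x) = A *\<^sub>v r x + ?\<Phi> *\<^sub>v proj_map X x"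
        "\<And>a. a \<in> carrier_vec n \<Longrightarrow> r (inj_map X a) = a"
      then show thesis by (rule that)
    qed (use f deg in auto)
    have "ext_equiv class_ring ?M' X' (?R X)"
      using ext_equiv_sym[OF restrict_scalars_extension[OF red_map_poly_hom Xe]] X'
      unfolding ext_class_def by blast
    then obtain \<psi> where \<psi>: "\<psi> \<in> LinearCombinations.module_hom class_ring (mid X') (restrict_scalars ?h (mid X))"
        "\<forall>a\<in>carrier ?M'. \<psi> (inj_map X' a) = inj_map X a"
        "\<forall>x\<in>carrier (mid X'). proj_map X (\<psi> x) = proj_map X' x"
      unfolding ext_equiv_def extension.simps by blast
    have "ext_equiv class_ring ?M' Y (lift_extension \<pi> red n A0)"
      using ext_equiv_sym[OF L] Y unfolding ext_class_def by blast
    then obtain \<eta> where \<eta>: "\<eta> \<in> LinearCombinations.module_hom class_ring (mid Y) (matrix_module n A0)"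
        "\<forall>a\<in>carrier ?M'. \<eta> (inj_map Y a) = map_vec \<iota> a"
        "\<forall>y\<in>carrier (mid Y). map_vec red (\<eta> y) = proj_map Y y"
      unfolding ext_equiv_def lift_extension_def extension.simps by blast
    note F = module_homD[OF \<psi>(1)] and G = module_homD[OF \<eta>(1)]
    have \<psi>_cl: "\<psi> x \<in> carrier (mid X)" "r (\<psi> x) \<in> carrier_vec n" if "x \<in> carrier (mid X')" for x
      using F(1)[OF that] r(1) by auto
    have \<eta>_cl: "\<eta> y \<in> carrier_vec n" if "y \<in> carrier (mid Y)" for y using G(1)[OF that] by simp
    show ?thesis
    proof (rule baer_sum_equiv_poly[OF M' M' X'e Ye W, where \<theta> = "\<lambda>x y. \<eta> y + map_vec \<iota> (r (\<psi> x))"])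
      fix x y assume xy: "x \<in> carrier (mid X')" "y \<in> carrier (mid Y)" "proj_map X' x = proj_map Y y"
      note c = \<psi>_cl[OF xy(1)] \<eta>_cl[OF xy(2)]
      have "map_vec red (\<eta> y + map_vec \<iota> (r (\<psi> x))) = map_vec red (\<eta> y)"
        using c by (intro eq_vecI) (auto simp: hom_add)
      then show "\<eta> y + map_vec \<iota> (r (\<psi> x)) \<in> carrier (mid ?W) \<and>
          proj_map ?W (\<eta> y + map_vec \<iota> (r (\<psi> x))) = proj_map X' x"
        using c bspec[OF \<eta>(3) xy(2)] xy(3) by (simp add: lift_extension_def)
      show "\<eta> ([:a:] \<odot>\<^bsub>mid Y\<^esub> y) + map_vec \<iota> (r (\<psi> ([:a:] \<odot>\<^bsub>mid X'\<^esub> x))) =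
          [:a:] \<odot>\<^bsub>mid ?W\<^esub> (\<eta> y + map_vec \<iota> (r (\<psi> x)))" for a
        using c xy F(3)[of "[:a:]" x] G(3)[of "[:a:]" y] r(3)[OF c(1)]
          smult_add_distrib_vec[OF c(3), of "map_vec \<iota> (r (\<psi> x))" a]
        by (simp add: lift_extension_def matrix_module_const[OF A0] matrix_module_const[OF Ae]
            map_poly_pCons pi_lift_vec_smult)
      show "\<eta> ([:0, 1:] \<odot>\<^bsub>mid Y\<^esub> y) + map_vec \<iota> (r (\<psi> ([:0, 1:] \<odot>\<^bsub>mid X'\<^esub> x))) =
          [:0, 1:] \<odot>\<^bsub>mid ?W\<^esub> (\<eta> y + map_vec \<iota> (r (\<psi> x)))"
        using c xy F(3)[of "[:0, 1:]" x] G(3)[of "[:0, 1:]" y] r(4)[OF c(1)] bspec[OF \<psi>(3) xy(1)] bspec[OF \<eta>(3) xy(2)]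
          deformed_action[OF A0 phi_mat_carrier[of \<epsilon>] c(3) c(2)]
        by (simp add: lift_extension_def matrix_module_t[OF A0] matrix_module_t[OF Ae] map_poly_pCons redA0)
    next
      fix x y x' y' assume xy: "x \<in> carrier (mid X')" "y \<in> carrier (mid Y)"
        "x' \<in> carrier (mid X')" "y' \<in> carrier (mid Y)"
      note c = \<psi>_cl[OF xy(1)] \<eta>_cl[OF xy(2)] \<psi>_cl[OF xy(3)] \<eta>_cl[OF xy(4)]
      have "\<psi> (x \<oplus>\<^bsub>mid X'\<^esub> x') = \<psi> x \<oplus>\<^bsub>mid X\<^esub> \<psi> x'" using F(2)[OF xy(1,3)] by simp
      moreover have "\<eta> (y \<oplus>\<^bsub>mid Y\<^esub> y') = \<eta> y + \<eta> y'" using G(2)[OF xy(2,4)] by simp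
      ultimately show "\<eta> (y \<oplus>\<^bsub>mid Y\<^esub> y') + map_vec \<iota> (r (\<psi> (x \<oplus>\<^bsub>mid X'\<^esub> x'))) =
          (\<eta> y + map_vec \<iota> (r (\<psi> x))) \<oplus>\<^bsub>mid ?W\<^esub> (\<eta> y' + map_vec \<iota> (r (\<psi> x')))"
        using c r(2)[OF c(1,4)] by (intro eq_vecI) (auto simp: lift_extension_def pi_lift_add)
    next
      fix a b assume "a \<in> carrier ?M'" "b \<in> carrier ?M'"
      then have ab: "a \<in> carrier_vec n" "b \<in> carrier_vec n" by simp_all
      then show "\<eta> (inj_map Y b) + map_vec \<iota> (r (\<psi> (inj_map X' a))) = inj_map ?W (a \<oplus>\<^bsub>?M'\<^esub> b)"
        using \<psi>(2) \<eta>(2) r(5) by (intro eq_vecI) (auto simp: lift_extension_def pi_lift_add)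
    qed
  qed
  show ?thesis
  proof (intro equalityI subsetI)
    fix B assume "B \<in> A_xi \<pi> red n A A0 \<xi>"
    then obtain X X' Y Z where X: "X \<in> \<xi>" "X' \<in> ext_class class_ring ?M' ?M' (?R X)"
        "Y \<in> ext_class class_ring ?M' ?M' (lift_extension \<pi> red n A0)"
      and Z: "Z \<in> ext_class class_ring ?M' ?M' (baer_sum ?M' X' Y)" and B: "is_t_matrix n Z B"
      unfolding A_xi_def Let_def ext_add_def ext_restrict_def by blast
    have Ze: "is_extension class_ring ?M' ?M' Z" and "ext_equiv class_ring ?M' ?W Z"
      using Z ext_equiv_trans[OF baer[OF X]] unfolding ext_class_def by auto
    then have "is_t_matrix n ?W B"
      using is_t_matrix_ext_equiv[OF Ze W ext_equiv_sym[OF W] B] by simp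
    then show "B \<in> congruence_conjugates red n ?Ae" using t_matrices_of_lift[OF Ae] by simp
  next
    fix B assume "B \<in> congruence_conjugates red n ?Ae"
    then have B: "is_t_matrix n ?W B" using t_matrices_of_lift[OF Ae] by simp
    have X0_in: "X0 \<in> \<xi>" unfolding \<xi>_eq by (rule ext_class_refl[OF X0])
    have X': "?R X0 \<in> ext_class class_ring ?M' ?M' (?R X0)"
      by (rule ext_class_refl[OF restrict_scalars_extension[OF red_map_poly_hom X0]])
    obtain Y where Y: "Y \<in> ext_class class_ring ?M' ?M' (lift_extension \<pi> red n A0)"
      using ext_class_nonempty[OF M' L] by blast
    obtain Z :: "('r poly, 'k vec, 'k vec \<times> 'k vec, 'k vec) extension"
      where Z: "is_extension class_ring ?M' ?M' Z" "ext_equiv class_ring ?M' ?W Z"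
      using ext_class_nonempty[OF M' W] unfolding ext_class_def by blast
    have "ext_equiv class_ring ?M' (baer_sum ?M' (?R X0) Y) Z"
      by (rule ext_equiv_trans[OF ext_equiv_sym[OF W baer[OF X0_in X' Y]] Z(2)])
    then have "Z \<in> ext_class class_ring ?M' ?M' (baer_sum ?M' (?R X0) Y)"
      unfolding ext_class_def using Z(1) by blast
    then have "Z \<in> ext_add class_ring ?M' ?M' (ext_restrict class_ring ?h M M \<xi>)
        (ext_class class_ring ?M' ?M' (lift_extension \<pi> red n A0))"
      unfolding ext_add_def ext_restrict_def using X0_in X' Y by blast
    moreover have "is_t_matrix n Z B" by (rule is_t_matrix_ext_equiv[OF W Z B])
    ultimately show "B \<in> A_xi \<pi> red n A A0 \<xi>" unfolding A_xi_def Let_def by blast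
  qed
qed

end
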